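(* Let $m,n\ge2$, let $\theta$ be a permutation of $\{1,\dots,m\}\times\{1,\dots,n\}$, and suppose $\mathbb{F}_\theta^+$ is periodic with minimal period $(a,-b)$, $a,b>0$. Then the C*-algebra $\mathfrak A=\sigma_1(\mathrm C^*(\mathbb{F}_\theta^+))$ described in the context is simple.
   Context: Semigroup. For a permutation $\theta$ of $\{1,\dots,m\}\times\{1,\dots,n\}$, $\mathbb{F}_\theta^+$ is the unital semigroup generated by $e_1,\dots,e_m,f_1,\dots,f_n$ subject only to the relations $e_if_j=f_{j'}e_{i'}$ whenever $\theta(i,j)=(i',j')$; $\varnothing$ denotes its identity. A word with $k$ $e$'s and $l$ $f$'s has degree $d(w)=(k,l)$. Every element of degree $(k,l)$ can be uniquely factored with any prescribed pattern of $k$ $e$'s and $l$ $f$'s. Write $\mathbf m=\{1,\dots,m\}$, $\mathbf n=\{1,\dots,n\}$, and $e_u=e_{i_1}\cdots e_{i_a}$ for $u=i_1\cdots i_a\in\mathbf m^a$, similarly $f_v$ for $v\in\mathbf n^b$. Tails and symmetry. A tail is an infinite word $\tau=e_{i_0}f_{j_0}e_{i_1}f_{j_1}\cdots$. Let $\tau_T=e_{i_0}f_{j_0}\cdots e_{i_{T-1}}f_{j_{T-1}}$. For integers $s,t\le 0$, choose $T>\max(|s|,|t|)$, factor $\tau_T=w_1w_2$ with $d(w_1)=(|s|,|t|)$, and write $w_2=e_iw'=f_jw''$; then $i_{s,t}:=i$, $j_{s,t}:=j$ (independent of $T$). The tail is $(p,q)$-periodic if $(i_{s+p,t+q},j_{s+p,t+q})=(i_{s,t},j_{s,t})$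 whenever $s,t,s+p,t+q\le0$. $H_\tau\subset\mathbb Z^2$ is the subgroup of those $(p,q)$ for which this equality holds for all $s,t\le T$, for some integer $T$. $\mathbb{F}_\theta^+$ is periodic if no tail has $H_\tau=\{(0,0)\}$. For $a,b>0$ it is $(a,-b)$-periodic if every tail is $(a,-b)$-periodic; equivalently there is a (unique) bijection $\gamma:\mathbf m^a\to\mathbf n^b$ with $e_uf_v=f_{\gamma(u)}e_{\gamma^{-1}(v)}$ for all $u\in\mathbf m^a$, $v\in\mathbf n^b$. The minimal period is the pair $(a,-b)$, $a,b>0$, with this property and $a$ smallest. C*-algebra. A $*$-representation of $\mathbb{F}_\theta^+$ is a representation $\sigma$ by isometries on a Hilbert space with $\sum_{i=1}^m\sigma(e_i)\sigma(e_i)^*=I=\sum_{j=1}^n\sigma(f_j)\sigma(f_j)^*$. $\mathrm C^*(\mathbb{F}_\theta^+)$ is the universal C*-algebra for $*$-representations; generators are denoted by the same letters. $W:=\sum_{u\in\mathbf m^a}f_{\gamma(u)}e_u^*\in \mathrm C^*(\mathbb{F}_\theta^+)$, a central unitary. The representation $\lambda_\tau$. For a tail $\tau$, let $\mathcal G_s=\mathbb{F}_\theta^+$ for $s\ge0$, $\rho_s:\mathcal G_s\to\mathcal G_{s+1}$, $\rho_s(g)=ge_{i_s}f_{j_s}$, $\mathcal G_\tau=\varinjlim(\mathcal G_s,\rho_s)$ with injections $\iota_s:\mathcal G_s\to\mathcal G_\tau$. $\mathbb{F}_\theta^+$ acts on $\mathcal G_\tau$ by $w\,\iota_s(x)=\iota_s(wx)$,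 and $\lambda_\tau(w)\xi_{g}=\xi_{wg}$ defines a $*$-representation on $\ell^2(\mathcal G_\tau)$ with orthonormal basis $\{\xi_g\}$. The algebra $\mathfrak A$. Let $\tau$ be a tail with $H_\tau=\mathbb Z(a,-b)$ (such a tail exists). The unitary $\lambda_\tau(W)$ permutes the basis $\{\xi_g\}$. Define $x\sim y$ on $\mathcal G_\tau$ if $\lambda_\tau(W)^k\xi_x=\xi_y$ for some $k\in\mathbb Z$. On $\ell^2(\mathcal G_\tau/\!\sim)$ with orthonormal basis $\{\zeta_{[x]}\}$ define $\sigma_1(w)\zeta_{[x]}=\zeta_{[wx]}$ for $w\in\mathbb{F}_\theta^+$; this is a well-defined $*$-representation and so extends to $\mathrm C^*(\mathbb{F}_\theta^+)$. Set $\mathfrak A=\sigma_1(\mathrm C^*(\mathbb{F}_\theta^+))$. *)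

theory Defs
  imports "HOL-Analysis.Analysis" "HOL-Algebra.Group"
begin

section \<open>The semigroup of a permutation\<close>

text \<open>
  The index sets of sizes \<open>m\<close> and \<open>n\<close> are finite types \<open>'m\<close> and \<open>'n\<close>; words are lists of
  generators, with \<open>GenE i\<close> for $e_i$ and \<open>GenF j\<close> for $f_j$.
\<close>

datatype ('m, 'n) gen = GenE 'm | GenF 'n

type_synonym ('m, 'n) word = "('m, 'n) gen list"

type_synonym ('m, 'n) perm = "'m \<times> 'n \<Rightarrow> 'm \<times> 'n"

inductive_set fstep :: "('m, 'n) perm \<Rightarrow> (('m, 'n) word \<times> ('m, 'n) word) set"
  for \<theta> :: "('m, 'n) perm" where
  "\<theta> (i, j) = (i', j') \<Longrightarrow> (x @ [GenE i, GenF j] @ y, x @ [GenF j', GenE i'] @ y) \<in> fstep \<theta>"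

definition fcong :: "('m, 'n) perm \<Rightarrow> (('m, 'n) word \<times> ('m, 'n) word) set" where
  "fcong \<theta> = (fstep \<theta> \<union> (fstep \<theta>)\<inverse>)\<^sup>*"

type_synonym ('m, 'n) sem = "('m, 'n) word set"

definition cls :: "('m, 'n) perm \<Rightarrow> ('m, 'n) word \<Rightarrow> ('m, 'n) sem" where
  "cls \<theta> w = fcong \<theta> `` {w}"

definition Ftheta :: "('m, 'n) perm \<Rightarrow> ('m, 'n) sem monoid" where
  "Ftheta \<theta> = \<lparr>carrier = UNIV // fcong \<theta>,
     mult = (\<lambda>X Y. \<Union>x\<in>X. \<Union>y\<in>Y. cls \<theta> (x @ y)),
     one = cls \<theta> []\<rparr>"

definition eword :: "('m, 'n) perm \<Rightarrow> 'm list \<Rightarrow> ('m, 'n) sem" where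
  "eword \<theta> u = cls \<theta> (map GenE u)"

definition fword :: "('m, 'n) perm \<Rightarrow> 'n list \<Rightarrow> ('m, 'n) sem" where
  "fword \<theta> v = cls \<theta> (map GenF v)"

fun wdeg :: "('m, 'n) word \<Rightarrow> nat \<times> nat" where
  "wdeg [] = (0, 0)"
| "wdeg (GenE i # w) = (Suc (fst (wdeg w)), snd (wdeg w))"
| "wdeg (GenF j # w) = (fst (wdeg w), Suc (snd (wdeg w)))"

text \<open>The relations preserve \<open>wdeg\<close>, so it is constant on classes.\<close>

definition deg :: "('m, 'n) sem \<Rightarrow> nat \<times> nat" where
  "deg X = (THE d. \<forall>w\<in>X. wdeg w = d)"


lemma equiv_fcong: "equiv UNIV (fcong \<theta>)"
proof (rule equivI)
  show "sym (fcong \<theta>)"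
    unfolding fcong_def by (intro sym_rtrancl) (auto simp: sym_def)
qed (auto simp: fcong_def intro: refl_rtrancl trans_rtrancl)

lemma fstep_append: "(v, w) \<in> fstep \<theta> \<Longrightarrow> (x @ v @ y, x @ w @ y) \<in> fstep \<theta>"
proof (induction rule: fstep.induct)
  case (1 i j i' j' a b)
  then have "((x @ a) @ [GenE i, GenF j] @ (b @ y), (x @ a) @ [GenF j', GenE i'] @ (b @ y)) \<in> fstep \<theta>"
    by (rule fstep.intros)
  then show ?case by simp
qed

lemma fcong_append1: "(v, w) \<in> fcong \<theta> \<Longrightarrow> (x @ v @ y, x @ w @ y) \<in> fcong \<theta>"
  unfolding fcong_def
proof (induction rule: rtrancl_induct)
  case (step w z)
  then have "(x @ w @ y, x @ z @ y) \<in> fstep \<theta> \<union> (fstep \<theta>)\<inverse>"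
    by (auto intro: fstep_append)
  with step.IH show ?case by (rule rtrancl_into_rtrancl)
qed simp

lemma fcong_append:
  assumes "(v, v') \<in> fcong \<theta>" "(w, w') \<in> fcong \<theta>"
  shows "(v @ w, v' @ w') \<in> fcong \<theta>"
proof -
  have "(v @ w, v' @ w) \<in> fcong \<theta>" "(v' @ w, v' @ w') \<in> fcong \<theta>"
    using fcong_append1[OF assms(1), of "[]" w] fcong_append1[OF assms(2), of v' "[]"] by simp_all
  then show ?thesis unfolding fcong_def by (rule rtrancl_trans)
qed

lemma cls_eq_iff: "cls \<theta> v = cls \<theta> w \<longleftrightarrow> (v, w) \<in> fcong \<theta>"
  unfolding cls_def using eq_equiv_class_iff[OF equiv_fcong] by blast

lemma self_in_cls: "w \<in> cls \<theta> w"
  unfolding cls_def using equiv_fcong by (rule equiv_class_self) simp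

lemma in_cls_iff: "v \<in> cls \<theta> w \<longleftrightarrow> (w, v) \<in> fcong \<theta>"
  by (simp add: cls_def)

lemma mult_cls: "mult (Ftheta \<theta>) (cls \<theta> v) (cls \<theta> w) = cls \<theta> (v @ w)"
proof -
  have *: "cls \<theta> (x @ y) = cls \<theta> (v @ w)" if "x \<in> cls \<theta> v" "y \<in> cls \<theta> w" for x y
    using fcong_append[of v x \<theta> w y] that unfolding in_cls_iff cls_eq_iff[symmetric] by simp
  have "mult (Ftheta \<theta>) (cls \<theta> v) (cls \<theta> w) = (\<Union>x\<in>cls \<theta> v. \<Union>y\<in>cls \<theta> w. cls \<theta> (x @ y))"
    by (simp add: Ftheta_def)
  also have "\<dots> = (\<Union>x\<in>cls \<theta> v. \<Union>y\<in>cls \<theta> w. cls \<theta> (v @ w))"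
    by (intro SUP_cong refl *)
  also have "\<dots> = cls \<theta> (v @ w)"
    using self_in_cls[of v \<theta>] self_in_cls[of w \<theta>] by blast
  finally show ?thesis .
qed

lemma carrier_Ftheta: "carrier (Ftheta \<theta>) = range (cls \<theta>)"
  by (auto simp: Ftheta_def cls_def quotient_def)

lemma monoid_Ftheta: "monoid (Ftheta \<theta>)"
proof (rule monoidI)
  show "\<one>\<^bsub>Ftheta \<theta>\<^esub> \<in> carrier (Ftheta \<theta>)"
    unfolding carrier_Ftheta by (simp add: Ftheta_def)
  fix x y z
  assume "x \<in> carrier (Ftheta \<theta>)" "y \<in> carrier (Ftheta \<theta>)" "z \<in> carrier (Ftheta \<theta>)"
  then obtain u v w where "x = cls \<theta> u" "y = cls \<theta> v" "z = cls \<theta> w"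
    by (auto simp: carrier_Ftheta)
  then show "x \<otimes>\<^bsub>Ftheta \<theta>\<^esub> y \<otimes>\<^bsub>Ftheta \<theta>\<^esub> z = x \<otimes>\<^bsub>Ftheta \<theta>\<^esub> (y \<otimes>\<^bsub>Ftheta \<theta>\<^esub> z)"
    by (simp add: mult_cls)
next
  fix x y
  assume "x \<in> carrier (Ftheta \<theta>)" "y \<in> carrier (Ftheta \<theta>)"
  then obtain u v where "x = cls \<theta> u" "y = cls \<theta> v"
    by (auto simp: carrier_Ftheta)
  then show "x \<otimes>\<^bsub>Ftheta \<theta>\<^esub> y \<in> carrier (Ftheta \<theta>)"
    by (simp add: carrier_Ftheta mult_cls)
next
  have one: "\<one>\<^bsub>Ftheta \<theta>\<^esub> = cls \<theta> []" by (simp add: Ftheta_def)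
  fix x assume "x \<in> carrier (Ftheta \<theta>)"
  then obtain u where "x = cls \<theta> u"
    by (auto simp: carrier_Ftheta)
  then show "\<one>\<^bsub>Ftheta \<theta>\<^esub> \<otimes>\<^bsub>Ftheta \<theta>\<^esub> x = x" "x \<otimes>\<^bsub>Ftheta \<theta>\<^esub> \<one>\<^bsub>Ftheta \<theta>\<^esub> = x"
    by (simp_all only: one mult_cls append_Nil append_Nil2)
qed


section \<open>Tails and periodicity\<close>

text \<open>The tail $e_{i_0}f_{j_0}e_{i_1}f_{j_1}\cdots$ is the function with \<open>\<tau> s = (i_s, j_s)\<close>.\<close>

type_synonym ('m, 'n) tail = "nat \<Rightarrow> 'm \<times> 'n"

definition tail_word :: "('m, 'n) perm \<Rightarrow> ('m, 'n) tail \<Rightarrow> nat \<Rightarrow> ('m, 'n) sem" where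
  "tail_word \<theta> \<tau> T = cls \<theta> (concat (map (\<lambda>s. [GenE (fst (\<tau> s)), GenF (snd (\<tau> s))]) [0..<T]))"

text \<open>
  \<open>tail_cut \<theta> \<tau> s t w\<^sub>2\<close>: for some \<open>T\<close> large enough, \<open>w\<^sub>2\<close> is what remains of \<open>\<tau>\<^sub>T\<close> after
  removing a left factor of degree \<open>(\<bar>s\<bar>, \<bar>t\<bar>)\<close>.
\<close>

definition tail_cut ::
  "('m, 'n) perm \<Rightarrow> ('m, 'n) tail \<Rightarrow> int \<Rightarrow> int \<Rightarrow> ('m, 'n) sem \<Rightarrow> bool" where
  "tail_cut \<theta> \<tau> s t w2 \<longleftrightarrow>
     w2 \<in> carrier (Ftheta \<theta>) \<and>
     (\<exists>T. \<exists>w1\<in>carrier (Ftheta \<theta>).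
        int T > max \<bar>s\<bar> \<bar>t\<bar> \<and> deg w1 = (nat \<bar>s\<bar>, nat \<bar>t\<bar>) \<and>
        tail_word \<theta> \<tau> T = w1 \<otimes>\<^bsub>Ftheta \<theta>\<^esub> w2)"

definition tail_i :: "('m, 'n) perm \<Rightarrow> ('m, 'n) tail \<Rightarrow> int \<Rightarrow> int \<Rightarrow> 'm" where
  "tail_i \<theta> \<tau> s t = (THE i. \<exists>w2. tail_cut \<theta> \<tau> s t w2 \<and>
     (\<exists>w'\<in>carrier (Ftheta \<theta>). w2 = eword \<theta> [i] \<otimes>\<^bsub>Ftheta \<theta>\<^esub> w'))"

definition tail_j :: "('m, 'n) perm \<Rightarrow> ('m, 'n) tail \<Rightarrow> int \<Rightarrow> int \<Rightarrow> 'n" where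
  "tail_j \<theta> \<tau> s t = (THE j. \<exists>w2. tail_cut \<theta> \<tau> s t w2 \<and>
     (\<exists>w'\<in>carrier (Ftheta \<theta>). w2 = fword \<theta> [j] \<otimes>\<^bsub>Ftheta \<theta>\<^esub> w'))"

definition tail_periodic_below ::
  "('m, 'n) perm \<Rightarrow> ('m, 'n) tail \<Rightarrow> int \<Rightarrow> int \<Rightarrow> int \<Rightarrow> bool" where
  "tail_periodic_below \<theta> \<tau> T p q \<longleftrightarrow>
     (\<forall>s t. s \<le> T \<and> t \<le> T \<and> s \<le> 0 \<and> t \<le> 0 \<and> s + p \<le> 0 \<and> t + q \<le> 0 \<longrightarrow>
        (tail_i \<theta> \<tau> (s + p) (t + q), tail_j \<theta> \<tau> (s + p) (t + q)) =
        (tail_i \<theta> \<tau> s t, tail_j \<theta> \<tau> s t))"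

definition tail_periodic :: "('m, 'n) perm \<Rightarrow> ('m, 'n) tail \<Rightarrow> int \<Rightarrow> int \<Rightarrow> bool" where
  "tail_periodic \<theta> \<tau> p q \<longleftrightarrow> tail_periodic_below \<theta> \<tau> 0 p q"

definition H_tail :: "('m, 'n) perm \<Rightarrow> ('m, 'n) tail \<Rightarrow> (int \<times> int) set" where
  "H_tail \<theta> \<tau> = {(p, q). \<exists>T. tail_periodic_below \<theta> \<tau> T p q}"

definition periodic_semigroup :: "('m, 'n) perm \<Rightarrow> bool" where
  "periodic_semigroup \<theta> \<longleftrightarrow> \<not> (\<exists>\<tau>. H_tail \<theta> \<tau> = {(0, 0)})"

definition all_tails_periodic :: "('m, 'n) perm \<Rightarrow> nat \<Rightarrow> nat \<Rightarrow> bool" where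
  "all_tails_periodic \<theta> a b \<longleftrightarrow> (\<forall>\<tau>. tail_periodic \<theta> \<tau> (int a) (- int b))"

definition minimal_period :: "('m, 'n) perm \<Rightarrow> nat \<Rightarrow> nat \<Rightarrow> bool" where
  "minimal_period \<theta> a b \<longleftrightarrow> a > 0 \<and> b > 0 \<and> all_tails_periodic \<theta> a b \<and>
     (\<forall>a' b'. a' > 0 \<and> b' > 0 \<and> all_tails_periodic \<theta> a' b' \<longrightarrow> a \<le> a')"

definition period_bijection ::
  "('m, 'n) perm \<Rightarrow> nat \<Rightarrow> nat \<Rightarrow> ('m list \<Rightarrow> 'n list) \<Rightarrow> bool" where
  "period_bijection \<theta> a b \<gamma> \<longleftrightarrow>
     bij_betw \<gamma> {u. length u = a} {v. length v = b} \<and>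
     (\<forall>u v. length u = a \<and> length v = b \<longrightarrow>
        eword \<theta> u \<otimes>\<^bsub>Ftheta \<theta>\<^esub> fword \<theta> v =
        fword \<theta> (\<gamma> u) \<otimes>\<^bsub>Ftheta \<theta>\<^esub> eword \<theta> (inv_into {u. length u = a} \<gamma> v))"


section \<open>The Hilbert spaces\<close>

typedef 'x ell2 = "{f :: 'x \<Rightarrow> complex. (\<lambda>k. (cmod (f k))\<^sup>2) summable_on UNIV}"
  morphisms coord Abs_ell2
proof
  show "(\<lambda>_. 0) \<in> {f :: 'x \<Rightarrow> complex. (\<lambda>k. (cmod (f k))\<^sup>2) summable_on UNIV}" by simp
qed

setup_lifting type_definition_ell2

lemma sq_cmod_add_le: "(cmod (a + b))\<^sup>2 \<le> 2 * (cmod a)\<^sup>2 + 2 * (cmod b)\<^sup>2"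
proof -
  have "(cmod (a + b))\<^sup>2 \<le> (cmod a + cmod b)\<^sup>2"
    by (intro power_mono norm_triangle_ineq) simp
  also have "\<dots> \<le> 2 * (cmod a)\<^sup>2 + 2 * (cmod b)\<^sup>2"
    using sum_squares_bound[of "cmod a" "cmod b"] by (simp add: power2_sum)
  finally show ?thesis .
qed

lemma ell2_summable_add:
  assumes "(\<lambda>k. (cmod (f k))\<^sup>2) summable_on UNIV" "(\<lambda>k. (cmod (g k))\<^sup>2) summable_on UNIV"
  shows "(\<lambda>k. (cmod (f k + g k))\<^sup>2) summable_on UNIV"
proof (rule summable_on_comparison_test)
  show "(\<lambda>k. 2 * (cmod (f k))\<^sup>2 + 2 * (cmod (g k))\<^sup>2) summable_on UNIV"
    by (intro summable_on_add summable_on_cmult_right assms)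
qed (auto intro: sq_cmod_add_le)

lemma ell2_summable_scale:
  assumes "(\<lambda>k. (cmod (f k))\<^sup>2) summable_on UNIV"
  shows "(\<lambda>k. (cmod (c * f k))\<^sup>2) summable_on UNIV"
  unfolding norm_mult power_mult_distrib by (rule summable_on_cmult_right[OF assms])

lift_definition cscale :: "complex \<Rightarrow> 'x ell2 \<Rightarrow> 'x ell2" is "\<lambda>c f k. c * f k"
  by (rule ell2_summable_scale)

lift_definition restr :: "'x set \<Rightarrow> 'x ell2 \<Rightarrow> 'x ell2" is "\<lambda>S f k. if k \<in> S then f k else 0"
proof -
  fix S :: "'x set" and f :: "'x \<Rightarrow> complex"
  assume "(\<lambda>k. (cmod (f k))\<^sup>2) summable_on UNIV"
  then show "(\<lambda>k. (cmod (if k \<in> S then f k else 0))\<^sup>2) summable_on UNIV"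
    by (rule summable_on_comparison_test) auto
qed

lift_definition ket :: "'x \<Rightarrow> 'x ell2" is "\<lambda>g k. if k = g then 1 else 0"
proof -
  fix g :: 'x
  have "{k. (cmod (if k = g then 1 else 0))\<^sup>2 \<noteq> 0} \<subseteq> {g}" by auto
  then have "finite {k \<in> UNIV. (cmod (if k = g then 1 else 0))\<^sup>2 \<noteq> 0}"
    by (simp add: finite_subset)
  then show "(\<lambda>k. (cmod (if k = g then 1 else 0))\<^sup>2) summable_on UNIV"
    by (rule finite_nonzero_values_imp_summable_on)
qed

definition cinner :: "'x ell2 \<Rightarrow> 'x ell2 \<Rightarrow> complex" where
  "cinner x y = (\<Sum>\<^sub>\<infinity>k. coord x k * cnj (coord y k))"

lemma coord_summable: "(\<lambda>k. (cmod (coord x k))\<^sup>2) summable_on UNIV"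
  using coord[of x] by simp

lemma cinner_summable: "(\<lambda>k. coord x k * cnj (coord y k)) summable_on UNIV"
proof (rule abs_summable_summable)
  show "(\<lambda>k. norm (coord x k * cnj (coord y k))) summable_on UNIV"
  proof (rule summable_on_comparison_test)
    show "(\<lambda>k. (cmod (coord x k))\<^sup>2 + (cmod (coord y k))\<^sup>2) summable_on UNIV"
      by (intro summable_on_add coord_summable)
    fix k
    have "2 * (cmod (coord x k) * cmod (coord y k)) \<le> (cmod (coord x k))\<^sup>2 + (cmod (coord y k))\<^sup>2"
      using sum_squares_bound[of "cmod (coord x k)" "cmod (coord y k)"] by (simp add: mult.assoc)
    moreover have "0 \<le> cmod (coord x k) * cmod (coord y k)" by simp
    ultimately show "norm (coord x k * cnj (coord y k)) \<le> (cmod (coord x k))\<^sup>2 + (cmod (coord y k))\<^sup>2"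
      unfolding norm_mult complex_mod_cnj by linarith
  qed simp
qed

instantiation ell2 :: (type) real_inner
begin

lift_definition zero_ell2 :: "'a ell2" is "\<lambda>_. 0" by simp
lift_definition plus_ell2 :: "'a ell2 \<Rightarrow> 'a ell2 \<Rightarrow> 'a ell2" is "\<lambda>f g k. f k + g k"
  by (rule ell2_summable_add)
lift_definition uminus_ell2 :: "'a ell2 \<Rightarrow> 'a ell2" is "\<lambda>f k. - f k" by simp
definition minus_ell2 :: "'a ell2 \<Rightarrow> 'a ell2 \<Rightarrow> 'a ell2" where "minus_ell2 x y = x + (- y)"
definition scaleR_ell2 :: "real \<Rightarrow> 'a ell2 \<Rightarrow> 'a ell2" where
  "scaleR_ell2 r x = cscale (complex_of_real r) x"
definition inner_ell2 :: "'a ell2 \<Rightarrow> 'a ell2 \<Rightarrow> real" where "inner_ell2 x y = Re (cinner x y)"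
definition norm_ell2 :: "'a ell2 \<Rightarrow> real" where "norm_ell2 x = sqrt (x \<bullet> x)"
definition sgn_ell2 :: "'a ell2 \<Rightarrow> 'a ell2" where "sgn_ell2 x = scaleR (inverse (norm x)) x"
definition dist_ell2 :: "'a ell2 \<Rightarrow> 'a ell2 \<Rightarrow> real" where "dist_ell2 x y = norm (x - y)"
definition uniformity_ell2 :: "('a ell2 \<times> 'a ell2) filter" where
  "uniformity_ell2 = (INF e\<in>{0<..}. principal {(x, y). dist x y < e})"
definition open_ell2 :: "'a ell2 set \<Rightarrow> bool" where
  "open_ell2 U = (\<forall>x\<in>U. eventually (\<lambda>(x', y). x' = x \<longrightarrow> y \<in> U) uniformity)"

instance
proof
  fix x y z :: "'a ell2" and r s :: real
  show "x + y + z = x + (y + z)" by transfer (simp add: add.assoc)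
  show "x + y = y + x" by transfer (simp add: add.commute)
  show "0 + x = x" by transfer simp
  show "- x + x = 0" by transfer simp
  show "x - y = x + - y" by (simp add: minus_ell2_def)
  show "r *\<^sub>R (x + y) = r *\<^sub>R x + r *\<^sub>R y"
    unfolding scaleR_ell2_def by transfer (simp add: algebra_simps)
  show "(r + s) *\<^sub>R x = r *\<^sub>R x + s *\<^sub>R x"
    unfolding scaleR_ell2_def by transfer (simp add: algebra_simps)
  show "r *\<^sub>R s *\<^sub>R x = (r * s) *\<^sub>R x"
    unfolding scaleR_ell2_def by transfer (simp add: algebra_simps)
  show "1 *\<^sub>R x = x"
    unfolding scaleR_ell2_def by transfer simp
  show "sgn x = scaleR (inverse (norm x)) x" by (simp add: sgn_ell2_def)
  show "dist x y = norm (x - y)" by (simp add: dist_ell2_def)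
  show "uniformity = (INF e\<in>{0<..}. principal {(x, y :: 'a ell2). dist x y < e})"
    by (simp add: uniformity_ell2_def)
  show "open U \<longleftrightarrow> (\<forall>x\<in>U. \<forall>\<^sub>F (x', y) in uniformity. x' = x \<longrightarrow> y \<in> U)" for U :: "'a ell2 set"
    by (simp add: open_ell2_def)
  have cinner_swap: "cinner x y = cnj (cinner y x)"
    unfolding cinner_def infsum_cnj[symmetric] by (simp add: mult.commute)
  then show "x \<bullet> y = y \<bullet> x" by (simp add: inner_ell2_def)
  have "cinner (x + y) z = cinner x z + cinner y z"
    unfolding cinner_def infsum_add[OF cinner_summable cinner_summable, symmetric]
    by (simp add: plus_ell2.rep_eq algebra_simps)
  then show "(x + y) \<bullet> z = x \<bullet> z + y \<bullet> z" by (simp add: inner_ell2_def)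
  have "cinner (r *\<^sub>R x) y = complex_of_real r * cinner x y"
    unfolding cinner_def infsum_cmult_right[OF cinner_summable, symmetric]
    by (simp add: scaleR_ell2_def cscale.rep_eq algebra_simps)
  then show "(r *\<^sub>R x) \<bullet> y = r * (x \<bullet> y)" by (simp add: inner_ell2_def)
  have inner_self: "x \<bullet> x = (\<Sum>\<^sub>\<infinity>k. (cmod (coord x k))\<^sup>2)"
  proof -
    have "x \<bullet> x = (\<Sum>\<^sub>\<infinity>k. Re (coord x k * cnj (coord x k)))"
      unfolding inner_ell2_def cinner_def by (rule infsum_Re[OF cinner_summable, symmetric])
    also have "\<dots> = (\<Sum>\<^sub>\<infinity>k. (cmod (coord x k))\<^sup>2)"
      by (rule infsum_cong) (simp only: complex_mult_cnj Re_complex_of_real cmod_power2)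
    finally show ?thesis .
  qed
  show "0 \<le> x \<bullet> x" unfolding inner_self by (rule infsum_nonneg) simp
  show "x \<bullet> x = 0 \<longleftrightarrow> x = 0"
  proof
    assume "x \<bullet> x = 0"
    then have "(cmod (coord x k))\<^sup>2 = 0" for k
      unfolding inner_self by (intro nonneg_infsum_le_0D[OF _ coord_summable]) auto
    then show "x = 0" by (simp add: coord_inject[symmetric] zero_ell2.rep_eq fun_eq_iff)
  next
    assume "x = 0"
    then have "coord x = (\<lambda>_. 0)" by (simp add: zero_ell2.rep_eq)
    then show "x \<bullet> x = 0" unfolding inner_self by simp
  qed
  show "norm x = sqrt (x \<bullet> x)" by (simp add: norm_ell2_def)
qed

end

text \<open>
  Up to unitary equivalence every Hilbert space is \<open>\<ell>\<^sup>2(S)\<close> for a set \<open>S\<close>. It is treated as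
  the subspace of \<open>'x ell2\<close> of the vectors supported in \<open>S :: 'x set\<close>, and a bounded operator
  on it as an element of the corresponding corner of the bounded operators on \<open>'x ell2\<close>;
  its unit is the projection \<open>id_on S\<close>. Elements of \<open>'x ell2 \<Rightarrow>\<^sub>L 'x ell2\<close> are only
  real-linear in general.
\<close>

type_synonym 'x oper = "'x ell2 \<Rightarrow>\<^sub>L 'x ell2"

definition ops_on :: "'x set \<Rightarrow> 'x oper set" where
  "ops_on S = {T. (\<forall>c x. blinfun_apply T (cscale c x) = cscale c (blinfun_apply T x)) \<and>
                  (\<forall>x. restr S (blinfun_apply T (restr S x)) = blinfun_apply T x)}"

definition id_on :: "'x set \<Rightarrow> 'x oper" where
  "id_on S = Blinfun (restr S)"

definition op_cscale :: "complex \<Rightarrow> 'x oper \<Rightarrow> 'x oper" where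
  "op_cscale c T = Blinfun (\<lambda>x. cscale c (blinfun_apply T x))"

definition adj :: "'x oper \<Rightarrow> 'x oper" where
  "adj T = (THE T'. \<forall>x y. cinner (blinfun_apply T x) y = cinner x (blinfun_apply T' y))"

lemma norm_ell2_sq: "(norm x)\<^sup>2 = (\<Sum>\<^sub>\<infinity>k. (cmod (coord x k))\<^sup>2)"
proof -
  have "(norm x)\<^sup>2 = Re (cinner x x)"
    by (simp add: power2_norm_eq_inner inner_ell2_def)
  also have "\<dots> = (\<Sum>\<^sub>\<infinity>k. Re (coord x k * cnj (coord x k)))"
    unfolding cinner_def by (rule infsum_Re[OF cinner_summable, symmetric])
  also have "\<dots> = (\<Sum>\<^sub>\<infinity>k. (cmod (coord x k))\<^sup>2)"
    by (rule infsum_cong) (simp only: complex_mult_cnj Re_complex_of_real cmod_power2)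
  finally show ?thesis .
qed

lemma norm_restr_le: "norm (restr S x) \<le> norm x"
proof (rule power2_le_imp_le)
  show "(norm (restr S x))\<^sup>2 \<le> (norm x)\<^sup>2"
    unfolding norm_ell2_sq
    by (rule infsum_mono[OF coord_summable coord_summable]) (simp add: restr.rep_eq)
qed simp

lemma norm_cscale: "norm (cscale c x) = cmod c * norm x"
proof -
  have "(norm (cscale c x))\<^sup>2 = (cmod c * norm x)\<^sup>2"
    unfolding norm_ell2_sq power_mult_distrib
    by (subst infsum_cmult_right[OF coord_summable, symmetric])
       (simp add: cscale.rep_eq norm_mult power_mult_distrib)
  then show ?thesis by simp
qed

lemma bounded_linear_restr: "bounded_linear (restr S :: 'x ell2 \<Rightarrow> 'x ell2)"
proof (rule bounded_linear_intro[where K = 1])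
  show "restr S (x + y) = restr S x + restr S y" for x y :: "'x ell2" by transfer auto
  show "restr S (r *\<^sub>R x) = r *\<^sub>R restr S x" for r and x :: "'x ell2"
    unfolding scaleR_ell2_def by transfer auto
  show "norm (restr S x) \<le> norm x * 1" for x :: "'x ell2" by (simp add: norm_restr_le)
qed

lemma bounded_linear_cscale: "bounded_linear (cscale c :: 'x ell2 \<Rightarrow> 'x ell2)"
proof (rule bounded_linear_intro[where K = "cmod c"])
  show "cscale c (x + y) = cscale c x + cscale c y" for x y :: "'x ell2"
    by transfer (simp add: algebra_simps)
  show "cscale c (r *\<^sub>R x) = r *\<^sub>R cscale c x" for r and x :: "'x ell2"
    unfolding scaleR_ell2_def by transfer (simp add: algebra_simps)
  show "norm (cscale c x) \<le> norm x * cmod c" for x :: "'x ell2" by (simp add: norm_cscale mult.commute)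
qed

lemma id_on_apply [simp]: "blinfun_apply (id_on S) x = restr S x"
  unfolding id_on_def by (simp add: bounded_linear_Blinfun_apply bounded_linear_restr)

lemma op_cscale_apply [simp]: "blinfun_apply (op_cscale c T) x = cscale c (blinfun_apply T x)"
  unfolding op_cscale_def
  by (subst bounded_linear_Blinfun_apply)
     (auto intro: bounded_linear_compose[OF bounded_linear_cscale] blinfun.bounded_linear_right)

text \<open>The bounded operator on \<open>\<ell>\<^sup>2(S)\<close> mapping the basis vector of \<open>g\<close> to that of \<open>\<phi> g\<close>.\<close>

definition basis_op :: "'x set \<Rightarrow> ('x \<Rightarrow> 'x) \<Rightarrow> 'x oper" where
  "basis_op S \<phi> = (THE T. T \<in> ops_on S \<and> (\<forall>g\<in>S. blinfun_apply T (ket g) = ket (\<phi> g)))"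

text \<open>For unitary \<open>T\<close>, where the adjoint is the inverse.\<close>

definition unitary_power :: "'x oper \<Rightarrow> int \<Rightarrow> 'x ell2 \<Rightarrow> 'x ell2" where
  "unitary_power T k = (if k \<ge> 0 then blinfun_apply T ^^ nat k
                        else blinfun_apply (adj T) ^^ nat (- k))"


section \<open>The universal C*-algebra\<close>

text \<open>A representation is given by the index set of its Hilbert space and its action.\<close>

type_synonym ('m, 'n, 'x) repn = "'x set \<times> (('m, 'n) sem \<Rightarrow> 'x oper)"

definition star_rep ::
  "('m::finite, 'n::finite) perm \<Rightarrow> ('m, 'n, 'x) repn \<Rightarrow> bool" where
  "star_rep \<theta> \<rho> \<longleftrightarrow> (case \<rho> of (S, \<sigma>) \<Rightarrow>
     (\<forall>w\<in>carrier (Ftheta \<theta>). \<sigma> w \<in> ops_on S \<and>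
        (\<forall>x. norm (blinfun_apply (\<sigma> w) (restr S x)) = norm (restr S x))) \<and>
     \<sigma> \<one>\<^bsub>Ftheta \<theta>\<^esub> = id_on S \<and>
     (\<forall>v\<in>carrier (Ftheta \<theta>). \<forall>w\<in>carrier (Ftheta \<theta>).
        \<sigma> (v \<otimes>\<^bsub>Ftheta \<theta>\<^esub> w) = \<sigma> v o\<^sub>L \<sigma> w) \<and>
     (\<Sum>i\<in>UNIV. \<sigma> (eword \<theta> [i]) o\<^sub>L adj (\<sigma> (eword \<theta> [i]))) = id_on S \<and>
     (\<Sum>j\<in>UNIV. \<sigma> (fword \<theta> [j]) o\<^sub>L adj (\<sigma> (fword \<theta> [j]))) = id_on S)"

text \<open>
  The universal C*-algebra is realised inside the product of the operator algebras of all
  *-representations on the spaces \<open>\<ell>\<^sup>2(S)\<close>, \<open>S :: 'x set\<close>: its elements are the families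
  \<open>c\<close> of operators, indexed by representations, in the closed *-algebra generated by the
  families \<open>ugen \<theta> w = (\<sigma> w)\<^sub>\<sigma>\<close>, for the norm \<open>sup \<parallel>c \<rho>\<parallel>\<close>. Families vanish at indices that are
  not *-representations. The extension of a *-representation to this algebra is evaluation at
  the corresponding index. The algebra is separable and every cyclic representation of it
  lives on a separable space, so for every infinite type \<open>'x\<close> the supremum is the one
  over all *-representations, and the result is the same algebra up to isomorphism.
\<close>

type_synonym ('m, 'n, 'x) family = "('m, 'n, 'x) repn \<Rightarrow> 'x oper"

definition ugen ::
  "('m::finite, 'n::finite) perm \<Rightarrow> ('m, 'n) sem \<Rightarrow> ('m, 'n, 'x) family" where
  "ugen \<theta> w = (\<lambda>\<rho>. if star_rep \<theta> \<rho> then snd \<rho> w else 0)"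

inductive_set star_poly :: "('m::finite, 'n::finite) perm \<Rightarrow> ('m, 'n, 'x) family set"
  for \<theta> :: "('m::finite, 'n::finite) perm" where
  gen: "w \<in> carrier (Ftheta \<theta>) \<Longrightarrow> ugen \<theta> w \<in> star_poly \<theta>"
| add: "c \<in> star_poly \<theta> \<Longrightarrow> d \<in> star_poly \<theta> \<Longrightarrow> (\<lambda>\<rho>. c \<rho> + d \<rho>) \<in> star_poly \<theta>"
| scale: "c \<in> star_poly \<theta> \<Longrightarrow> (\<lambda>\<rho>. op_cscale z (c \<rho>)) \<in> star_poly \<theta>"
| mult: "c \<in> star_poly \<theta> \<Longrightarrow> d \<in> star_poly \<theta> \<Longrightarrow> (\<lambda>\<rho>. c \<rho> o\<^sub>L d \<rho>) \<in> star_poly \<theta>"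
| star: "c \<in> star_poly \<theta> \<Longrightarrow> (\<lambda>\<rho>. adj (c \<rho>)) \<in> star_poly \<theta>"

definition Cstar :: "('m::finite, 'n::finite) perm \<Rightarrow> ('m, 'n, 'x) family set" where
  "Cstar \<theta> = {c. (\<forall>\<rho>. \<not> star_rep \<theta> \<rho> \<longrightarrow> c \<rho> = 0) \<and>
     (\<forall>\<epsilon>>0. \<exists>p\<in>star_poly \<theta>. \<forall>\<rho>. star_rep \<theta> \<rho> \<longrightarrow> norm (c \<rho> - p \<rho>) \<le> \<epsilon>)}"

definition rep_ext :: "('m, 'n, 'x) repn \<Rightarrow> ('m, 'n, 'x) family \<Rightarrow> 'x oper" where
  "rep_ext \<rho> c = c \<rho>"

lemma rep_ext_ugen: "star_rep \<theta> (S, \<sigma>) \<Longrightarrow> rep_ext (S, \<sigma>) (ugen \<theta> w) = \<sigma> w"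
  by (simp add: rep_ext_def ugen_def)

definition Wunitary ::
  "('m::finite, 'n::finite) perm \<Rightarrow> nat \<Rightarrow> ('m list \<Rightarrow> 'n list) \<Rightarrow> ('m, 'n, 'x) family" where
  "Wunitary \<theta> a \<gamma> = (\<lambda>\<rho>. \<Sum>u\<in>{u. length u = a}.
     ugen \<theta> (fword \<theta> (\<gamma> u)) \<rho> o\<^sub>L adj (ugen \<theta> (eword \<theta> u) \<rho>))"


section \<open>The representation of a tail\<close>

definition rho :: "('m, 'n) perm \<Rightarrow> ('m, 'n) tail \<Rightarrow> nat \<Rightarrow> ('m, 'n) sem \<Rightarrow> ('m, 'n) sem" where
  "rho \<theta> \<tau> s g = g \<otimes>\<^bsub>Ftheta \<theta>\<^esub> eword \<theta> [fst (\<tau> s)] \<otimes>\<^bsub>Ftheta \<theta>\<^esub> fword \<theta> [snd (\<tau> s)]"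

primrec push ::
  "('m, 'n) perm \<Rightarrow> ('m, 'n) tail \<Rightarrow> nat \<Rightarrow> nat \<Rightarrow> ('m, 'n) sem \<Rightarrow> ('m, 'n) sem" where
  "push \<theta> \<tau> s 0 g = g"
| "push \<theta> \<tau> s (Suc k) g = rho \<theta> \<tau> (s + k) (push \<theta> \<tau> s k g)"

definition limrel ::
  "('m, 'n) perm \<Rightarrow> ('m, 'n) tail \<Rightarrow> ((nat \<times> ('m, 'n) sem) \<times> (nat \<times> ('m, 'n) sem)) set" where
  "limrel \<theta> \<tau> = {((s, g), (t, h)). g \<in> carrier (Ftheta \<theta>) \<and> h \<in> carrier (Ftheta \<theta>) \<and>
     (\<exists>k l. s + k = t + l \<and> push \<theta> \<tau> s k g = push \<theta> \<tau> t l h)}"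

type_synonym ('m, 'n) gpoint = "(nat \<times> ('m, 'n) sem) set"

definition Gtau :: "('m, 'n) perm \<Rightarrow> ('m, 'n) tail \<Rightarrow> ('m, 'n) gpoint set" where
  "Gtau \<theta> \<tau> = (UNIV \<times> carrier (Ftheta \<theta>)) // limrel \<theta> \<tau>"

definition iota ::
  "('m, 'n) perm \<Rightarrow> ('m, 'n) tail \<Rightarrow> nat \<Rightarrow> ('m, 'n) sem \<Rightarrow> ('m, 'n) gpoint" where
  "iota \<theta> \<tau> s x = limrel \<theta> \<tau> `` {(s, x)}"

definition act ::
  "('m, 'n) perm \<Rightarrow> ('m, 'n) tail \<Rightarrow> ('m, 'n) sem \<Rightarrow> ('m, 'n) gpoint \<Rightarrow> ('m, 'n) gpoint" where
  "act \<theta> \<tau> w X = (\<Union>(s, x)\<in>X. iota \<theta> \<tau> s (w \<otimes>\<^bsub>Ftheta \<theta>\<^esub> x))"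

definition lambda_tau ::
  "('m, 'n) perm \<Rightarrow> ('m, 'n) tail \<Rightarrow> ('m, 'n, ('m, 'n) gpoint) repn" where
  "lambda_tau \<theta> \<tau> = (Gtau \<theta> \<tau>, \<lambda>w. basis_op (Gtau \<theta> \<tau>) (act \<theta> \<tau> w))"


section \<open>The algebra\<close>

definition orbrel ::
  "('m::finite, 'n::finite) perm \<Rightarrow> nat \<Rightarrow> ('m list \<Rightarrow> 'n list) \<Rightarrow> ('m, 'n) tail \<Rightarrow>
     (('m, 'n) gpoint \<times> ('m, 'n) gpoint) set" where
  "orbrel \<theta> a \<gamma> \<tau> = {(x, y). x \<in> Gtau \<theta> \<tau> \<and> y \<in> Gtau \<theta> \<tau> \<and>
     (\<exists>k. unitary_power (rep_ext (lambda_tau \<theta> \<tau>) (Wunitary \<theta> a \<gamma>)) k (ket x) = ket y)}"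

definition orbits ::
  "('m::finite, 'n::finite) perm \<Rightarrow> nat \<Rightarrow> ('m list \<Rightarrow> 'n list) \<Rightarrow> ('m, 'n) tail \<Rightarrow>
     ('m, 'n) gpoint set set" where
  "orbits \<theta> a \<gamma> \<tau> = Gtau \<theta> \<tau> // orbrel \<theta> a \<gamma> \<tau>"

definition orbit_act ::
  "('m::finite, 'n::finite) perm \<Rightarrow> nat \<Rightarrow> ('m list \<Rightarrow> 'n list) \<Rightarrow> ('m, 'n) tail \<Rightarrow>
     ('m, 'n) sem \<Rightarrow> ('m, 'n) gpoint set \<Rightarrow> ('m, 'n) gpoint set" where
  "orbit_act \<theta> a \<gamma> \<tau> w X = (\<Union>x\<in>X. orbrel \<theta> a \<gamma> \<tau> `` {act \<theta> \<tau> w x})"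

definition sigma1 ::
  "('m::finite, 'n::finite) perm \<Rightarrow> nat \<Rightarrow> ('m list \<Rightarrow> 'n list) \<Rightarrow> ('m, 'n) tail \<Rightarrow>
     ('m, 'n, ('m, 'n) gpoint set) repn" where
  "sigma1 \<theta> a \<gamma> \<tau> = (orbits \<theta> a \<gamma> \<tau>,
     \<lambda>w. basis_op (orbits \<theta> a \<gamma> \<tau>) (orbit_act \<theta> a \<gamma> \<tau> w))"

definition frakA ::
  "('m::finite, 'n::finite) perm \<Rightarrow> nat \<Rightarrow> ('m list \<Rightarrow> 'n list) \<Rightarrow> ('m, 'n) tail \<Rightarrow>
     ('m, 'n) gpoint set oper set" where
  "frakA \<theta> a \<gamma> \<tau> = rep_ext (sigma1 \<theta> a \<gamma> \<tau>) ` Cstar \<theta>"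


section \<open>Simplicity\<close>

text \<open>Two-sided ideals of \<open>A\<close> that are closed in the norm topology of \<open>A\<close>.\<close>

definition closed_ideal :: "'x oper set \<Rightarrow> 'x oper set \<Rightarrow> bool" where
  "closed_ideal J A \<longleftrightarrow> J \<subseteq> A \<and> 0 \<in> J \<and>
     (\<forall>x\<in>J. \<forall>y\<in>J. x + y \<in> J) \<and> (\<forall>c. \<forall>x\<in>J. op_cscale c x \<in> J) \<and>
     (\<forall>x\<in>J. \<forall>y\<in>A. x o\<^sub>L y \<in> J \<and> y o\<^sub>L x \<in> J) \<and>
     closedin (top_of_set A) J"

definition simple_algebra :: "'x oper set \<Rightarrow> bool" where
  "simple_algebra A \<longleftrightarrow> A \<noteq> {0} \<and> (\<forall>J. closed_ideal J A \<longrightarrow> J = {0} \<or> J = A)"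

end

theory Submission
  imports Defs
begin

text \<open>
  Two points of \<open>Gtau \<theta> \<tau>\<close> spell the same infinite word exactly when they lie in one orbit of the
  unitary \<open>W\<close>. So the orbits are the infinite words tail equivalent to \<open>\<tau>\<close>, and \<open>sigma1\<close> is the
  representation of the semigroup by shifts \<open>s\<^sub>w \<zeta>\<^sub>x = \<zeta>\<^bsub>wx\<^esub>\<close> of the basis vectors indexed by these
  words. Three properties of this action of the semigroup on a set give simplicity: every
  point has exactly one prefix of each degree, points with the same prefixes are equal, and
  two elements \<open>v\<close>, \<open>w\<close> with \<open>vy = wy\<close> for one point \<open>y\<close> act in the same way on all points.
  The last property says that the isotropy that is left after dividing by \<open>W\<close> acts trivially.

  Given such an action, let \<open>T\<close> be a nonzero element of a closed ideal. Any two points are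
  tail equivalent, hence of the form \<open>gz\<close>, \<open>hz\<close>, so passing from \<open>T\<close> to \<open>s\<^sub>g\<^sup>* T s\<^sub>h\<close> makes a diagonal entry at some \<open>z\<close> nonzero; scale it
  to 1. Let \<open>P\<close> be a polynomial in the shifts and their adjoints that is close to \<open>T\<close>. If \<open>w\<close> is a
  long prefix of \<open>z = wy\<close>, then \<open>P s\<^sub>w\<close> is a linear combination of shifts \<open>s\<^sub>v\<close>. For each of them,
  either \<open>vy = wy\<close>, and then \<open>s\<^sub>v = s\<^sub>w\<close>, or \<open>vy\<close> and \<open>wy\<close> differ at a finite place, and lengthening \<open>w\<close>
  makes the term disappear from \<open>s\<^sub>w\<^sup>* P s\<^sub>w\<close>. So \<open>s\<^sub>w\<^sup>* P s\<^sub>w\<close> is the scalar \<open>\<langle>P \<zeta>\<^sub>z, \<zeta>\<^sub>z\<rangle>\<close>, which is close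
  to 1 (lemma \<open>compress\<close>). Hence \<open>s\<^sub>w\<^sup>* T s\<^sub>w\<close>, which is in the ideal, is close to the identity, and the ideal
  is the whole algebra (\<open>simple_algebra_if_approximable\<close>).

  The properties of the action rest on three facts. Unique factorization in the semigroup comes
  from the normal form \<open>e\<^sub>u f\<^sub>v\<close>. The defining relation of \<open>\<gamma>\<close> implies that the bijection
  \<open>e\<^sub>u y \<mapsto> f\<^bsub>\<gamma> u\<^esub> y\<close>, by which \<open>W\<close> permutes the basis, commutes with the semigroup (\<open>period_slide\<close>,
  \<open>twist_act\<close>). Finally, if two points spell the same word, then the difference of their degrees is in
  \<open>H_tail \<theta> \<tau>\<close>, hence a multiple of \<open>(a, -b)\<close>, and a power of \<open>W\<close> removes it (\<open>alike_period\<close>, \<open>alike_orb\<close>).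
\<close>

section \<open>Operators given by injections of the index set\<close>

lemma ell2_eqI: "(\<And>k. coord x k = coord y k) \<Longrightarrow> x = y"
  by (simp add: coord_inject[symmetric] fun_eq_iff)

lemma coord_minus: "coord (x - y) k = coord x k - coord y k"
  unfolding minus_ell2_def by (simp only: plus_ell2.rep_eq uminus_ell2.rep_eq) simp

lemmas coord_simps = zero_ell2.rep_eq plus_ell2.rep_eq uminus_ell2.rep_eq coord_minus
  cscale.rep_eq restr.rep_eq ket.rep_eq

lemma coord_le_norm: "cmod (coord x k) \<le> norm x"
proof (rule power2_le_imp_le)
  have "(\<Sum>\<^sub>\<infinity>j\<in>{k}. (cmod (coord x j))\<^sup>2) \<le> (\<Sum>\<^sub>\<infinity>j. (cmod (coord x j))\<^sup>2)"
    by (rule infsum_mono_neutral[OF summable_on_finite coord_summable]) simp_all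
  then show "(cmod (coord x k))\<^sup>2 \<le> (norm x)\<^sup>2"
    unfolding norm_ell2_sq by simp
qed simp

lemma cinner_ket_left: "cinner (ket k) y = cnj (coord y k)"
proof -
  have "cinner (ket k) y = (\<Sum>\<^sub>\<infinity>j\<in>{k}. coord (ket k) j * cnj (coord y j))"
    unfolding cinner_def by (rule infsum_cong_neutral) (auto simp: ket.rep_eq)
  then show ?thesis by (simp add: ket.rep_eq)
qed

lemma cinner_commute: "cinner x y = cnj (cinner y x)"
  unfolding cinner_def infsum_cnj[symmetric] by (simp add: mult.commute)

lemma cinner_add_left: "cinner (x + y) z = cinner x z + cinner y z"
  unfolding cinner_def infsum_add[OF cinner_summable cinner_summable, symmetric]
  by (simp add: plus_ell2.rep_eq algebra_simps)

lemma cinner_cscale_left: "cinner (cscale c x) y = c * cinner x y"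
  unfolding cinner_def infsum_cmult_right[OF cinner_summable, symmetric]
  by (simp add: cscale.rep_eq algebra_simps)

lemma cinner_add_right: "cinner x (y + z) = cinner x y + cinner x z"
  by (metis cinner_add_left cinner_commute complex_cnj_add)

lemma cinner_cscale_right: "cinner x (cscale (cnj c) y) = c * cinner x y"
  by (metis cinner_cscale_left cinner_commute complex_cnj_mult complex_cnj_cnj)

lemma cscale_add_right: "cscale c (x + y) = cscale c x + cscale c y"
  by (rule ell2_eqI) (simp add: coord_simps algebra_simps)

lemma cscale_zero: "cscale c 0 = 0"
  by (rule ell2_eqI) (simp add: coord_simps)

text \<open>
  The squared error is the tail of the convergent series of the squared coordinates.
\<close>

lemma finite_restr_approx:
  assumes "e > 0"
  shows "\<exists>F. finite F \<and> norm (x - restr F x) < e"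
proof -
  let ?f = "\<lambda>k. (cmod (coord x k))\<^sup>2"
  have "(sum ?f \<longlongrightarrow> infsum ?f UNIV) (finite_subsets_at_top UNIV)"
    by (rule infsum_tendsto[OF coord_summable])
  then have "\<forall>\<^sub>F F in finite_subsets_at_top UNIV. dist (sum ?f F) (infsum ?f UNIV) < e\<^sup>2"
    by (rule tendstoD) (use assms in simp)
  then obtain F where F: "finite F" "dist (sum ?f F) (infsum ?f UNIV) < e\<^sup>2"
    unfolding eventually_finite_subsets_at_top by blast
  have "(norm (x - restr F x))\<^sup>2 = infsum ?f (UNIV - F)"
    unfolding norm_ell2_sq by (rule infsum_cong_neutral) (auto simp: coord_simps)
  also have "\<dots> = infsum ?f UNIV - infsum ?f F"
    by (rule infsum_Diff) (use F in \<open>simp_all add: coord_summable\<close>)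
  also have "\<dots> = infsum ?f UNIV - sum ?f F"
    using F by simp
  also have "\<dots> < e\<^sup>2"
    using F(2) by (simp add: dist_real_def abs_if split: if_splits)
  finally have "norm (x - restr F x) < e"
    using assms by (simp add: power2_less_imp_less)
  with F show ?thesis by blast
qed

lemma restr_finite_sum:
  assumes "finite F"
  shows "restr F x = (\<Sum>k\<in>F. cscale (coord x k) (ket k))"
  using assms
proof (induction F rule: finite_induct)
  case empty
  then show ?case by (intro ell2_eqI) (simp add: coord_simps)
next
  case (insert k F)
  have "restr (insert k F) x = cscale (coord x k) (ket k) + restr F x"
    using insert.hyps by (intro ell2_eqI) (simp add: coord_simps)
  with insert show ?case by simp
qed

text \<open>
  The finite linear combinations of basis vectors are dense, and \<open>T\<close> is continuous.
\<close>

lemma oper_zero_if_kets_zero: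
  assumes "\<And>c x. blinfun_apply T (cscale c x) = cscale c (blinfun_apply T x)"
    and "\<And>k. blinfun_apply T (ket k) = 0"
  shows "T = 0"
proof (rule blinfun_eqI)
  fix x
  have "norm (blinfun_apply T x) \<le> e" if "e > 0" for e
  proof -
    have "norm T + 1 > 0"
      using norm_ge_zero[of T] by linarith
    then have "e / (norm T + 1) > 0"
      using that by simp
    then obtain F where F: "finite F" "norm (x - restr F x) < e / (norm T + 1)"
      using finite_restr_approx by blast
    have "blinfun_apply T (restr F x) = 0"
      unfolding restr_finite_sum[OF F(1)] by (simp add: blinfun.sum_right assms cscale_zero)
    then have "norm (blinfun_apply T x) = norm (blinfun_apply T (x - restr F x))"
      by (simp add: blinfun.diff_right)
    also have "\<dots> \<le> norm T * norm (x - restr F x)"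
      by (rule norm_blinfun)
    also have "\<dots> \<le> (norm T + 1) * (e / (norm T + 1))"
      by (rule mult_mono) (use F(2) that in auto)
    also have "\<dots> = e"
      using norm_ge_zero[of T] by (simp add: add_nonneg_eq_0_iff)
    finally show ?thesis .
  qed
  then have "norm (blinfun_apply T x) \<le> 0"
    by (meson dense_ge)
  then show "blinfun_apply T x = blinfun_apply 0 x" by simp
qed

lemma ops_onI:
  assumes "\<And>c x. blinfun_apply T (cscale c x) = cscale c (blinfun_apply T x)"
    and "\<And>x. blinfun_apply T (restr S x) = blinfun_apply T x"
    and "\<And>x. restr S (blinfun_apply T x) = blinfun_apply T x"
  shows "T \<in> ops_on S"
  using assms by (simp add: ops_on_def)

lemma restr_restr: "restr S (restr S x) = restr S x"
  by (rule ell2_eqI) (simp add: coord_simps)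

lemma ops_on_scale: "T \<in> ops_on S \<Longrightarrow> blinfun_apply T (cscale c x) = cscale c (blinfun_apply T x)"
  by (simp add: ops_on_def)

lemma ops_on_restr:
  assumes "T \<in> ops_on S"
  shows "blinfun_apply T (restr S x) = blinfun_apply T x"
    and "restr S (blinfun_apply T x) = blinfun_apply T x"
  using assms unfolding ops_on_def by (metis (mono_tags, lifting) mem_Collect_eq restr_restr)+

lemma restr_ket: "restr S (ket g) = (if g \<in> S then ket g else 0)"
  by (rule ell2_eqI) (simp add: coord_simps)

lemma ops_on_ket_outside: "T \<in> ops_on S \<Longrightarrow> g \<notin> S \<Longrightarrow> blinfun_apply T (ket g) = 0"
  using ops_on_restr(1)[of T S "ket g"] by (simp add: restr_ket)

lemma ops_on_eqI:
  assumes "A \<in> ops_on S" "B \<in> ops_on S"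
    and "\<And>g. g \<in> S \<Longrightarrow> blinfun_apply A (ket g) = blinfun_apply B (ket g)"
  shows "A = B"
proof -
  have "A - B = 0"
  proof (rule oper_zero_if_kets_zero)
    show "blinfun_apply (A - B) (cscale c x) = cscale c (blinfun_apply (A - B) x)" for c x
      using assms(1,2)
      by (intro ell2_eqI) (simp add: blinfun.diff_left ops_on_scale coord_simps algebra_simps)
    show "blinfun_apply (A - B) (ket k) = 0" for k
      using assms by (cases "k \<in> S") (simp_all add: blinfun.diff_left ops_on_ket_outside)
  qed
  then show ?thesis by simp
qed

lemma id_on_ops: "id_on S \<in> ops_on S"
proof (rule ops_onI)
  show "blinfun_apply (id_on S) (cscale c x) = cscale c (blinfun_apply (id_on S) x)" for c and x :: "'a ell2"
    by (intro ell2_eqI) (simp add: coord_simps)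
qed (simp_all add: restr_restr)

lemma zero_ops: "0 \<in> ops_on S"
  by (rule ops_onI; rule ell2_eqI; simp add: coord_simps)

lemma restr_add: "restr S (x + y) = restr S x + restr S y"
  by (rule ell2_eqI) (simp add: coord_simps)

lemma restr_cscale: "restr S (cscale c x) = cscale c (restr S x)"
  by (rule ell2_eqI) (simp add: coord_simps)

lemma cscale_cscale: "cscale c (cscale d x) = cscale (c * d) x"
  by (rule ell2_eqI) (simp add: coord_simps)

lemma add_ops: "A \<in> ops_on S \<Longrightarrow> B \<in> ops_on S \<Longrightarrow> A + B \<in> ops_on S"
  by (rule ops_onI) (simp_all add: blinfun.add_left ops_on_scale ops_on_restr cscale_add_right restr_add)

lemma sum_ops: "(\<And>i. i \<in> I \<Longrightarrow> A i \<in> ops_on S) \<Longrightarrow> sum A I \<in> ops_on S"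
  by (induction I rule: infinite_finite_induct) (auto intro: add_ops zero_ops)

lemma cscale_ops: "A \<in> ops_on S \<Longrightarrow> op_cscale c A \<in> ops_on S"
  by (rule ops_onI) (simp_all add: ops_on_scale ops_on_restr restr_cscale cscale_cscale mult.commute)

lemma comp_ops: "A \<in> ops_on S \<Longrightarrow> B \<in> ops_on S \<Longrightarrow> A o\<^sub>L B \<in> ops_on S"
  by (rule ops_onI) (simp_all add: ops_on_scale ops_on_restr)

lemma ket_inject: "ket x = ket y \<longleftrightarrow> x = y"
proof
  assume "ket x = ket y"
  then have "coord (ket x) x = coord (ket y) x" by simp
  then show "x = y" by (simp add: ket.rep_eq split: if_splits)
qed simp

lemma norm_ket: "norm (ket x) = 1"
  by (simp add: norm_ell2_def inner_ell2_def cinner_ket_left ket.rep_eq)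

text \<open>
  Membership in \<open>ops_on S\<close> is a conjunction of equations between continuous functions of the operator.
\<close>

lemma closed_ops_on: "closed (ops_on S)"
proof -
  have *: "continuous_on UNIV (\<lambda>T :: 'x oper. blinfun_apply T x)" for x :: "'x ell2"
    by (intro continuous_intros)
  show ?thesis
    unfolding ops_on_def
    by (intro closed_Collect_conj closed_Collect_all closed_Collect_eq *
        bounded_linear.continuous_on[OF bounded_linear_cscale]
        bounded_linear.continuous_on[OF bounded_linear_restr])
qed

lemma ops_on_limit:
  assumes "\<And>\<epsilon>. \<epsilon> > 0 \<Longrightarrow> \<exists>P\<in>ops_on S. norm (T - P) \<le> \<epsilon>"
  shows "T \<in> ops_on S"
proof -
  have "T \<in> closure (ops_on S)"
    unfolding closure_approachable
  proof (intro allI impI)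
    fix e :: real assume "e > 0"
    then obtain P where "P \<in> ops_on S" "norm (T - P) \<le> e / 2"
      using assms[of "e / 2"] by auto
    with \<open>e > 0\<close> show "\<exists>P\<in>ops_on S. dist P T < e"
      by (intro bexI[of _ P]) (simp_all add: dist_norm norm_minus_commute)
  qed
  then show ?thesis
    using closed_ops_on by (metis closure_closed)
qed

lemma comp_cscale_left: "op_cscale c A o\<^sub>L B = op_cscale c (A o\<^sub>L B)"
  by (rule blinfun_eqI) simp

lemma comp_cscale_right: "A \<in> ops_on S \<Longrightarrow> A o\<^sub>L op_cscale c B = op_cscale c (A o\<^sub>L B)"
  by (rule blinfun_eqI) (simp add: ops_on_scale)

lemma comp_add_left: "(A + B) o\<^sub>L C = (A o\<^sub>L C) + (B o\<^sub>L C)" for C :: "'x oper"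
  by (rule blinfun_eqI) (simp add: blinfun.add_left)

lemma comp_add_right: "C o\<^sub>L (A + B) = (C o\<^sub>L A) + (C o\<^sub>L B)" for C :: "'x oper"
  by (rule blinfun_eqI) (simp add: blinfun.add_left blinfun.add_right)

lemma comp_assoc: "(A o\<^sub>L B) o\<^sub>L C = A o\<^sub>L (B o\<^sub>L C)" for C :: "'x oper"
  by (rule blinfun_eqI) simp

definition adjoint_pair :: "'x oper \<Rightarrow> 'x oper \<Rightarrow> bool" where
  "adjoint_pair T T' \<longleftrightarrow>
     (\<forall>x y. cinner (blinfun_apply T x) y = cinner x (blinfun_apply T' y))"

text \<open>
  The adjoint is defined by a description, so it is only accessible for operators with an explicit
  candidate. Pairing with basis vectors shows that there is at most one.
\<close>

lemma adj_eqI: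
  assumes "adjoint_pair T T'"
  shows "adj T = T'"
  unfolding adj_def
proof (rule the_equality)
  show *: "\<forall>x y. cinner (blinfun_apply T x) y = cinner x (blinfun_apply T' y)"
    using assms by (simp add: adjoint_pair_def)
  fix R assume R: "\<forall>x y. cinner (blinfun_apply T x) y = cinner x (blinfun_apply R y)"
  show "R = T'"
  proof (intro blinfun_eqI ell2_eqI)
    fix y k
    have "cinner (ket k) (blinfun_apply R y) = cinner (ket k) (blinfun_apply T' y)"
      using R * by metis
    then show "coord (blinfun_apply R y) k = coord (blinfun_apply T' y) k"
      by (simp add: cinner_ket_left)
  qed
qed

lemma adjoint_pair_sym: "adjoint_pair T T' \<Longrightarrow> adjoint_pair T' T"
  unfolding adjoint_pair_def by (metis cinner_commute)

lemma adjoint_pair_add: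
  "adjoint_pair A A' \<Longrightarrow> adjoint_pair B B' \<Longrightarrow> adjoint_pair (A + B) (A' + B')"
  by (simp add: adjoint_pair_def blinfun.add_left cinner_add_left cinner_add_right)

lemma adjoint_pair_cscale:
  "adjoint_pair A A' \<Longrightarrow> adjoint_pair (op_cscale c A) (op_cscale (cnj c) A')"
  by (simp add: adjoint_pair_def cinner_cscale_left cinner_cscale_right)

lemma adjoint_pair_comp:
  "adjoint_pair A A' \<Longrightarrow> adjoint_pair B B' \<Longrightarrow> adjoint_pair (A o\<^sub>L B) (B' o\<^sub>L A')"
  by (simp add: adjoint_pair_def)

lemma adjoint_pair_zero: "adjoint_pair 0 0"
  by (simp add: adjoint_pair_def cinner_def coord_simps)

text \<open>
  On basis vectors this is \<open>\<phi>\<close>. Together with its adjoint \<open>pull_vec\<close> it describes all the operators of the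
  representations explicitly. The injectivity test makes the image square summable for every \<open>\<phi>\<close>.
\<close>

lift_definition push_vec :: "'x set \<Rightarrow> ('x \<Rightarrow> 'x) \<Rightarrow> 'x ell2 \<Rightarrow> 'x ell2" is
  "\<lambda>S \<phi> f k. if inj_on \<phi> S \<and> k \<in> \<phi> ` S then f (inv_into S \<phi> k) else 0"
proof -
  fix S :: "'x set" and \<phi> :: "'x \<Rightarrow> 'x" and f :: "'x \<Rightarrow> complex"
  assume f: "(\<lambda>k. (cmod (f k))\<^sup>2) summable_on UNIV"
  let ?g = "\<lambda>k. (cmod (f (inv_into S \<phi> k)))\<^sup>2"
  show "(\<lambda>k. (cmod (if inj_on \<phi> S \<and> k \<in> \<phi> ` S then f (inv_into S \<phi> k) else 0))\<^sup>2) summable_on UNIV"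
  proof (cases "inj_on \<phi> S")
    case True
    have "(\<lambda>k. (cmod (f k))\<^sup>2) summable_on S"
      using f by (rule summable_on_subset_banach) simp
    then have "(?g \<circ> \<phi>) summable_on S"
      by (rule summable_on_cong[THEN iffD1, rotated]) (simp add: True)
    then have "?g summable_on (\<phi> ` S)"
      by (simp add: summable_on_reindex[OF True])
    then show ?thesis
      by (rule summable_on_cong_neutral[THEN iffD1, rotated -1]) (auto simp: True)
  qed simp
qed

lift_definition pull_vec :: "'x set \<Rightarrow> ('x \<Rightarrow> 'x) \<Rightarrow> 'x ell2 \<Rightarrow> 'x ell2" is
  "\<lambda>S \<phi> f k. if inj_on \<phi> S \<and> k \<in> S then f (\<phi> k) else 0"
proof -
  fix S :: "'x set" and \<phi> :: "'x \<Rightarrow> 'x" and f :: "'x \<Rightarrow> complex"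
  assume f: "(\<lambda>k. (cmod (f k))\<^sup>2) summable_on UNIV"
  show "(\<lambda>k. (cmod (if inj_on \<phi> S \<and> k \<in> S then f (\<phi> k) else 0))\<^sup>2) summable_on UNIV"
  proof (cases "inj_on \<phi> S")
    case True
    have "(\<lambda>k. (cmod (f k))\<^sup>2) summable_on (\<phi> ` S)"
      using f by (rule summable_on_subset_banach) simp
    then have "((\<lambda>k. (cmod (f k))\<^sup>2) \<circ> \<phi>) summable_on S"
      by (simp add: summable_on_reindex[OF True])
    then show ?thesis
      by (rule summable_on_cong_neutral[THEN iffD1, rotated -1]) (auto simp: True)
  qed simp
qed

lemma norm_push_vec:
  assumes "inj_on \<phi> S"
  shows "norm (push_vec S \<phi> x) = norm (restr S x)"
proof -
  let ?g = "\<lambda>k. (cmod (coord (push_vec S \<phi> x) k))\<^sup>2"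
  have "(norm (push_vec S \<phi> x))\<^sup>2 = infsum ?g (\<phi> ` S)"
    unfolding norm_ell2_sq by (rule infsum_cong_neutral) (auto simp: push_vec.rep_eq)
  also have "\<dots> = infsum (?g \<circ> \<phi>) S"
    by (rule infsum_reindex[OF assms])
  also have "\<dots> = (norm (restr S x))\<^sup>2"
    unfolding norm_ell2_sq
    by (rule infsum_cong_neutral) (auto simp: push_vec.rep_eq restr.rep_eq assms)
  finally show ?thesis by simp
qed

lemma norm_pull_vec_le: "norm (pull_vec S \<phi> x) \<le> norm x"
proof (cases "inj_on \<phi> S")
  case True
  let ?g = "\<lambda>k. (cmod (coord x k))\<^sup>2"
  have "(norm (pull_vec S \<phi> x))\<^sup>2 = infsum (?g \<circ> \<phi>) S"
    unfolding norm_ell2_sq by (rule infsum_cong_neutral) (auto simp: pull_vec.rep_eq True)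
  also have "\<dots> = infsum ?g (\<phi> ` S)"
    by (rule infsum_reindex[OF True, symmetric])
  also have "\<dots> \<le> (norm x)\<^sup>2"
    unfolding norm_ell2_sq
    by (rule infsum_mono_neutral[OF summable_on_subset_banach[OF coord_summable] coord_summable])
       simp_all
  finally show ?thesis by (rule power2_le_imp_le) simp
next
  case False
  then have "pull_vec S \<phi> x = 0"
    by (intro ell2_eqI) (simp add: pull_vec.rep_eq coord_simps)
  then show ?thesis by simp
qed

lemma cinner_push_pull:
  assumes "inj_on \<phi> S"
  shows "cinner (push_vec S \<phi> x) y = cinner x (pull_vec S \<phi> y)"
proof -
  let ?g = "\<lambda>k. coord (push_vec S \<phi> x) k * cnj (coord y k)"
  have "cinner (push_vec S \<phi> x) y = infsum ?g (\<phi> ` S)"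
    unfolding cinner_def by (rule infsum_cong_neutral) (auto simp: push_vec.rep_eq)
  also have "\<dots> = infsum (?g \<circ> \<phi>) S"
    by (rule infsum_reindex[OF assms])
  also have "\<dots> = cinner x (pull_vec S \<phi> y)"
    unfolding cinner_def
    by (rule infsum_cong_neutral) (auto simp: push_vec.rep_eq pull_vec.rep_eq assms)
  finally show ?thesis .
qed

definition push_op :: "'x set \<Rightarrow> ('x \<Rightarrow> 'x) \<Rightarrow> 'x oper" where
  "push_op S \<phi> = Blinfun (push_vec S \<phi>)"

definition pull_op :: "'x set \<Rightarrow> ('x \<Rightarrow> 'x) \<Rightarrow> 'x oper" where
  "pull_op S \<phi> = Blinfun (pull_vec S \<phi>)"

lemma push_op_apply: 
  assumes "inj_on \<phi> S"
  shows "blinfun_apply (push_op S \<phi>) x = push_vec S \<phi> x"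
proof -
  have "bounded_linear (push_vec S \<phi>)"
  proof (rule bounded_linear_intro[where K = 1])
    show "push_vec S \<phi> (x + y) = push_vec S \<phi> x + push_vec S \<phi> y" for x y
      by (rule ell2_eqI) (simp add: push_vec.rep_eq coord_simps)
    show "push_vec S \<phi> (r *\<^sub>R x) = r *\<^sub>R push_vec S \<phi> x" for r x
      unfolding scaleR_ell2_def by (rule ell2_eqI) (simp add: push_vec.rep_eq coord_simps)
    show "norm (push_vec S \<phi> x) \<le> norm x * 1" for x
      by (simp add: norm_push_vec[OF assms] norm_restr_le)
  qed
  then show ?thesis by (simp add: push_op_def bounded_linear_Blinfun_apply)
qed

lemma pull_op_apply: "blinfun_apply (pull_op S \<phi>) x = pull_vec S \<phi> x"
proof -
  have "bounded_linear (pull_vec S \<phi>)"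
  proof (rule bounded_linear_intro[where K = 1])
    show "pull_vec S \<phi> (x + y) = pull_vec S \<phi> x + pull_vec S \<phi> y" for x y
      by (rule ell2_eqI) (simp add: pull_vec.rep_eq coord_simps)
    show "pull_vec S \<phi> (r *\<^sub>R x) = r *\<^sub>R pull_vec S \<phi> x" for r x
      unfolding scaleR_ell2_def by (rule ell2_eqI) (simp add: pull_vec.rep_eq coord_simps)
    show "norm (pull_vec S \<phi> x) \<le> norm x * 1" for x
      by (simp add: norm_pull_vec_le)
  qed
  then show ?thesis by (simp add: pull_op_def bounded_linear_Blinfun_apply)
qed

lemma adjoint_pair_push_pull: "inj_on \<phi> S \<Longrightarrow> adjoint_pair (push_op S \<phi>) (pull_op S \<phi>)"
  by (simp add: adjoint_pair_def push_op_apply pull_op_apply cinner_push_pull)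

lemma push_op_ops:
  assumes "inj_on \<phi> S" "\<phi> ` S \<subseteq> S"
  shows "push_op S \<phi> \<in> ops_on S"
proof (rule ops_onI; rule ell2_eqI)
  fix c x k
  show "coord (blinfun_apply (push_op S \<phi>) (cscale c x)) k =
      coord (cscale c (blinfun_apply (push_op S \<phi>) x)) k"
    by (simp add: push_op_apply assms push_vec.rep_eq coord_simps)
  have "inv_into S \<phi> k \<in> S" if "k \<in> \<phi> ` S"
    using that by (rule inv_into_into)
  then show "coord (blinfun_apply (push_op S \<phi>) (restr S x)) k = coord (blinfun_apply (push_op S \<phi>) x) k"
    by (simp add: push_op_apply assms push_vec.rep_eq coord_simps)
  show "coord (restr S (blinfun_apply (push_op S \<phi>) x)) k = coord (blinfun_apply (push_op S \<phi>) x) k"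
    using assms(2) by (auto simp: push_op_apply assms(1) push_vec.rep_eq coord_simps)
qed

lemma pull_op_ops:
  assumes "\<phi> ` S \<subseteq> S"
  shows "pull_op S \<phi> \<in> ops_on S"
proof (rule ops_onI; rule ell2_eqI)
  fix c x k
  show "coord (blinfun_apply (pull_op S \<phi>) (cscale c x)) k =
      coord (cscale c (blinfun_apply (pull_op S \<phi>) x)) k"
    by (simp add: pull_op_apply pull_vec.rep_eq coord_simps)
  have "\<phi> k \<in> S" if "k \<in> S"
    using assms that by blast
  then show "coord (blinfun_apply (pull_op S \<phi>) (restr S x)) k = coord (blinfun_apply (pull_op S \<phi>) x) k"
    by (simp add: pull_op_apply pull_vec.rep_eq coord_simps)
  show "coord (restr S (blinfun_apply (pull_op S \<phi>) x)) k = coord (blinfun_apply (pull_op S \<phi>) x) k"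
    by (simp add: pull_op_apply pull_vec.rep_eq coord_simps)
qed

lemma push_op_ket:
  assumes "inj_on \<phi> S" "g \<in> S"
  shows "blinfun_apply (push_op S \<phi>) (ket g) = ket (\<phi> g)"
proof (rule ell2_eqI)
  fix k
  have "inv_into S \<phi> k = g \<longleftrightarrow> k = \<phi> g" if "k \<in> \<phi> ` S"
    using assms that by auto
  then show "coord (blinfun_apply (push_op S \<phi>) (ket g)) k = coord (ket (\<phi> g)) k"
    using assms by (simp add: push_op_apply push_vec.rep_eq coord_simps)
qed

lemma pull_op_ket:
  assumes "inj_on \<phi> S" "g \<in> S"
  shows "blinfun_apply (pull_op S \<phi>) (ket (\<phi> g)) = ket g"
proof (rule ell2_eqI)
  fix k
  have "\<phi> k = \<phi> g \<longleftrightarrow> k = g" if "k \<in> S"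
    using assms that by (simp add: inj_on_eq_iff)
  then show "coord (blinfun_apply (pull_op S \<phi>) (ket (\<phi> g))) k = coord (ket g) k"
    using assms by (auto simp: pull_op_apply pull_vec.rep_eq coord_simps)
qed

lemma pull_op_ket_outside:
  assumes "g \<notin> \<phi> ` S"
  shows "blinfun_apply (pull_op S \<phi>) (ket g) = 0"
proof (rule ell2_eqI)
  fix k
  have "\<phi> k \<noteq> g" if "k \<in> S"
    using assms that by blast
  then show "coord (blinfun_apply (pull_op S \<phi>) (ket g)) k = coord 0 k"
    by (simp add: pull_op_apply pull_vec.rep_eq coord_simps)
qed

lemma basis_op_eq_push:
  assumes "inj_on \<phi> S" "\<phi> ` S \<subseteq> S"
  shows "basis_op S \<phi> = push_op S \<phi>"
  unfolding basis_op_def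
proof (rule the_equality)
  show *: "push_op S \<phi> \<in> ops_on S \<and> (\<forall>g\<in>S. blinfun_apply (push_op S \<phi>) (ket g) = ket (\<phi> g))"
    using assms by (simp add: push_op_ops push_op_ket)
  show "T = push_op S \<phi>" if "T \<in> ops_on S \<and> (\<forall>g\<in>S. blinfun_apply T (ket g) = ket (\<phi> g))" for T
    using that * by (intro ops_on_eqI[of T S]) auto
qed

lemma norm_push_op_le: "inj_on \<phi> S \<Longrightarrow> norm (push_op S \<phi>) \<le> 1"
  by (rule norm_blinfun_bound) (simp_all add: push_op_apply norm_push_vec norm_restr_le)

lemma norm_pull_op_le: "norm (pull_op S \<phi>) \<le> 1"
  by (rule norm_blinfun_bound) (simp_all add: pull_op_apply norm_pull_vec_le)

section \<open>Unique factorization in the semigroup\<close>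

text \<open>
  Moving a letter to the right: \<open>carry \<theta> j u = (u', j')\<close> encodes \<open>f\<^sub>j e\<^sub>u = e\<^bsub>u'\<^esub> f\<^bsub>j'\<^esub>\<close>.
\<close>

fun carry :: "('m, 'n) perm \<Rightarrow> 'n \<Rightarrow> 'm list \<Rightarrow> 'm list \<times> 'n" where
  "carry \<theta> j [] = ([], j)"
| "carry \<theta> j (i # u) =
     (let (i', j') = inv_into UNIV \<theta> (i, j); (u', j'') = carry \<theta> j' u in (i' # u', j''))"

text \<open>
  \<open>nform \<theta> w = (u, v)\<close> encodes \<open>w = e\<^sub>u f\<^sub>v\<close>. The recursion lets the letters of \<open>w\<close> act from the
  left on such pairs. Since \<open>\<theta>\<close> is a permutation, both sides of a defining relation act in the same
  way, so the pair depends only on the class of \<open>w\<close> and is a complete invariant of it.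
\<close>

fun nform :: "('m, 'n) perm \<Rightarrow> ('m, 'n) word \<Rightarrow> 'm list \<times> 'n list" where
  "nform \<theta> [] = ([], [])"
| "nform \<theta> (GenE i # w) = (case nform \<theta> w of (u, v) \<Rightarrow> (i # u, v))"
| "nform \<theta> (GenF j # w) = (case nform \<theta> w of (u, v) \<Rightarrow> case carry \<theta> j u of (u', j') \<Rightarrow> (u', j' # v))"

lemma nform_prepend: "nform \<theta> v = nform \<theta> w \<Longrightarrow> nform \<theta> (x @ v) = nform \<theta> (x @ w)"
proof (induction x)
  case (Cons g x)
  then show ?case by (cases g) simp_all
qed simp

lemma nform_fstep:
  assumes "bij \<theta>" "(v, w) \<in> fstep \<theta>"
  shows "nform \<theta> v = nform \<theta> w"
  using assms(2)
proof (cases rule: fstep.cases)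
  case (1 i j i' j' x y)
  have "inv_into UNIV \<theta> (i', j') = (i, j)"
    using 1(3) assms(1) by (metis bij_inv_eq_iff)
  then have "nform \<theta> ([GenE i, GenF j] @ y) = nform \<theta> ([GenF j', GenE i'] @ y)"
    by (simp split: prod.splits)
  then have "nform \<theta> (x @ [GenE i, GenF j] @ y) = nform \<theta> (x @ [GenF j', GenE i'] @ y)"
    by (rule nform_prepend)
  with 1 show ?thesis by simp
qed

lemma nform_fcong:
  assumes "bij \<theta>" "(v, w) \<in> fcong \<theta>"
  shows "nform \<theta> v = nform \<theta> w"
  using assms(2) unfolding fcong_def
proof (induction rule: rtrancl_induct)
  case (step x y)
  then show ?case using nform_fstep[OF assms(1)] by fastforce
qed simp

lemma cls_append_cong:
  "cls \<theta> x = cls \<theta> x' \<Longrightarrow> cls \<theta> y = cls \<theta> y' \<Longrightarrow> cls \<theta> (x @ y) = cls \<theta> (x' @ y')"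
  unfolding cls_eq_iff by (rule fcong_append)

lemma cls_swap: "\<theta> (i, j) = (i', j') \<Longrightarrow> cls \<theta> [GenE i, GenF j] = cls \<theta> [GenF j', GenE i']"
  unfolding cls_eq_iff fcong_def
  using fstep.intros[of \<theta> i j i' j' "[]" "[]"] by (simp add: r_into_rtrancl)

lemma cls_carry:
  assumes "bij \<theta>" "carry \<theta> j u = (u', j')"
  shows "cls \<theta> (GenF j # map GenE u) = cls \<theta> (map GenE u' @ [GenF j'])"
  using assms(2)
proof (induction u arbitrary: j u' j')
  case (Cons i u)
  obtain i1 j1 where 1: "inv_into UNIV \<theta> (i, j) = (i1, j1)" by force
  obtain u2 j2 where 2: "carry \<theta> j1 u = (u2, j2)" by force
  have "u' = i1 # u2" "j' = j2"
    using Cons.prems 1 2 by auto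
  have "\<theta> (i1, j1) = (i, j)"
    using 1 assms(1) by (metis bij_inv_eq_iff)
  then have "cls \<theta> ([GenF j, GenE i] @ map GenE u) = cls \<theta> ([GenE i1, GenF j1] @ map GenE u)"
    by (intro cls_append_cong refl cls_swap[symmetric])
  also have "\<dots> = cls \<theta> ([GenE i1] @ (GenF j1 # map GenE u))"
    by simp
  also have "\<dots> = cls \<theta> ([GenE i1] @ (map GenE u2 @ [GenF j2]))"
    by (intro cls_append_cong refl Cons.IH[OF 2])
  finally show ?case
    using \<open>u' = i1 # u2\<close> \<open>j' = j2\<close> by simp
qed simp

lemma cls_nform:
  assumes "bij \<theta>" "nform \<theta> w = (u, v)"
  shows "cls \<theta> w = cls \<theta> (map GenE u @ map GenF v)"
  using assms(2)
proof (induction w arbitrary: u v)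
  case (Cons g w)
  obtain u1 v1 where 1: "nform \<theta> w = (u1, v1)" by force
  have IH: "cls \<theta> ([g] @ w) = cls \<theta> ([g] @ (map GenE u1 @ map GenF v1))"
    by (intro cls_append_cong refl Cons.IH 1)
  show ?case
  proof (cases g)
    case (GenE i)
    with 1 Cons.prems have "u = i # u1" "v = v1" by simp_all
    with IH GenE show ?thesis by simp
  next
    case (GenF j)
    obtain u2 j2 where 2: "carry \<theta> j u1 = (u2, j2)" by force
    have "cls \<theta> ([g] @ w) = cls \<theta> ((GenF j # map GenE u1) @ map GenF v1)"
      using IH GenF by simp
    also have "\<dots> = cls \<theta> ((map GenE u2 @ [GenF j2]) @ map GenF v1)"
      by (intro cls_append_cong refl cls_carry 2 assms(1))
    finally have "cls \<theta> ([g] @ w) = cls \<theta> ((map GenE u2 @ [GenF j2]) @ map GenF v1)" .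
    moreover have "u = u2" "v = j2 # v1"
      using 1 2 GenF Cons.prems by simp_all
    ultimately show ?thesis by simp
  qed
qed simp

lemma cls_eq_iff_nform:
  assumes "bij \<theta>"
  shows "cls \<theta> v = cls \<theta> w \<longleftrightarrow> nform \<theta> v = nform \<theta> w"
proof
  assume "nform \<theta> v = nform \<theta> w"
  then show "cls \<theta> v = cls \<theta> w"
    using cls_nform[OF assms, of v] cls_nform[OF assms, of w] by (cases "nform \<theta> w") simp
qed (use nform_fcong[OF assms] cls_eq_iff in blast)

text \<open>
  Running \<open>carry\<close> backwards uses \<open>\<theta>\<close> in place of its inverse, so nothing is lost. This gives left
  cancellation of the letters \<open>f\<^sub>j\<close>; for the letters \<open>e\<^sub>i\<close> it is visible in the normal form.
\<close>

lemma carry_inject: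
  assumes "bij \<theta>" "carry \<theta> j u = carry \<theta> k w"
  shows "j = k \<and> u = w"
  using assms(2)
proof (induction u arbitrary: j k w)
  case Nil
  then show ?case by (cases w) (auto split: prod.splits)
next
  case (Cons i u)
  then obtain i2 w2 where w: "w = i2 # w2"
    by (cases w) (auto split: prod.splits)
  obtain i1 j1 where 1: "inv_into UNIV \<theta> (i, j) = (i1, j1)" by force
  obtain i3 j3 where 3: "inv_into UNIV \<theta> (i2, k) = (i3, j3)" by force
  have "i1 = i3" "carry \<theta> j1 u = carry \<theta> j3 w2"
    using Cons.prems w 1 3 by (auto split: prod.splits)
  with Cons.IH have "j1 = j3" "u = w2" by blast+
  with \<open>i1 = i3\<close> have "inv_into UNIV \<theta> (i, j) = inv_into UNIV \<theta> (i2, k)"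
    using 1 3 by simp
  then have "(i, j) = (i2, k)"
    using assms(1) by (metis bij_inv_eq_iff)
  with \<open>u = w2\<close> w show ?case by simp
qed

lemma wdeg_append: "wdeg (x @ y) = wdeg x + wdeg y"
  by (induction x rule: wdeg.induct) (simp_all add: prod_eq_iff)

lemma wdeg_fstep: "(v, w) \<in> fstep \<theta> \<Longrightarrow> wdeg v = wdeg w"
  by (induction rule: fstep.induct) (simp add: wdeg_append)

lemma wdeg_fcong:
  assumes "(v, w) \<in> fcong \<theta>"
  shows "wdeg v = wdeg w"
  using assms unfolding fcong_def
proof (induction rule: rtrancl_induct)
  case (step x y)
  then show ?case using wdeg_fstep by fastforce
qed simp

lemma deg_cls: "deg (cls \<theta> w) = wdeg w"
  unfolding deg_def
proof (rule the_equality)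
  show "\<forall>x\<in>cls \<theta> w. wdeg x = wdeg w"
    using wdeg_fcong by (metis in_cls_iff)
  show "d = wdeg w" if "\<forall>x\<in>cls \<theta> w. wdeg x = d" for d
    using bspec[OF that self_in_cls] by simp
qed

lemma wdeg_GenE: "wdeg (map GenE u) = (length u, 0)"
  by (induction u) simp_all

lemma wdeg_GenF: "wdeg (map GenF v) = (0, length v)"
  by (induction v) simp_all

locale perm_semigroup =
  fixes \<theta> :: "('m::finite, 'n::finite) perm"
  assumes bij_theta: "bij \<theta>"
begin

abbreviation FF :: "('m, 'n) sem set" where "FF \<equiv> carrier (Ftheta \<theta>)"

abbreviation mul :: "('m, 'n) sem \<Rightarrow> ('m, 'n) sem \<Rightarrow> ('m, 'n) sem" (infixl "\<odot>" 70)
  where "x \<odot> y \<equiv> x \<otimes>\<^bsub>Ftheta \<theta>\<^esub> y"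

abbreviation unit :: "('m, 'n) sem" where "unit \<equiv> \<one>\<^bsub>Ftheta \<theta>\<^esub>"

abbreviation E :: "'m list \<Rightarrow> ('m, 'n) sem" where "E \<equiv> eword \<theta>"

abbreviation V :: "'n list \<Rightarrow> ('m, 'n) sem" where "V \<equiv> fword \<theta>"

lemma unit_cls: "unit = cls \<theta> []"
  by (simp add: Ftheta_def)

lemma cls_FF [simp]: "cls \<theta> w \<in> FF"
  by (simp add: carrier_Ftheta)

lemma E_FF [simp]: "E u \<in> FF" and V_FF [simp]: "V v \<in> FF"
  by (simp_all add: eword_def fword_def)

lemma FF_E: "x \<in> FF \<Longrightarrow> \<exists>w. x = cls \<theta> w"
  by (auto simp: carrier_Ftheta)

lemma mul_FF [simp]: "x \<in> FF \<Longrightarrow> y \<in> FF \<Longrightarrow> x \<odot> y \<in> FF"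
  using monoid_Ftheta by (rule monoid.m_closed)

lemma unit_FF [simp]: "unit \<in> FF"
  by (simp add: unit_cls)

lemma mul_assoc: "x \<in> FF \<Longrightarrow> y \<in> FF \<Longrightarrow> z \<in> FF \<Longrightarrow> x \<odot> y \<odot> z = x \<odot> (y \<odot> z)"
  using monoid_Ftheta by (rule monoid.m_assoc)

lemma unit_mul [simp]: "x \<in> FF \<Longrightarrow> unit \<odot> x = x" and mul_unit [simp]: "x \<in> FF \<Longrightarrow> x \<odot> unit = x"
  by (simp_all add: monoid.l_one[OF monoid_Ftheta] monoid.r_one[OF monoid_Ftheta])

lemma deg_mul: "x \<in> FF \<Longrightarrow> y \<in> FF \<Longrightarrow> deg (x \<odot> y) = deg x + deg y"
  by (auto dest!: FF_E simp: mult_cls deg_cls wdeg_append)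

lemma deg_unit [simp]: "deg unit = (0, 0)"
  by (simp add: unit_cls deg_cls)

lemma deg_E [simp]: "deg (E u) = (length u, 0)" and deg_V [simp]: "deg (V v) = (0, length v)"
  by (simp_all add: eword_def fword_def deg_cls wdeg_GenE wdeg_GenF)

lemma deg_eq_0: "x \<in> FF \<Longrightarrow> deg x = (0, 0) \<Longrightarrow> x = unit"
proof -
  assume "x \<in> FF" "deg x = (0, 0)"
  then obtain w where "x = cls \<theta> w" "wdeg w = (0, 0)"
    using FF_E deg_cls by metis
  then show "x = unit"
    by (cases w rule: wdeg.cases) (simp_all add: unit_cls)
qed

lemma E_append: "E (u @ u') = E u \<odot> E u'" and V_append: "V (v @ v') = V v \<odot> V v'"
  by (simp_all add: eword_def fword_def mult_cls)

lemma E_Nil [simp]: "E [] = unit" and V_Nil [simp]: "V [] = unit"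
  by (simp_all add: eword_def fword_def unit_cls)

lemma swap_EV:
  assumes "\<theta> (i, j) = (i', j')"
  shows "E [i] \<odot> V [j] = V [j'] \<odot> E [i']"
  using cls_swap[of \<theta> i j i' j'] assms by (simp add: eword_def fword_def mult_cls)

lemma swap_VE: "\<exists>i' j'. V [j] \<odot> E [i] = E [i'] \<odot> V [j']"
proof -
  obtain i' j' where "\<theta> (i', j') = (i, j)"
    using bij_theta by (metis bij_pointE surj_pair)
  then show ?thesis using swap_EV by metis
qed

lemma E_cancel:
  assumes "x \<in> FF" "y \<in> FF" "E [i] \<odot> x = E [i'] \<odot> y"
  shows "i = i' \<and> x = y"
proof -
  obtain v w where x: "x = cls \<theta> v" and y: "y = cls \<theta> w"
    using assms FF_E by metis
  have "nform \<theta> (GenE i # v) = nform \<theta> (GenE i' # w)"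
    using assms(3) by (simp add: x y eword_def mult_cls cls_eq_iff_nform[OF bij_theta] del: nform.simps)
  then show ?thesis
    by (auto simp: x y cls_eq_iff_nform[OF bij_theta] split: prod.splits)
qed

lemma V_cancel:
  assumes "x \<in> FF" "y \<in> FF" "V [j] \<odot> x = V [j'] \<odot> y"
  shows "j = j' \<and> x = y"
proof -
  obtain v w where x: "x = cls \<theta> v" and y: "y = cls \<theta> w"
    using assms FF_E by metis
  have *: "nform \<theta> (GenF j # v) = nform \<theta> (GenF j' # w)"
    using assms(3) by (simp add: x y fword_def mult_cls cls_eq_iff_nform[OF bij_theta] del: nform.simps)
  obtain u1 v1 u2 v2 where "nform \<theta> v = (u1, v1)" "nform \<theta> w = (u2, v2)" by force
  with * have "carry \<theta> j u1 = carry \<theta> j' u2" "v1 = v2"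
    by (auto split: prod.splits)
  with carry_inject[OF bij_theta] \<open>nform \<theta> v = _\<close> \<open>nform \<theta> w = _\<close> show ?thesis
    by (auto simp: x y cls_eq_iff_nform[OF bij_theta])
qed

lemma E_word_cancel:
  assumes "x \<in> FF" "y \<in> FF" "length u = length u'" "E u \<odot> x = E u' \<odot> y"
  shows "u = u' \<and> x = y"
  using assms(3,4)
proof (induction u u' rule: list_induct2)
  case (Cons i u i' u')
  have "E [i] \<odot> (E u \<odot> x) = E [i'] \<odot> (E u' \<odot> y)"
    using Cons.prems E_append[of "[i]" u] E_append[of "[i']" u'] assms by (simp add: mul_assoc)
  then have "i = i'" "E u \<odot> x = E u' \<odot> y"
    using E_cancel assms by (meson E_FF mul_FF)+
  with Cons.IH show ?case by simp
qed (use assms in simp)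

lemma V_word_cancel:
  assumes "x \<in> FF" "y \<in> FF" "length v = length v'" "V v \<odot> x = V v' \<odot> y"
  shows "v = v' \<and> x = y"
  using assms(3,4)
proof (induction v v' rule: list_induct2)
  case (Cons j v j' v')
  have "V [j] \<odot> (V v \<odot> x) = V [j'] \<odot> (V v' \<odot> y)"
    using Cons.prems V_append[of "[j]" v] V_append[of "[j']" v'] assms by (simp add: mul_assoc)
  then have "j = j'" "V v \<odot> x = V v' \<odot> y"
    using V_cancel assms by (meson V_FF mul_FF)+
  with Cons.IH show ?case by simp
qed (use assms in simp)

text \<open>
  A letter \<open>e\<^sub>i\<close> that occurs anywhere in a word can be moved to its front, past one letter \<open>f\<^sub>j\<close> at a
  time.
\<close>

lemma split_E:
  assumes "x \<in> FF" "0 < fst (deg x)"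
  shows "\<exists>i. \<exists>y\<in>FF. x = E [i] \<odot> y"
proof -
  have "\<exists>i y. cls \<theta> w = E [i] \<odot> cls \<theta> y" if "0 < fst (wdeg w)" for w
    using that
  proof (induction w rule: wdeg.induct)
    case (2 i w)
    have "cls \<theta> (GenE i # w) = E [i] \<odot> cls \<theta> w"
      by (simp add: eword_def mult_cls)
    then show ?case by blast
  next
    case (3 j w)
    then obtain i y where "cls \<theta> w = E [i] \<odot> cls \<theta> y" by auto
    moreover obtain i' j' where "V [j] \<odot> E [i] = E [i'] \<odot> V [j']"
      using swap_VE by blast
    moreover have "cls \<theta> (GenF j # w) = V [j] \<odot> cls \<theta> w"
      by (simp add: fword_def mult_cls)
    ultimately have "cls \<theta> (GenF j # w) = E [i'] \<odot> (V [j'] \<odot> cls \<theta> y)"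
      by (metis mul_assoc E_FF V_FF cls_FF)
    then show ?case by (metis fword_def mult_cls)
  qed simp
  then show ?thesis using assms FF_E deg_cls by (metis cls_FF)
qed

lemma split_V:
  assumes "x \<in> FF" "0 < snd (deg x)"
  shows "\<exists>j. \<exists>y\<in>FF. x = V [j] \<odot> y"
proof -
  have "\<exists>j y. cls \<theta> w = V [j] \<odot> cls \<theta> y" if "0 < snd (wdeg w)" for w
    using that
  proof (induction w rule: wdeg.induct)
    case (2 i w)
    then obtain j y where "cls \<theta> w = V [j] \<odot> cls \<theta> y" by auto
    moreover obtain i' j' where "E [i] \<odot> V [j] = V [j'] \<odot> E [i']"
      using swap_EV by (metis surj_pair)
    moreover have "cls \<theta> (GenE i # w) = E [i] \<odot> cls \<theta> w"
      by (simp add: eword_def mult_cls)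
    ultimately have "cls \<theta> (GenE i # w) = V [j'] \<odot> (E [i'] \<odot> cls \<theta> y)"
      by (metis mul_assoc E_FF V_FF cls_FF)
    then show ?case by (metis eword_def mult_cls)
  next
    case (3 j w)
    have "cls \<theta> (GenF j # w) = V [j] \<odot> cls \<theta> w"
      by (simp add: fword_def mult_cls)
    then show ?case by blast
  qed simp
  then show ?thesis using assms FF_E deg_cls by (metis cls_FF)
qed

lemma split_E_word:
  assumes "x \<in> FF" "k \<le> fst (deg x)"
  shows "\<exists>u. \<exists>y\<in>FF. length u = k \<and> x = E u \<odot> y"
  using assms(2)
proof (induction k)
  case 0
  then show ?case using assms(1) by (intro exI[of _ "[]"]) simp
next
  case (Suc k)
  then obtain u y where uy: "y \<in> FF" "length u = k" "x = E u \<odot> y" by auto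
  then have "0 < fst (deg y)" using Suc.prems by (simp add: deg_mul)
  then obtain i z where iz: "z \<in> FF" "y = E [i] \<odot> z" using split_E uy by blast
  then have "x = E (u @ [i]) \<odot> z" using uy by (simp add: E_append mul_assoc)
  with iz uy show ?case by (intro exI[of _ "u @ [i]"]) auto
qed

lemma split_V_word:
  assumes "x \<in> FF" "k \<le> snd (deg x)"
  shows "\<exists>v. \<exists>y\<in>FF. length v = k \<and> x = V v \<odot> y"
  using assms(2)
proof (induction k)
  case 0
  then show ?case using assms(1) by (intro exI[of _ "[]"]) simp
next
  case (Suc k)
  then obtain v y where uy: "y \<in> FF" "length v = k" "x = V v \<odot> y" by auto
  then have "0 < snd (deg y)" using Suc.prems by (simp add: deg_mul)
  then obtain j z where iz: "z \<in> FF" "y = V [j] \<odot> z" using split_V uy by blast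
  then have "x = V (v @ [j]) \<odot> z" using uy by (simp add: V_append mul_assoc)
  with iz uy show ?case by (intro exI[of _ "v @ [j]"]) auto
qed

lemma split_EV:
  assumes "x \<in> FF" "k \<le> fst (deg x)" "l \<le> snd (deg x)"
  shows "\<exists>u v. \<exists>y\<in>FF. length u = k \<and> length v = l \<and> x = E u \<odot> V v \<odot> y"
proof -
  obtain u y where uy: "y \<in> FF" "length u = k" "x = E u \<odot> y"
    using split_E_word assms by blast
  have "l \<le> snd (deg y)" using assms uy by (simp add: deg_mul)
  then obtain v z where "z \<in> FF" "length v = l" "y = V v \<odot> z"
    using split_V_word uy by blast
  with uy show ?thesis by (metis mul_assoc E_FF V_FF)
qed

lemma factor_exists:
  assumes "x \<in> FF" "k \<le> fst (deg x)" "l \<le> snd (deg x)"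
  shows "\<exists>w\<in>FF. \<exists>y\<in>FF. deg w = (k, l) \<and> x = w \<odot> y"
proof -
  obtain u v y where "y \<in> FF" "length u = k" "length v = l" "x = E u \<odot> V v \<odot> y"
    using split_EV[OF assms] by blast
  then show ?thesis by (intro bexI[of _ "E u \<odot> V v"] bexI[of _ y]) (simp_all add: deg_mul)
qed

lemma degree_word:
  assumes "x \<in> FF"
  shows "\<exists>u v. length u = fst (deg x) \<and> length v = snd (deg x) \<and> x = E u \<odot> V v"
proof -
  obtain u v y where uv: "y \<in> FF" "length u = fst (deg x)" "length v = snd (deg x)" "x = E u \<odot> V v \<odot> y"
    using split_EV[OF assms order_refl order_refl] by blast
  then have "deg x = deg x + deg y"
    by (metis (no_types, lifting) deg_mul deg_E deg_V E_FF V_FF mul_FF add_Pair add_0 add.right_neutral prod.collapse)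
  then have "deg y = (0, 0)"
    by (metis add_cancel_left_right prod.collapse fst_add snd_add)
  then have "y = unit" using deg_eq_0 uv by blast
  with uv show ?thesis by auto
qed

text \<open>
  Writing the left factors as \<open>e\<^sub>u f\<^sub>v\<close> with prescribed lengths reduces this to cancelling single letters.
\<close>

lemma factor_unique:
  assumes "x \<in> FF" "x' \<in> FF" "y \<in> FF" "y' \<in> FF" "deg x = deg x'" "x \<odot> y = x' \<odot> y'"
  shows "x = x' \<and> y = y'"
proof -
  obtain u v where x: "length u = fst (deg x)" "length v = snd (deg x)" "x = E u \<odot> V v"
    using degree_word assms by blast
  obtain u' v' where x': "length u' = fst (deg x)" "length v' = snd (deg x)" "x' = E u' \<odot> V v'"
    using degree_word assms by metis
  have "E u \<odot> (V v \<odot> y) = E u' \<odot> (V v' \<odot> y')"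
    using assms x x' by (simp add: mul_assoc)
  then have "u = u'" "V v \<odot> y = V v' \<odot> y'"
    using E_word_cancel[of "V v \<odot> y" "V v' \<odot> y'" u u'] assms x x' by auto
  then show ?thesis
    using V_word_cancel[of y y' v v'] assms x x' by auto
qed

lemma E_inject: "E u = E u' \<Longrightarrow> u = u'"
  by (metis E_word_cancel E_FF mul_unit unit_FF deg_E prod.inject)

lemma V_inject: "V v = V v' \<Longrightarrow> v = v'"
  by (metis V_word_cancel V_FF mul_unit unit_FF deg_V prod.inject)

lemma degree_E:
  assumes "x \<in> FF" "deg x = (k, 0)"
  shows "\<exists>u. length u = k \<and> x = E u"
  using degree_word[OF assms(1)] assms(2) by auto

lemma degree_V:
  assumes "x \<in> FF" "deg x = (0, l)"
  shows "\<exists>v. length v = l \<and> x = V v"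
  using degree_word[OF assms(1)] assms(2) by auto

end

section \<open>Actions with unique factorization\<close>

text \<open>
  The model is a set of infinite words, on which the semigroup acts by prepending. The shifts
  \<open>ket x \<mapsto> ket (\<alpha> w x)\<close> form a *-representation, because the ranges of the generators of
  one kind partition the space.
\<close>

locale semigroup_action = perm_semigroup \<theta>
  for \<theta> :: "('m::finite, 'n::finite) perm" +
  fixes S :: "'x set" and \<alpha> :: "('m, 'n) sem \<Rightarrow> 'x \<Rightarrow> 'x"
  assumes act_closed: "w \<in> FF \<Longrightarrow> x \<in> S \<Longrightarrow> \<alpha> w x \<in> S"
    and act_unit: "x \<in> S \<Longrightarrow> \<alpha> unit x = x"
    and act_mul: "v \<in> FF \<Longrightarrow> w \<in> FF \<Longrightarrow> x \<in> S \<Longrightarrow> \<alpha> (v \<odot> w) x = \<alpha> v (\<alpha> w x)"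
    and act_factor: "x \<in> S \<Longrightarrow> \<exists>w\<in>FF. \<exists>y\<in>S. deg w = (k, l) \<and> x = \<alpha> w y"
    and act_unique: "v \<in> FF \<Longrightarrow> w \<in> FF \<Longrightarrow> x \<in> S \<Longrightarrow> y \<in> S \<Longrightarrow> deg v = deg w \<Longrightarrow>
        \<alpha> v x = \<alpha> w y \<Longrightarrow> v = w \<and> x = y"
begin

lemma act_inj: "w \<in> FF \<Longrightarrow> inj_on (\<alpha> w) S"
  by (rule inj_onI) (use act_unique in blast)

lemma ranges_disjoint:
  assumes "v \<in> FF" "w \<in> FF" "deg v = deg w" "v \<noteq> w"
  shows "\<alpha> v ` S \<inter> \<alpha> w ` S = {}"
proof (rule ccontr)
  assume "\<alpha> v ` S \<inter> \<alpha> w ` S \<noteq> {}"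
  then obtain x y where "x \<in> S" "y \<in> S" "\<alpha> v x = \<alpha> w y" by blast
  with assms act_unique[of v w x y] show False by blast
qed

lemma act_image: "w \<in> FF \<Longrightarrow> \<alpha> w ` S \<subseteq> S"
  using act_closed by blast

definition shift :: "('m, 'n) sem \<Rightarrow> 'x oper" where
  "shift w = push_op S (\<alpha> w)"

definition coshift :: "('m, 'n) sem \<Rightarrow> 'x oper" where
  "coshift w = pull_op S (\<alpha> w)"

lemma basis_op_shift: "w \<in> FF \<Longrightarrow> basis_op S (\<alpha> w) = shift w"
  unfolding shift_def by (rule basis_op_eq_push[OF act_inj act_image])

lemma adjoint_pair_shift: "w \<in> FF \<Longrightarrow> adjoint_pair (shift w) (coshift w)"
  unfolding shift_def coshift_def by (rule adjoint_pair_push_pull[OF act_inj])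

lemma adj_shift: "w \<in> FF \<Longrightarrow> adj (shift w) = coshift w"
  by (rule adj_eqI[OF adjoint_pair_shift])

lemma shift_ops: "w \<in> FF \<Longrightarrow> shift w \<in> ops_on S"
  unfolding shift_def by (rule push_op_ops[OF act_inj act_image])

lemma coshift_ops: "w \<in> FF \<Longrightarrow> coshift w \<in> ops_on S"
  unfolding coshift_def by (rule pull_op_ops[OF act_image])

lemma shift_ket: "w \<in> FF \<Longrightarrow> x \<in> S \<Longrightarrow> blinfun_apply (shift w) (ket x) = ket (\<alpha> w x)"
  unfolding shift_def by (rule push_op_ket[OF act_inj])

lemma coshift_ket: "w \<in> FF \<Longrightarrow> x \<in> S \<Longrightarrow> blinfun_apply (coshift w) (ket (\<alpha> w x)) = ket x"
  unfolding coshift_def by (rule pull_op_ket[OF act_inj])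

lemma coshift_ket_outside: "x \<notin> \<alpha> w ` S \<Longrightarrow> blinfun_apply (coshift w) (ket x) = 0"
  unfolding coshift_def by (rule pull_op_ket_outside)

lemma coord_coshift: "w \<in> FF \<Longrightarrow> x \<in> S \<Longrightarrow> coord (blinfun_apply (coshift w) f) x = coord f (\<alpha> w x)"
  by (simp add: coshift_def pull_op_apply pull_vec.rep_eq act_inj)

lemma norm_shift_le: "w \<in> FF \<Longrightarrow> norm (shift w) \<le> 1" and norm_coshift_le: "norm (coshift w) \<le> 1"
  by (simp_all add: shift_def coshift_def norm_push_op_le act_inj norm_pull_op_le)

lemma shift_unit: "shift unit = id_on S"
  by (rule ops_on_eqI[OF shift_ops id_on_ops]) (simp_all add: shift_ket act_unit restr_ket)

lemma shift_mul: "v \<in> FF \<Longrightarrow> w \<in> FF \<Longrightarrow> shift (v \<odot> w) = shift v o\<^sub>L shift w"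
  by (rule ops_on_eqI[OF shift_ops comp_ops[OF shift_ops shift_ops]])
     (simp_all add: shift_ket act_mul act_closed)

lemma shift_eqI:
  assumes "v \<in> FF" "w \<in> FF" "\<And>x. x \<in> S \<Longrightarrow> \<alpha> v x = \<alpha> w x"
  shows "shift v = shift w"
  by (rule ops_on_eqI[OF shift_ops shift_ops]) (simp_all add: assms shift_ket)

lemma coshift_shift: "w \<in> FF \<Longrightarrow> coshift w o\<^sub>L shift w = id_on S"
  by (rule ops_on_eqI[OF comp_ops[OF coshift_ops shift_ops] id_on_ops])
     (simp_all add: shift_ket coshift_ket restr_ket)

lemma coshift_shift_disjoint:
  assumes "v \<in> FF" "w \<in> FF" "\<alpha> v ` S \<inter> \<alpha> w ` S = {}"
  shows "coshift v o\<^sub>L shift w = 0"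
proof (rule ops_on_eqI[OF comp_ops[OF coshift_ops shift_ops] zero_ops])
  fix g assume g: "g \<in> S"
  then have "\<alpha> w g \<notin> \<alpha> v ` S" using assms(3) by blast
  then show "blinfun_apply (coshift v o\<^sub>L shift w) (ket g) = blinfun_apply 0 (ket g)"
    by (simp add: shift_ket g assms coshift_ket_outside)
qed (use assms in auto)

text \<open>
  Each \<open>x\<close> has one prefix of degree \<open>d\<close>, so it is in the range of exactly one of the maps \<open>\<alpha> (W i)\<close>, and
  the summands are the projections onto these ranges.
\<close>

lemma range_partition:
  fixes W :: "'i::finite \<Rightarrow> ('m, 'n) sem"
  assumes W: "\<And>i. W i \<in> FF" "\<And>i. deg (W i) = d" "inj W"
    and ex: "\<And>w. w \<in> FF \<Longrightarrow> deg w = d \<Longrightarrow> \<exists>i. w = W i"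
  shows "(\<Sum>i\<in>UNIV. shift (W i) o\<^sub>L adj (shift (W i))) = id_on S"
proof (rule ops_on_eqI)
  show "(\<Sum>i\<in>UNIV. shift (W i) o\<^sub>L adj (shift (W i))) \<in> ops_on S"
    by (rule sum_ops) (simp add: W adj_shift comp_ops shift_ops coshift_ops)
  fix x assume "x \<in> S"
  obtain k l where d: "d = (k, l)" by force
  obtain w y where "w \<in> FF" "y \<in> S" "deg w = d" "x = \<alpha> w y"
    using act_factor[OF \<open>x \<in> S\<close>, of k l] d by blast
  then obtain i where y: "y \<in> S" "x = \<alpha> (W i) y"
    using ex by blast
  have "blinfun_apply (shift (W j) o\<^sub>L adj (shift (W j))) (ket x) = (if j = i then ket x else 0)" for j
  proof (cases "j = i")
    case True
    then show ?thesis by (simp add: y W adj_shift coshift_ket shift_ket)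
  next
    case False
    have "W j \<noteq> W i" "deg (W j) = deg (W i)"
      using False W(2) injD[OF W(3)] by auto
    then have "x \<notin> \<alpha> (W j) ` S"
      using ranges_disjoint[OF W(1)[of j] W(1)[of i]] y by blast
    then show ?thesis using False by (simp add: W adj_shift coshift_ket_outside blinfun.zero_right)
  qed
  then have "blinfun_apply (\<Sum>i\<in>UNIV. shift (W i) o\<^sub>L adj (shift (W i))) (ket x) = ket x"
    by (simp add: blinfun.sum_left del: blinfun_apply_blinfun_compose)
  then show "blinfun_apply (\<Sum>i\<in>UNIV. shift (W i) o\<^sub>L adj (shift (W i))) (ket x) = blinfun_apply (id_on S) (ket x)"
    using \<open>x \<in> S\<close> by (simp add: restr_ket)
qed (rule id_on_ops)

lemma sum_E: "(\<Sum>i\<in>UNIV. shift (E [i]) o\<^sub>L adj (shift (E [i]))) = id_on S"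
proof (rule range_partition)
  show "inj (\<lambda>i. E [i])" by (rule injI) (use E_inject in blast)
  show "\<exists>i. w = E [i]" if "w \<in> FF" "deg w = (1, 0)" for w
    using degree_E[OF that] by (auto simp: length_Suc_conv)
qed simp_all

lemma sum_V: "(\<Sum>j\<in>UNIV. shift (V [j]) o\<^sub>L adj (shift (V [j]))) = id_on S"
proof (rule range_partition)
  show "inj (\<lambda>j. V [j])" by (rule injI) (use V_inject in blast)
  show "\<exists>j. w = V [j]" if "w \<in> FF" "deg w = (0, 1)" for w
    using degree_V[OF that] by (auto simp: length_Suc_conv)
qed simp_all

lemma star_rep_act: "star_rep \<theta> (S, \<lambda>w. basis_op S (\<alpha> w))"
  unfolding star_rep_def prod.case
proof (intro conjI ballI allI)
  fix v w x assume v: "v \<in> FF" and w: "w \<in> FF"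
  show "basis_op S (\<alpha> (v \<odot> w)) = basis_op S (\<alpha> v) o\<^sub>L basis_op S (\<alpha> w)"
    by (simp add: v w basis_op_shift shift_mul)
next
  fix w x assume w: "w \<in> FF"
  show "basis_op S (\<alpha> w) \<in> ops_on S"
    by (simp add: w basis_op_shift shift_ops)
  show "norm (blinfun_apply (basis_op S (\<alpha> w)) (restr S x)) = norm (restr S x)"
    by (simp add: w basis_op_shift shift_def push_op_apply norm_push_vec act_inj restr_restr)
qed (simp_all add: basis_op_shift shift_unit sum_E sum_V)

end

section \<open>Simplicity for aperiodic actions\<close>

text \<open>
  The assumption \<open>separated\<close> identifies a point with the infinite word that it spells, and \<open>effective\<close> is
  trivial isotropy, in the form that makes sense if different elements of the semigroup may act in the
  same way, as \<open>e\<^sub>u\<close> and \<open>f\<^bsub>\<gamma> u\<^esub>\<close> do on the orbits of \<open>W\<close>.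
\<close>

locale aperiodic_action = semigroup_action \<theta> S \<alpha>
  for \<theta> :: "('m::finite, 'n::finite) perm" and S :: "'x set" and \<alpha> +
  assumes nonempty: "S \<noteq> {}"
    and separated: "x \<in> S \<Longrightarrow> y \<in> S \<Longrightarrow>
      (\<And>k l. \<exists>w\<in>FF. \<exists>x'\<in>S. \<exists>y'\<in>S. deg w = (k, l) \<and> x = \<alpha> w x' \<and> y = \<alpha> w y') \<Longrightarrow> x = y"
    and effective: "v \<in> FF \<Longrightarrow> w \<in> FF \<Longrightarrow> y \<in> S \<Longrightarrow> \<alpha> v y = \<alpha> w y \<Longrightarrow> z \<in> S \<Longrightarrow> \<alpha> v z = \<alpha> w z"
    and transitive: "x \<in> S \<Longrightarrow> y \<in> S \<Longrightarrow> \<exists>z\<in>S. \<exists>g\<in>FF. \<exists>h\<in>FF. x = \<alpha> g z \<and> y = \<alpha> h z"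
begin

inductive_set shift_span :: "'x oper set" where
  shift: "w \<in> FF \<Longrightarrow> shift w \<in> shift_span"
| add: "A \<in> shift_span \<Longrightarrow> B \<in> shift_span \<Longrightarrow> A + B \<in> shift_span"
| scale: "A \<in> shift_span \<Longrightarrow> op_cscale c A \<in> shift_span"

text \<open>
  The values of the families in \<open>star_poly\<close> at the representation by shifts.
\<close>

inductive_set star_alg :: "'x oper set" where
  gen: "w \<in> FF \<Longrightarrow> shift w \<in> star_alg"
| add: "A \<in> star_alg \<Longrightarrow> B \<in> star_alg \<Longrightarrow> A + B \<in> star_alg"
| scale: "A \<in> star_alg \<Longrightarrow> op_cscale c A \<in> star_alg"
| mult: "A \<in> star_alg \<Longrightarrow> B \<in> star_alg \<Longrightarrow> A o\<^sub>L B \<in> star_alg"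
| star: "A \<in> star_alg \<Longrightarrow> adj A \<in> star_alg"

text \<open>
  A polynomial contains adjoints of shifts, which are cancelled by composition with a sufficiently long
  shift. The uniform bound \<open>N\<close> makes this property pass to sums and compositions; for the star, it is
  carried along for an operator and its adjoint simultaneously.
\<close>

definition absorbed :: "'x oper \<Rightarrow> bool" where
  "absorbed A \<longleftrightarrow> A \<in> ops_on S \<and>
     (\<exists>N. \<forall>w\<in>FF. N \<le> fst (deg w) \<and> N \<le> snd (deg w) \<longrightarrow> A o\<^sub>L shift w \<in> shift_span)"

lemma zero_shift_span: "0 \<in> shift_span"
proof -
  have "op_cscale 0 (shift unit) = 0"
    by (intro blinfun_eqI ell2_eqI) (simp add: coord_simps)
  then show ?thesis by (metis shift_span.shift shift_span.scale unit_FF)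
qed

text \<open>
  A prefix long enough for both operators splits: the first part turns \<open>B\<close> into a combination of shifts,
  and the second part is still there for \<open>A\<close> after each of these shifts.
\<close>

lemma absorbed_comp:
  assumes A: "absorbed A" and B: "absorbed B"
  shows "absorbed (A o\<^sub>L B)"
proof -
  obtain M where M: "\<And>w. w \<in> FF \<Longrightarrow> M \<le> fst (deg w) \<Longrightarrow> M \<le> snd (deg w) \<Longrightarrow> A o\<^sub>L shift w \<in> shift_span"
    using A by (auto simp: absorbed_def)
  obtain N where N: "\<And>w. w \<in> FF \<Longrightarrow> N \<le> fst (deg w) \<Longrightarrow> N \<le> snd (deg w) \<Longrightarrow> B o\<^sub>L shift w \<in> shift_span"
    using B by (auto simp: absorbed_def)
  have span: "A o\<^sub>L (C o\<^sub>L shift w) \<in> shift_span"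
    if "C \<in> shift_span" "w \<in> FF" "M \<le> fst (deg w)" "M \<le> snd (deg w)" for C w
    using that
  proof (induction rule: shift_span.induct)
    case (shift v)
    then show ?case by (simp add: shift_mul[symmetric] M deg_mul trans_le_add2)
  next
    case (scale C c)
    moreover have "A \<in> ops_on S" using A by (simp add: absorbed_def)
    ultimately show ?case by (simp add: comp_cscale_left comp_cscale_right shift_span.scale)
  qed (simp add: comp_add_left comp_add_right shift_span.add)
  have "A o\<^sub>L B o\<^sub>L shift w \<in> shift_span" if w: "w \<in> FF" "M + N \<le> fst (deg w)" "M + N \<le> snd (deg w)" for w
  proof -
    obtain v u where vu: "v \<in> FF" "u \<in> FF" "deg v = (N, N)" "w = v \<odot> u"
      using factor_exists[of w N N] w by auto
    have "A o\<^sub>L ((B o\<^sub>L shift v) o\<^sub>L shift u) \<in> shift_span"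
      by (rule span) (use vu w in \<open>simp_all add: N deg_mul\<close>)
    then show ?thesis by (simp add: vu shift_mul comp_assoc)
  qed
  then show ?thesis
    using A B unfolding absorbed_def by (blast intro: comp_ops)
qed

lemma absorbed_add:
  assumes A: "absorbed A" and B: "absorbed B"
  shows "absorbed (A + B)"
proof -
  obtain M where M: "\<And>w. w \<in> FF \<Longrightarrow> M \<le> fst (deg w) \<Longrightarrow> M \<le> snd (deg w) \<Longrightarrow> A o\<^sub>L shift w \<in> shift_span"
    using A by (auto simp: absorbed_def)
  obtain N where N: "\<And>w. w \<in> FF \<Longrightarrow> N \<le> fst (deg w) \<Longrightarrow> N \<le> snd (deg w) \<Longrightarrow> B o\<^sub>L shift w \<in> shift_span"
    using B by (auto simp: absorbed_def)
  have "(A + B) o\<^sub>L shift w \<in> shift_span" if "w \<in> FF" "max M N \<le> fst (deg w)" "max M N \<le> snd (deg w)" for w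
    using M N that by (simp add: comp_add_left shift_span.add)
  then show ?thesis
    using A B unfolding absorbed_def by (blast intro: add_ops)
qed

lemma absorbed_scale: "absorbed A \<Longrightarrow> absorbed (op_cscale c A)"
  unfolding absorbed_def by (metis cscale_ops comp_cscale_left shift_span.scale)

lemma absorbed_shift: "w \<in> FF \<Longrightarrow> absorbed (shift w)"
  unfolding absorbed_def by (metis shift_ops shift_mul shift_span.shift mul_FF)

text \<open>
  A long \<open>v\<close> has a prefix \<open>p\<close> of the degree of \<open>w\<close>. Then \<open>s\<^sub>w\<^sup>* s\<^sub>p\<close> is the identity or zero, according to
  whether \<open>p = w\<close>, and the rest of \<open>v\<close> remains.
\<close>

lemma absorbed_coshift:
  assumes w: "w \<in> FF"
  shows "absorbed (coshift w)"
proof -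
  have "coshift w o\<^sub>L shift v \<in> shift_span"
    if v: "v \<in> FF" "max (fst (deg w)) (snd (deg w)) \<le> fst (deg v)"
      "max (fst (deg w)) (snd (deg w)) \<le> snd (deg v)" for v
  proof -
    obtain p q where pq: "p \<in> FF" "q \<in> FF" "deg p = deg w" "v = p \<odot> q"
      using factor_exists[of v "fst (deg w)" "snd (deg w)"] v by auto
    have eq: "coshift w o\<^sub>L shift v = (coshift w o\<^sub>L shift p) o\<^sub>L shift q"
      by (simp add: pq shift_mul comp_assoc)
    show ?thesis
    proof (cases "p = w")
      case True
      then have "coshift w o\<^sub>L shift v = id_on S o\<^sub>L shift q"
        using eq w by (simp add: coshift_shift)
      also have "\<dots> = shift q"
        by (rule blinfun_eqI) (simp add: ops_on_restr(2)[OF shift_ops] pq)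
      finally show ?thesis by (simp add: pq shift_span.shift)
    next
      case False
      then have "\<alpha> w ` S \<inter> \<alpha> p ` S = {}"
        using ranges_disjoint[OF w pq(1)] pq(3) by metis
      then have "coshift w o\<^sub>L shift v = 0"
        using eq w pq by (simp add: coshift_shift_disjoint)
      then show ?thesis by (simp add: zero_shift_span)
    qed
  qed
  then show ?thesis
    unfolding absorbed_def using coshift_ops[OF w] by blast
qed

lemma star_alg_absorbed: "A \<in> star_alg \<Longrightarrow> \<exists>B. adjoint_pair A B \<and> absorbed A \<and> absorbed B"
proof (induction rule: star_alg.induct)
  case (gen w)
  then show ?case using adjoint_pair_shift absorbed_shift absorbed_coshift by blast
next
  case (add A B)
  then show ?case using adjoint_pair_add absorbed_add by blast
next
  case (scale A c)
  then show ?case using adjoint_pair_cscale absorbed_scale by blast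
next
  case (mult A B)
  then show ?case using adjoint_pair_comp absorbed_comp by blast
next
  case (star A)
  then show ?case using adjoint_pair_sym adj_eqI by metis
qed

text \<open>
  The points \<open>vy\<close> and \<open>wy\<close> have different prefixes of some degree. As soon as the prefix \<open>u\<close> of \<open>y\<close> is
  that long, these prefixes are already prefixes of \<open>vu\<close> and \<open>wu\<close>, and keep the ranges apart.
\<close>

lemma disjoint_ranges:
  assumes vw: "v \<in> FF" "w \<in> FF" and y: "y \<in> S" and ne: "\<alpha> v y \<noteq> \<alpha> w y"
  shows "\<exists>N. \<forall>u\<in>FF. \<forall>z\<in>S. y = \<alpha> u z \<and> N \<le> fst (deg u) \<and> N \<le> snd (deg u) \<longrightarrow>
    \<alpha> (v \<odot> u) ` S \<inter> \<alpha> (w \<odot> u) ` S = {}"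
proof -
  obtain k l where kl: "\<And>p x' y'. p \<in> FF \<Longrightarrow> x' \<in> S \<Longrightarrow> y' \<in> S \<Longrightarrow> deg p = (k, l) \<Longrightarrow>
      \<alpha> v y = \<alpha> p x' \<Longrightarrow> \<alpha> w y = \<alpha> p y' \<Longrightarrow> False"
    using separated[of "\<alpha> v y" "\<alpha> w y"] ne vw y act_closed by blast
  have "\<alpha> (v \<odot> u) ` S \<inter> \<alpha> (w \<odot> u) ` S = {}"
    if u: "u \<in> FF" "z \<in> S" "y = \<alpha> u z" "max k l \<le> fst (deg u)" "max k l \<le> snd (deg u)" for u z
  proof (rule ccontr)
    assume "\<alpha> (v \<odot> u) ` S \<inter> \<alpha> (w \<odot> u) ` S \<noteq> {}"
    then obtain s t where st: "s \<in> S" "t \<in> S" "\<alpha> (v \<odot> u) s = \<alpha> (w \<odot> u) t" by blast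
    obtain p p' where p: "p \<in> FF" "p' \<in> FF" "deg p = (k, l)" "v \<odot> u = p \<odot> p'"
      using factor_exists[of "v \<odot> u" k l] vw u by (auto simp: deg_mul)
    obtain q q' where q: "q \<in> FF" "q' \<in> FF" "deg q = (k, l)" "w \<odot> u = q \<odot> q'"
      using factor_exists[of "w \<odot> u" k l] vw u by (auto simp: deg_mul)
    have "\<alpha> p (\<alpha> p' s) = \<alpha> q (\<alpha> q' t)"
      using st p q by (simp add: act_mul[symmetric])
    then have "p = q"
      using act_unique[of p q "\<alpha> p' s" "\<alpha> q' t"] p q st act_closed by simp
    have "\<alpha> v y = \<alpha> p (\<alpha> p' z)"
      using u p vw by (simp add: act_mul[symmetric])
    moreover have "\<alpha> w y = \<alpha> p (\<alpha> q' z)"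
      using u q vw \<open>p = q\<close> by (simp add: act_mul[symmetric])
    ultimately show False
      using kl[of p "\<alpha> p' z" "\<alpha> q' z"] p q u act_closed by blast
  qed
  then show ?thesis by (intro exI[of _ "max k l"]) blast
qed

text \<open>
  A shift \<open>s\<^sub>v\<close> with \<open>vy = wy\<close> equals \<open>s\<^sub>w\<close> by effectiveness, so its compression is the identity. Any other
  one is compressed to zero by \<open>disjoint_ranges\<close>. The scalar adds up the
  coefficients of the shifts of the first kind.
\<close>

lemma compress_span:
  assumes "A \<in> shift_span" and w: "w \<in> FF" and y: "y \<in> S"
  shows "\<exists>N. \<forall>u\<in>FF. \<forall>z\<in>S. y = \<alpha> u z \<and> N \<le> fst (deg u) \<and> N \<le> snd (deg u) \<longrightarrow>
    coshift (w \<odot> u) o\<^sub>L (A o\<^sub>L shift u) =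
      op_cscale (coord (blinfun_apply A (ket y)) (\<alpha> w y)) (id_on S)"
  using assms(1)
proof (induction rule: shift_span.induct)
  case (shift v)
  show ?case
  proof (cases "\<alpha> v y = \<alpha> w y")
    case True
    have "shift v = shift w"
      by (rule shift_eqI) (use shift w effective[OF shift w y True] in auto)
    have "coshift (w \<odot> u) o\<^sub>L (shift v o\<^sub>L shift u) = op_cscale 1 (id_on S)" if "u \<in> FF" for u
    proof -
      have "coshift (w \<odot> u) o\<^sub>L (shift v o\<^sub>L shift u) = id_on S"
        using \<open>shift v = shift w\<close> that w by (simp add: shift_mul[symmetric] coshift_shift)
      also have "\<dots> = op_cscale 1 (id_on S)"
        by (intro blinfun_eqI ell2_eqI) (simp add: coord_simps)
      finally show ?thesis .
    qed
    moreover have "coord (blinfun_apply (shift v) (ket y)) (\<alpha> w y) = 1"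
      using shift y True by (simp add: shift_ket ket.rep_eq)
    ultimately show ?thesis by metis
  next
    case False
    obtain N where N: "\<And>u z. u \<in> FF \<Longrightarrow> z \<in> S \<Longrightarrow> y = \<alpha> u z \<Longrightarrow> N \<le> fst (deg u) \<Longrightarrow> N \<le> snd (deg u) \<Longrightarrow>
        \<alpha> (w \<odot> u) ` S \<inter> \<alpha> (v \<odot> u) ` S = {}"
      using disjoint_ranges[OF w shift y] False by metis
    have "coord (blinfun_apply (shift v) (ket y)) (\<alpha> w y) = 0"
      using shift y False by (simp add: shift_ket ket.rep_eq)
    moreover have "op_cscale 0 (id_on S) = 0"
      by (intro blinfun_eqI ell2_eqI) (simp add: coord_simps)
    moreover have "coshift (w \<odot> u) o\<^sub>L (shift v o\<^sub>L shift u) = 0"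
      if "u \<in> FF" "z \<in> S" "y = \<alpha> u z" "N \<le> fst (deg u)" "N \<le> snd (deg u)" for u z
      using N[OF that] that w shift by (simp add: shift_mul[symmetric] coshift_shift_disjoint)
    ultimately show ?thesis by (intro exI[of _ N]) auto
  qed
next
  case (add A B)
  then obtain M N where
    M: "\<And>u z. u \<in> FF \<Longrightarrow> z \<in> S \<Longrightarrow> y = \<alpha> u z \<and> M \<le> fst (deg u) \<and> M \<le> snd (deg u) \<Longrightarrow>
      coshift (w \<odot> u) o\<^sub>L (A o\<^sub>L shift u) = op_cscale (coord (blinfun_apply A (ket y)) (\<alpha> w y)) (id_on S)" and
    N: "\<And>u z. u \<in> FF \<Longrightarrow> z \<in> S \<Longrightarrow> y = \<alpha> u z \<and> N \<le> fst (deg u) \<and> N \<le> snd (deg u) \<Longrightarrow>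
      coshift (w \<odot> u) o\<^sub>L (B o\<^sub>L shift u) = op_cscale (coord (blinfun_apply B (ket y)) (\<alpha> w y)) (id_on S)"
    by blast
  have distrib: "op_cscale (c + d) T = op_cscale c T + op_cscale d T" for c d and T :: "'x oper"
    by (intro blinfun_eqI ell2_eqI) (simp add: blinfun.add_left coord_simps algebra_simps)
  show ?case
  proof (intro exI[of _ "max M N"] ballI impI)
    fix u z
    assume u: "u \<in> FF" "z \<in> S" "y = \<alpha> u z \<and> max M N \<le> fst (deg u) \<and> max M N \<le> snd (deg u)"
    show "coshift (w \<odot> u) o\<^sub>L ((A + B) o\<^sub>L shift u) =
        op_cscale (coord (blinfun_apply (A + B) (ket y)) (\<alpha> w y)) (id_on S)"
      unfolding comp_add_left comp_add_right blinfun.add_left plus_ell2.rep_eq distrib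
      using M[OF u(1,2)] N[OF u(1,2)] u(3) by simp
  qed
next
  case (scale A c)
  then obtain N where
    N: "\<And>u z. u \<in> FF \<Longrightarrow> z \<in> S \<Longrightarrow> y = \<alpha> u z \<and> N \<le> fst (deg u) \<and> N \<le> snd (deg u) \<Longrightarrow>
      coshift (w \<odot> u) o\<^sub>L (A o\<^sub>L shift u) = op_cscale (coord (blinfun_apply A (ket y)) (\<alpha> w y)) (id_on S)"
    by blast
  have assoc: "op_cscale (c * d) T = op_cscale c (op_cscale d T)" for d and T :: "'x oper"
    by (intro blinfun_eqI ell2_eqI) (simp add: coord_simps)
  show ?case
  proof (intro exI[of _ N] ballI impI)
    fix u z
    assume u: "u \<in> FF" "z \<in> S" "y = \<alpha> u z \<and> N \<le> fst (deg u) \<and> N \<le> snd (deg u)"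
    have "coshift (w \<odot> u) \<in> ops_on S"
      using coshift_ops w u(1) by simp
    then show "coshift (w \<odot> u) o\<^sub>L (op_cscale c A o\<^sub>L shift u) =
        op_cscale (coord (blinfun_apply (op_cscale c A) (ket y)) (\<alpha> w y)) (id_on S)"
      unfolding op_cscale_apply cscale.rep_eq assoc comp_cscale_left
      using N[OF u] by (simp only: comp_cscale_right)
  qed
qed

text \<open>
  The prefix of \<open>z\<close> is chosen in two steps: the first one turns \<open>P\<close> into a combination of shifts, the
  second one removes those that do not contribute to the diagonal entry at \<open>z\<close>.
\<close>

lemma compress:
  assumes P: "P \<in> star_alg" and z: "z \<in> S"
  shows "\<exists>w\<in>FF. coshift w o\<^sub>L P o\<^sub>L shift w = op_cscale (coord (blinfun_apply P (ket z)) z) (id_on S)"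
proof -
  have "absorbed P"
    using star_alg_absorbed P by blast
  then obtain N where N: "\<And>w. w \<in> FF \<Longrightarrow> N \<le> fst (deg w) \<Longrightarrow> N \<le> snd (deg w) \<Longrightarrow> P o\<^sub>L shift w \<in> shift_span"
    by (auto simp: absorbed_def)
  obtain w y where w: "w \<in> FF" "y \<in> S" "deg w = (N, N)" "z = \<alpha> w y"
    using act_factor[OF z] by blast
  have "P o\<^sub>L shift w \<in> shift_span" using N w by simp
  then obtain M where M: "\<And>u y'. u \<in> FF \<Longrightarrow> y' \<in> S \<Longrightarrow> y = \<alpha> u y' \<Longrightarrow> M \<le> fst (deg u) \<Longrightarrow> M \<le> snd (deg u) \<Longrightarrow>
      coshift (w \<odot> u) o\<^sub>L ((P o\<^sub>L shift w) o\<^sub>L shift u) =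
      op_cscale (coord (blinfun_apply (P o\<^sub>L shift w) (ket y)) (\<alpha> w y)) (id_on S)"
    using compress_span[OF _ w(1,2)] by blast
  obtain u y' where u: "u \<in> FF" "y' \<in> S" "deg u = (M, M)" "y = \<alpha> u y'"
    using act_factor[OF w(2)] by blast
  have "coshift (w \<odot> u) o\<^sub>L P o\<^sub>L shift (w \<odot> u) = op_cscale (coord (blinfun_apply P (ket z)) z) (id_on S)"
    using M[OF u(1,2,4)] u(1,3) w by (simp add: shift_mul comp_assoc shift_ket)
  then show ?thesis
    by (rule bexI) (use w(1) u(1) in simp)
qed

text \<open>
  An ideal absorbs the shifts and their adjoints, so with \<open>T\<close> it contains the compressions of \<open>T\<close>. Those
  provided by \<open>compress\<close> come arbitrarily close to the identity.
\<close>

theorem simple_algebra_if_approximable: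
  assumes shift_A: "\<And>w. w \<in> FF \<Longrightarrow> shift w \<in> A" and coshift_A: "\<And>w. w \<in> FF \<Longrightarrow> coshift w \<in> A"
    and approx: "\<And>T \<epsilon>. T \<in> A \<Longrightarrow> \<epsilon> > 0 \<Longrightarrow> \<exists>P\<in>star_alg. norm (T - P) \<le> \<epsilon>"
  shows "simple_algebra A"
proof -
  have A_ops: "T \<in> ops_on S" if "T \<in> A" for T
    using approx[OF that] star_alg_absorbed
    by (intro ops_on_limit) (meson absorbed_def)
  have id_A: "id_on S \<in> A"
    using shift_A[OF unit_FF] by (simp add: shift_unit)
  have id_ne: "id_on S \<noteq> 0"
  proof
    assume "id_on S = 0"
    obtain x where "x \<in> S" using nonempty by blast
    then have "coord (blinfun_apply (id_on S) (ket x)) x = 1"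
      by (simp add: coord_simps)
    with \<open>id_on S = 0\<close> show False by (simp add: coord_simps)
  qed
  have norm_id: "norm (id_on S) \<le> 1"
    by (rule norm_blinfun_bound) (simp_all add: norm_restr_le)
  have "J = A" if J: "closed_ideal J A" and "J \<noteq> {0}" for J
  proof -
    have JA: "J \<subseteq> A" and "0 \<in> J" and J_scale: "\<And>c x. x \<in> J \<Longrightarrow> op_cscale c x \<in> J"
      and J_right: "\<And>x y. x \<in> J \<Longrightarrow> y \<in> A \<Longrightarrow> x o\<^sub>L y \<in> J"
      and J_left: "\<And>x y. x \<in> J \<Longrightarrow> y \<in> A \<Longrightarrow> y o\<^sub>L x \<in> J"
      and J_closed: "closedin (top_of_set A) J"
      using J unfolding closed_ideal_def by blast+
    obtain T where T: "T \<in> J" "T \<noteq> 0"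
      using \<open>0 \<in> J\<close> \<open>J \<noteq> {0}\<close> by blast
    have T_ops: "T \<in> ops_on S" using T JA A_ops by blast
    \<comment> \<open>Complex linear operators are determined by their matrix entries.\<close>
    obtain y x where xy: "y \<in> S" "x \<in> S" "coord (blinfun_apply T (ket y)) x \<noteq> 0"
    proof (rule ccontr)
      assume no: "\<not> thesis"
      have "T = 0"
      proof (rule ops_on_eqI[OF T_ops zero_ops])
        fix g assume "g \<in> S"
        have "coord (blinfun_apply T (ket g)) k = 0" for k
        proof (cases "k \<in> S")
          case True
          then show ?thesis using no that \<open>g \<in> S\<close> by blast
        next
          case False
          have "coord (restr S (blinfun_apply T (ket g))) k = 0"
            using False by (simp add: coord_simps)
          then show ?thesis by (simp add: ops_on_restr(2)[OF T_ops])
        qed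
        then show "blinfun_apply T (ket g) = blinfun_apply 0 (ket g)"
          by (intro ell2_eqI) (simp add: coord_simps)
      qed
      with T show False by simp
    qed
    obtain z g h where z: "z \<in> S" "g \<in> FF" "h \<in> FF" "x = \<alpha> g z" "y = \<alpha> h z"
      using transitive xy by blast
    define c where "c = coord (blinfun_apply T (ket y)) x"
    \<comment> \<open>Both points are images of \<open>z\<close>, which moves the entry to the diagonal at \<open>z\<close> and normalises it.\<close>
    define R where "R = op_cscale (1 / c) (coshift g o\<^sub>L T o\<^sub>L shift h)"
    have "R \<in> J"
      unfolding R_def using z T by (intro J_scale J_right J_left shift_A coshift_A)
    have R1: "coord (blinfun_apply R (ket z)) z = 1"
      using xy z by (simp add: R_def coord_simps coord_coshift shift_ket c_def)
    have close: "\<exists>K\<in>J. norm (K - id_on S) \<le> 2 * \<epsilon>" if "\<epsilon> > 0" for \<epsilon>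
    proof -
      obtain P where P: "P \<in> star_alg" "norm (R - P) \<le> \<epsilon>"
        using approx[of R \<epsilon>] \<open>R \<in> J\<close> JA \<open>\<epsilon> > 0\<close> by blast
      define d where "d = coord (blinfun_apply P (ket z)) z"
      obtain w where w: "w \<in> FF" "coshift w o\<^sub>L P o\<^sub>L shift w = op_cscale d (id_on S)"
        using compress[OF P(1) z(1)] d_def by blast
      let ?K = "coshift w o\<^sub>L R o\<^sub>L shift w"
      have "cmod (d - 1) = cmod (coord (blinfun_apply (R - P) (ket z)) z)"
        by (simp add: blinfun.diff_left coord_minus R1 d_def norm_minus_commute)
      also have "\<dots> \<le> norm (blinfun_apply (R - P) (ket z))"
        by (rule coord_le_norm)
      also have "\<dots> \<le> norm (R - P) * norm (ket z)"
        by (rule norm_blinfun)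
      finally have d1: "cmod (d - 1) \<le> \<epsilon>" using P(2) by (simp add: norm_ket)
      have "?K - id_on S = (coshift w o\<^sub>L (R - P) o\<^sub>L shift w) + op_cscale (d - 1) (id_on S)"
      proof (intro blinfun_eqI)
        fix f
        have "blinfun_apply (coshift w o\<^sub>L P o\<^sub>L shift w) f = cscale d (restr S f)"
          by (simp add: w)
        then have e1: "blinfun_apply (coshift w) (blinfun_apply P (blinfun_apply (shift w) f)) = cscale d (restr S f)"
          by simp
        show "blinfun_apply (?K - id_on S) f =
          blinfun_apply ((coshift w o\<^sub>L (R - P) o\<^sub>L shift w) + op_cscale (d - 1) (id_on S)) f"
          by (intro ell2_eqI)
             (simp add: blinfun.diff_left blinfun.diff_right blinfun.add_left e1 coord_simps algebra_simps)
      qed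
      also have "norm \<dots> \<le> norm (coshift w o\<^sub>L (R - P) o\<^sub>L shift w) + norm (op_cscale (d - 1) (id_on S))"
        by (rule norm_triangle_ineq)
      also have "\<dots> \<le> \<epsilon> + \<epsilon>"
      proof (rule add_mono)
        have "norm (coshift w o\<^sub>L (R - P) o\<^sub>L shift w)
            \<le> norm (coshift w o\<^sub>L (R - P)) * norm (shift w)"
          by (rule norm_blinfun_compose)
        also have "\<dots> \<le> (norm (coshift w) * norm (R - P)) * 1"
          by (intro mult_mono norm_blinfun_compose norm_shift_le) (simp_all add: w)
        also have "\<dots> \<le> 1 * \<epsilon> * 1"
          by (intro mult_mono norm_coshift_le P(2)) (simp_all add: \<open>\<epsilon> > 0\<close> less_imp_le)
        finally show "norm (coshift w o\<^sub>L (R - P) o\<^sub>L shift w) \<le> \<epsilon>" by simp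
        show "norm (op_cscale (d - 1) (id_on S)) \<le> \<epsilon>"
        proof (rule norm_blinfun_bound)
          fix f :: "'x ell2"
          have "norm (blinfun_apply (op_cscale (d - 1) (id_on S)) f) = cmod (d - 1) * norm (restr S f)"
            by (simp add: norm_cscale)
          also have "\<dots> \<le> \<epsilon> * norm f"
            by (intro mult_mono d1 norm_restr_le) (simp_all add: \<open>\<epsilon> > 0\<close> less_imp_le)
          finally show "norm (blinfun_apply (op_cscale (d - 1) (id_on S)) f) \<le> \<epsilon> * norm f" .
        qed (simp add: \<open>\<epsilon> > 0\<close> less_imp_le)
      qed
      finally have "norm (?K - id_on S) \<le> 2 * \<epsilon>" by simp
      moreover have "?K \<in> J"
        using \<open>R \<in> J\<close> w by (intro J_right J_left shift_A coshift_A)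
      ultimately show ?thesis by blast
    qed
    obtain C where C: "closed C" "J = A \<inter> C"
      using J_closed by (metis closedin_closed)
    have "id_on S \<in> closure J"
      unfolding closure_approachable
    proof (intro allI impI)
      fix e :: real assume "e > 0"
      then obtain K where "K \<in> J" "norm (K - id_on S) \<le> 2 * (e / 3)"
        using close[of "e / 3"] by auto
      moreover have "2 * (e / 3) < e" using \<open>e > 0\<close> by simp
      ultimately show "\<exists>K\<in>J. dist K (id_on S) < e"
        unfolding dist_norm by (meson le_less_trans)
    qed
    also have "closure J \<subseteq> C"
      using C by (simp add: closure_minimal)
    finally have "id_on S \<in> J" using id_A C by blast
    have "K \<in> J" if "K \<in> A" for K
    proof -
      have "id_on S o\<^sub>L K = K"
        by (rule blinfun_eqI) (simp add: ops_on_restr(2)[OF A_ops[OF that]])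
      then show ?thesis using J_right[OF \<open>id_on S \<in> J\<close> that] by simp
    qed
    with JA show ?thesis by blast
  qed
  then show ?thesis
    unfolding simple_algebra_def using id_A id_ne by blast
qed

end

section \<open>The space of a tail\<close>

locale tail_space = perm_semigroup \<theta>
  for \<theta> :: "('m::finite, 'n::finite) perm" +
  fixes \<tau> :: "('m, 'n) tail"
begin

definition seg :: "nat \<Rightarrow> nat \<Rightarrow> ('m, 'n) sem" where
  "seg s k = cls \<theta> (concat (map (\<lambda>r. [GenE (fst (\<tau> r)), GenF (snd (\<tau> r))]) [s..<s + k]))"

lemma seg_FF [simp]: "seg s k \<in> FF"
  by (simp add: seg_def)

lemma seg_0 [simp]: "seg s 0 = unit"
  by (simp add: seg_def unit_cls)

lemma seg_add: "seg s (k + l) = seg s k \<odot> seg (s + k) l"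
proof -
  have "[s..<s + (k + l)] = [s..<s + k] @ [s + k..<s + k + l]"
    using upt_add_eq_append[of s "s + k" l] by (simp add: add.assoc)
  then show ?thesis
    unfolding seg_def mult_cls by simp
qed

lemma seg_1: "seg s 1 = E [fst (\<tau> s)] \<odot> V [snd (\<tau> s)]"
  by (simp add: seg_def eword_def fword_def mult_cls)

lemma deg_seg [simp]: "deg (seg s k) = (k, k)"
proof (induction k)
  case (Suc k)
  have "seg s (Suc k) = seg s k \<odot> seg (s + k) 1"
    using seg_add[of s k 1] by simp
  with Suc show ?case by (simp add: deg_mul seg_1[simplified])
qed simp

lemma tail_word_seg: "tail_word \<theta> \<tau> T = seg 0 T"
  by (simp add: tail_word_def seg_def)

lemma push_seg: "g \<in> FF \<Longrightarrow> push \<theta> \<tau> s k g = g \<odot> seg s k"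
proof (induction k)
  case (Suc k)
  have "seg s (Suc k) = seg s k \<odot> seg (s + k) 1"
    using seg_add[of s k 1] by simp
  with Suc show ?case
    by (simp add: rho_def seg_1[simplified] mul_assoc)
qed simp

lemma limrel_iff: "((s, g), (t, h)) \<in> limrel \<theta> \<tau> \<longleftrightarrow>
    g \<in> FF \<and> h \<in> FF \<and> (\<exists>k l. s + k = t + l \<and> g \<odot> seg s k = h \<odot> seg t l)"
  unfolding limrel_def by (simp add: push_seg cong: conj_cong)

lemma equiv_limrel: "equiv (UNIV \<times> FF) (limrel \<theta> \<tau>)"
proof (rule equivI)
  show "limrel \<theta> \<tau> \<subseteq> (UNIV \<times> FF) \<times> (UNIV \<times> FF)"
    by (auto simp: limrel_def)
  show "refl_on (UNIV \<times> FF) (limrel \<theta> \<tau>)"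
    by (auto simp: refl_on_def limrel_iff)
  show "sym (limrel \<theta> \<tau>)"
    by (rule symI) (force simp: limrel_iff)
  show "trans (limrel \<theta> \<tau>)"
  proof (rule transI)
    fix p q r assume pq: "(p, q) \<in> limrel \<theta> \<tau>" and qr: "(q, r) \<in> limrel \<theta> \<tau>"
    obtain s g t h u f where eq: "p = (s, g)" "q = (t, h)" "r = (u, f)" by force
    obtain k l where kl: "g \<in> FF" "h \<in> FF" "s + k = t + l" "g \<odot> seg s k = h \<odot> seg t l"
      using pq by (auto simp: eq limrel_iff)
    obtain k' l' where kl': "f \<in> FF" "t + k' = u + l'" "h \<odot> seg t k' = f \<odot> seg u l'"
      using qr by (auto simp: eq limrel_iff)
    have "g \<odot> seg s (k + k') = (g \<odot> seg s k) \<odot> seg (s + k) k'"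
      by (simp add: seg_add mul_assoc kl(1))
    also have "\<dots> = (h \<odot> seg t l) \<odot> seg (t + l) k'"
      by (simp only: kl(3,4))
    also have "\<dots> = h \<odot> seg t (l + k')"
      by (simp add: seg_add mul_assoc kl(2))
    also have "\<dots> = (h \<odot> seg t k') \<odot> seg (t + k') l"
      using seg_add[of t k' l] by (simp add: mul_assoc kl(2) add.commute)
    also have "\<dots> = (f \<odot> seg u l') \<odot> seg (u + l') l"
      by (simp only: kl'(2,3))
    also have "\<dots> = f \<odot> seg u (l' + l)"
      by (simp add: seg_add mul_assoc kl'(1))
    finally have "g \<odot> seg s (k + k') = f \<odot> seg u (l' + l)" .
    moreover have "s + (k + k') = u + (l' + l)"
      using kl kl' by simp
    ultimately show "(p, r) \<in> limrel \<theta> \<tau>"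
      unfolding eq limrel_iff using kl(1) kl'(1) by blast
  qed
qed

abbreviation io :: "nat \<Rightarrow> ('m, 'n) sem \<Rightarrow> ('m, 'n) gpoint" where "io \<equiv> iota \<theta> \<tau>"

abbreviation G :: "('m, 'n) gpoint set" where "G \<equiv> Gtau \<theta> \<tau>"

lemma io_eq_iff: "g \<in> FF \<Longrightarrow> h \<in> FF \<Longrightarrow>
    io s g = io t h \<longleftrightarrow> (\<exists>k l. s + k = t + l \<and> g \<odot> seg s k = h \<odot> seg t l)"
  unfolding iota_def using eq_equiv_class_iff[OF equiv_limrel, of "(s, g)" "(t, h)"]
  by (simp add: limrel_iff)

lemma io_G [simp]: "g \<in> FF \<Longrightarrow> io s g \<in> G"
  unfolding iota_def Gtau_def by (rule quotientI) simp

lemma io_push: "g \<in> FF \<Longrightarrow> io s g = io (s + k) (g \<odot> seg s k)"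
  by (subst io_eq_iff) (auto intro!: exI[of _ k] exI[of _ 0])

lemma G_io: "x \<in> G \<Longrightarrow> \<exists>s\<ge>N. \<exists>g\<in>FF. x = io s g"
proof -
  assume "x \<in> G"
  then obtain s g where "g \<in> FF" "x = io s g"
    by (auto simp: Gtau_def quotient_def iota_def)
  then have "x = io (s + N) (g \<odot> seg s N)" "g \<odot> seg s N \<in> FF"
    using io_push by simp_all
  then show ?thesis by (intro exI[of _ "s + N"]) auto
qed

lemma G_io2:
  assumes "x \<in> G" "y \<in> G"
  shows "\<exists>s. \<exists>g\<in>FF. \<exists>h\<in>FF. x = io s g \<and> y = io s h"
proof -
  obtain s g where s: "g \<in> FF" "x = io s g" using G_io assms by blast
  obtain t h where t: "s \<le> t" "h \<in> FF" "y = io t h" using G_io assms by blast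
  have "x = io t (g \<odot> seg s (t - s))"
    using io_push[OF s(1), of s "t - s"] s t by simp
  with s t show ?thesis by (metis mul_FF seg_FF)
qed

lemma io_inject:
  assumes "g \<in> FF" "h \<in> FF" "io s g = io s h"
  shows "g = h"
proof -
  obtain k where "g \<odot> seg s k = h \<odot> seg s k"
    using assms io_eq_iff by auto
  moreover from this have "deg g = deg h"
    using assms by (metis deg_mul seg_FF add_right_cancel)
  ultimately show ?thesis using factor_unique assms seg_FF by blast
qed

lemma act_io:
  assumes "w \<in> FF" "g \<in> FF"
  shows "act \<theta> \<tau> w (io s g) = io s (w \<odot> g)"
proof -
  have mem: "(s, g) \<in> io s g"
    using assms by (auto simp: iota_def limrel_iff)
  have "io t (w \<odot> h) = io s (w \<odot> g)" if th: "(t, h) \<in> io s g" for t h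
  proof -
    obtain k l where kl: "h \<in> FF" "s + k = t + l" "g \<odot> seg s k = h \<odot> seg t l"
      using th by (auto simp: iota_def limrel_iff)
    then have "w \<odot> g \<odot> seg s k = w \<odot> h \<odot> seg t l"
      using assms by (simp add: mul_assoc)
    then have "io s (w \<odot> g) = io t (w \<odot> h)"
      using kl assms by (subst io_eq_iff) auto
    then show ?thesis by simp
  qed
  then have "act \<theta> \<tau> w (io s g) = (\<Union>p\<in>io s g. io s (w \<odot> g))"
    unfolding act_def by (intro SUP_cong) auto
  then show ?thesis using mem by auto
qed

text \<open>
  Degree of a representative minus its level; it is constant on the classes because the connecting maps
  \<open>rho\<close> raise the level and both coordinates of the degree by one.
\<close>

definition height :: "('m, 'n) gpoint \<Rightarrow> int \<times> int" where
  "height x = (THE d. \<exists>s g. g \<in> FF \<and> x = io s g \<and>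
     d = (int (fst (deg g)) - int s, int (snd (deg g)) - int s))"

lemma height_io:
  assumes "g \<in> FF"
  shows "height (io s g) = (int (fst (deg g)) - int s, int (snd (deg g)) - int s)"
  unfolding height_def
proof (rule the_equality)
  fix d assume "\<exists>t h. h \<in> FF \<and> io s g = io t h \<and>
     d = (int (fst (deg h)) - int t, int (snd (deg h)) - int t)"
  then obtain t h where th: "h \<in> FF" "io s g = io t h"
    "d = (int (fst (deg h)) - int t, int (snd (deg h)) - int t)" by blast
  then obtain k l where kl: "s + k = t + l" "g \<odot> seg s k = h \<odot> seg t l"
    using io_eq_iff assms by blast
  then have "deg g + (k, k) = deg h + (l, l)"
    using assms th by (metis deg_mul deg_seg seg_FF)
  then have "fst (deg g) + k = fst (deg h) + l" "snd (deg g) + k = snd (deg h) + l"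
    by (simp_all add: prod_eq_iff)
  with kl th(3) show "d = (int (fst (deg g)) - int s, int (snd (deg g)) - int s)"
    by simp
qed (use assms in blast)

lemma height_act:
  assumes "w \<in> FF" "x \<in> G"
  shows "height (act \<theta> \<tau> w x) = height x + (int (fst (deg w)), int (snd (deg w)))"
proof -
  obtain s g where "g \<in> FF" "x = io s g" using G_io assms by blast
  then show ?thesis using assms by (simp add: act_io height_io deg_mul)
qed

sublocale semigroup_action \<theta> G "act \<theta> \<tau>"
proof
  fix v w x
  assume v: "v \<in> FF" and w: "w \<in> FF" and "x \<in> G"
  then obtain s g where g: "g \<in> FF" "x = io s g" using G_io by blast
  show "act \<theta> \<tau> (v \<odot> w) x = act \<theta> \<tau> v (act \<theta> \<tau> w x)"
    using v w g by (simp add: act_io mul_assoc)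
next
  fix w x
  assume w: "w \<in> FF" and "x \<in> G"
  then obtain s g where g: "g \<in> FF" "x = io s g" using G_io by blast
  show "act \<theta> \<tau> w x \<in> G" using w g by (simp add: act_io)
next
  fix x assume "x \<in> G"
  then obtain s g where g: "g \<in> FF" "x = io s g" using G_io by blast
  then show "act \<theta> \<tau> unit x = x" by (simp add: act_io)
  fix k l
  have "io s g = io (s + (k + l)) (g \<odot> seg s (k + l))" using g io_push by blast
  moreover obtain w y where "w \<in> FF" "y \<in> FF" "deg w = (k, l)" "g \<odot> seg s (k + l) = w \<odot> y"
    using factor_exists[of "g \<odot> seg s (k + l)" k l] g by (auto simp: deg_mul)
  ultimately show "\<exists>w\<in>FF. \<exists>y\<in>G. deg w = (k, l) \<and> x = act \<theta> \<tau> w y"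
    using g by (intro bexI[of _ w] bexI[of _ "io (s + (k + l)) y"]) (simp_all add: act_io)
next
  fix v w x y
  assume v: "v \<in> FF" "w \<in> FF" and x: "x \<in> G" "y \<in> G" and d: "deg v = deg w"
    and eq: "act \<theta> \<tau> v x = act \<theta> \<tau> w y"
  obtain s g h where g: "g \<in> FF" "h \<in> FF" "x = io s g" "y = io s h"
    using G_io2[OF x] by blast
  have "v \<odot> g = w \<odot> h"
    using eq g v by (intro io_inject[of _ _ s]) (simp_all add: act_io)
  then show "v = w \<and> x = y"
    using factor_unique v g d by blast
qed

abbreviation base :: "nat \<Rightarrow> ('m, 'n) gpoint" where "base s \<equiv> io s unit"

lemma io_base: "g \<in> FF \<Longrightarrow> io s g = act \<theta> \<tau> g (base s)"
  by (simp add: act_io)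

lemma base_0: "base 0 = act \<theta> \<tau> (seg 0 s) (base s)"
  using io_push[of unit 0 s] by (simp add: act_io)

text \<open>
  The point \<open>base 0\<close> spells the tail itself. Removing its prefix of degree \<open>(\<bar>s\<bar>, \<bar>t\<bar>)\<close> leaves a unique
  point \<open>y\<close>, and every finite remainder \<open>w2\<close> admitted by \<open>tail_cut\<close> represents this point at
  its own level \<open>T\<close>. So the letters \<open>tail_i\<close> and \<open>tail_j\<close> are the first letters of \<open>y\<close>.
\<close>

lemma tail_cut_point:
  assumes cut: "tail_cut \<theta> \<tau> s t w2"
    and w: "w \<in> FF" "deg w = (nat \<bar>s\<bar>, nat \<bar>t\<bar>)" and y: "y \<in> G" and base: "base 0 = act \<theta> \<tau> w y"
  shows "\<exists>T. w2 \<in> FF \<and> y = io T w2"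
proof -
  obtain T w1 where w1: "w2 \<in> FF" "w1 \<in> FF" "deg w1 = (nat \<bar>s\<bar>, nat \<bar>t\<bar>)" "seg 0 T = w1 \<odot> w2"
    using cut by (auto simp: tail_cut_def tail_word_seg)
  have "base 0 = act \<theta> \<tau> w1 (io T w2)"
    using io_push[of unit 0 T] w1 by (simp add: act_io)
  then have eq: "act \<theta> \<tau> w1 (io T w2) = act \<theta> \<tau> w y"
    using base by (rule subst)
  have "io T w2 = y"
    using act_unique[OF w1(2) w(1) io_G[OF w1(1)] y _ eq] w1(3) w(2) by simp
  with w1(1) show ?thesis by blast
qed

lemma tail_cut_exists:
  assumes w: "w \<in> FF" "deg w = (nat \<bar>s\<bar>, nat \<bar>t\<bar>)" and y: "y \<in> G" and base: "base 0 = act \<theta> \<tau> w y"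
  shows "\<exists>w2. tail_cut \<theta> \<tau> s t w2 \<and> 0 < fst (deg w2) \<and> 0 < snd (deg w2)"
proof -
  define T where "T = Suc (nat \<bar>s\<bar> + nat \<bar>t\<bar>)"
  obtain w1 w2 where w1: "w1 \<in> FF" "w2 \<in> FF" "deg w1 = (nat \<bar>s\<bar>, nat \<bar>t\<bar>)" "seg 0 T = w1 \<odot> w2"
    using factor_exists[of "seg 0 T" "nat \<bar>s\<bar>" "nat \<bar>t\<bar>"] by (auto simp: T_def)
  have "deg w1 + deg w2 = (T, T)"
    using w1 by (metis deg_mul deg_seg)
  then have "0 < fst (deg w2)" "0 < snd (deg w2)"
    using w1 by (auto simp: prod_eq_iff T_def)
  moreover have "tail_cut \<theta> \<tau> s t w2"
    unfolding tail_cut_def tail_word_seg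
    using w1 by (intro conjI exI[of _ T] bexI[of _ w1]) (auto simp: T_def)
  ultimately show ?thesis by blast
qed

lemma tail_i_eq:
  assumes w: "w \<in> FF" "deg w = (nat \<bar>s\<bar>, nat \<bar>t\<bar>)" and y: "y \<in> G"
    and base: "base 0 = act \<theta> \<tau> w (act \<theta> \<tau> (E [i]) y)"
  shows "tail_i \<theta> \<tau> s t = i"
proof -
  have y': "act \<theta> \<tau> (E [i]) y \<in> G" using y by (simp add: act_closed)
  have uniq: "k = i" if cut: "tail_cut \<theta> \<tau> s t w2" and w': "w' \<in> FF" "w2 = E [k] \<odot> w'" for k w2 w'
  proof -
    obtain T where "act \<theta> \<tau> (E [i]) y = io T w2"
      using tail_cut_point[OF cut w y' base] by blast
    then have "act \<theta> \<tau> (E [i]) y = act \<theta> \<tau> (E [k]) (io T w')"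
      using w' by (simp add: act_io)
    then have "E [i] = E [k]"
      using act_unique[of "E [i]" "E [k]" y "io T w'"] y w' by simp
    then show ?thesis using E_inject by blast
  qed
  obtain w2 where w2: "tail_cut \<theta> \<tau> s t w2" "0 < fst (deg w2)"
    using tail_cut_exists[OF w y' base] by blast
  moreover have "w2 \<in> FF" using w2 by (simp add: tail_cut_def)
  ultimately obtain k w' where k: "w' \<in> FF" "w2 = E [k] \<odot> w'"
    using split_E by blast
  then have "k = i" using uniq w2 by blast
  show ?thesis
    unfolding tail_i_def
  proof (rule the_equality)
    show "\<exists>w2. tail_cut \<theta> \<tau> s t w2 \<and> (\<exists>w'\<in>FF. w2 = E [i] \<odot> w')"
      using w2 k \<open>k = i\<close> by blast
  qed (use uniq in blast)
qed

lemma tail_j_eq: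
  assumes w: "w \<in> FF" "deg w = (nat \<bar>s\<bar>, nat \<bar>t\<bar>)" and y: "y \<in> G"
    and base: "base 0 = act \<theta> \<tau> w (act \<theta> \<tau> (V [j]) y)"
  shows "tail_j \<theta> \<tau> s t = j"
proof -
  have y': "act \<theta> \<tau> (V [j]) y \<in> G" using y by (simp add: act_closed)
  have uniq: "k = j" if cut: "tail_cut \<theta> \<tau> s t w2" and w': "w' \<in> FF" "w2 = V [k] \<odot> w'" for k w2 w'
  proof -
    obtain T where "act \<theta> \<tau> (V [j]) y = io T w2"
      using tail_cut_point[OF cut w y' base] by blast
    then have "act \<theta> \<tau> (V [j]) y = act \<theta> \<tau> (V [k]) (io T w')"
      using w' by (simp add: act_io)
    then have "V [j] = V [k]"
      using act_unique[of "V [j]" "V [k]" y "io T w'"] y w' by simp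
    then show ?thesis using V_inject by blast
  qed
  obtain w2 where w2: "tail_cut \<theta> \<tau> s t w2" "0 < snd (deg w2)"
    using tail_cut_exists[OF w y' base] by blast
  moreover have "w2 \<in> FF" using w2 by (simp add: tail_cut_def)
  ultimately obtain k w' where k: "w' \<in> FF" "w2 = V [k] \<odot> w'"
    using split_V by blast
  then have "k = j" using uniq w2 by blast
  show ?thesis
    unfolding tail_j_def
  proof (rule the_equality)
    show "\<exists>w2. tail_cut \<theta> \<tau> s t w2 \<and> (\<exists>w'\<in>FF. w2 = V [j] \<odot> w')"
      using w2 k \<open>k = j\<close> by blast
  qed (use uniq in blast)
qed

text \<open>
  Two points are alike if they spell the same infinite word.
\<close>

definition alike :: "('m, 'n) gpoint \<Rightarrow> ('m, 'n) gpoint \<Rightarrow> bool" where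
  "alike x y \<longleftrightarrow> (\<forall>k l. \<exists>w\<in>FF. \<exists>x'\<in>G. \<exists>y'\<in>G. deg w = (k, l) \<and> x = act \<theta> \<tau> w x' \<and> y = act \<theta> \<tau> w y')"

lemma alike_same_height:
  assumes x: "x \<in> G" "y \<in> G" and "alike x y" "height x = height y"
  shows "x = y"
proof -
  obtain s g h where g: "g \<in> FF" "h \<in> FF" "x = io s g" "y = io s h"
    using G_io2[OF x] by blast
  have d: "deg g = deg h"
    using assms(4) g by (auto simp: height_io prod_eq_iff)
  obtain w x' y' where w: "w \<in> FF" "x' \<in> G" "y' \<in> G" "deg w = deg g"
      "x = act \<theta> \<tau> w x'" "y = act \<theta> \<tau> w y'"
    using \<open>alike x y\<close> unfolding alike_def by (metis prod.collapse)
  have "g = w"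
    using act_unique[of g w "base s" x'] g w io_base[of g s] by simp
  moreover have "h = w"
    using act_unique[of h w "base s" y'] g w d io_base[of h s] by simp
  ultimately show ?thesis using g by simp
qed

text \<open>
  The point \<open>io s g\<close> spells \<open>g\<close> followed by the tail from position \<open>s\<close> on. Cutting off a prefix \<open>w\<close> that
  covers \<open>g\<close> therefore leaves the same point as cutting off a prefix of the whole tail, of a degree that
  is shifted by that of \<open>g\<close>.
\<close>

lemma base_prefix:
  assumes g: "g \<in> FF" and w: "w \<in> FF" "fst (deg g) \<le> fst (deg w)" "snd (deg g) \<le> snd (deg w)"
    and y: "y \<in> G" and eq: "io s g = act \<theta> \<tau> w y"
  shows "\<exists>r\<in>FF. deg r = (s + fst (deg w) - fst (deg g), s + snd (deg w) - snd (deg g)) \<and>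
    base 0 = act \<theta> \<tau> r y"
proof -
  obtain g' r where r: "g' \<in> FF" "r \<in> FF" "deg g' = deg g" "w = g' \<odot> r"
    using factor_exists[OF w] by auto
  have "act \<theta> \<tau> g (base s) = act \<theta> \<tau> g' (act \<theta> \<tau> r y)"
    using eq g r y by (simp add: io_base[of g s, symmetric] act_mul[symmetric])
  then have "base s = act \<theta> \<tau> r y"
    using act_unique[of g g' "base s" "act \<theta> \<tau> r y"] g r y act_closed by simp
  then have "base 0 = act \<theta> \<tau> (seg 0 s \<odot> r) y"
    using base_0[of s] r y by (simp add: act_mul)
  moreover have "deg w = deg g + deg r" using r by (simp add: deg_mul)
  then have "deg (seg 0 s \<odot> r) = (s + fst (deg w) - fst (deg g), s + snd (deg w) - snd (deg g))"
    using r by (simp add: deg_mul prod_eq_iff)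
  ultimately show ?thesis using r by (intro bexI[of _ "seg 0 s \<odot> r"]) simp_all
qed

text \<open>
  Far out, the word spelled by \<open>io s g\<close> is the tail shifted by \<open>deg g\<close>, and the one spelled by \<open>io s h\<close> is the
  tail shifted by \<open>deg h\<close>. If they agree, then \<open>deg h - deg g\<close> is a period of the tail from some place on.
\<close>

lemma alike_period:
  assumes g: "g \<in> FF" "h \<in> FF" and al: "alike (io s g) (io s h)"
  shows "(int (fst (deg h)) - int (fst (deg g)), int (snd (deg h)) - int (snd (deg g))) \<in> H_tail \<theta> \<tau>"
proof -
  define p where "p = int (fst (deg h)) - int (fst (deg g))"
  define q where "q = int (snd (deg h)) - int (snd (deg g))"
  \<comment> \<open>Below this bound, the prefixes cut off from both points cover \<open>g\<close> and \<open>h\<close>.\<close>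
  define T where "T = - int s - int (fst (deg h)) - int (snd (deg h))"
  have "(tail_i \<theta> \<tau> (s1 + p) (t1 + q), tail_j \<theta> \<tau> (s1 + p) (t1 + q)) =
        (tail_i \<theta> \<tau> s1 t1, tail_j \<theta> \<tau> s1 t1)"
    if st: "s1 \<le> T" "t1 \<le> T" "s1 \<le> 0" "t1 \<le> 0" "s1 + p \<le> 0" "t1 + q \<le> 0" for s1 t1
  proof -
    \<comment> \<open>The prefix of \<open>io s g\<close> of degree \<open>(k, l)\<close> ends where the prefix of the tail of degree \<open>(-s1, -t1)\<close> ends.\<close>
    define k where "k = nat (- s1 - int s) + fst (deg g)"
    define l where "l = nat (- t1 - int s) + snd (deg g)"
    have le: "fst (deg g) \<le> k" "snd (deg g) \<le> l" "fst (deg h) \<le> k" "snd (deg h) \<le> l"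
      using st by (auto simp: k_def l_def T_def p_def q_def)
    have num: "s + k - fst (deg g) = nat \<bar>s1\<bar>" "s + l - snd (deg g) = nat \<bar>t1\<bar>"
        "s + k - fst (deg h) = nat \<bar>s1 + p\<bar>" "s + l - snd (deg h) = nat \<bar>t1 + q\<bar>"
      using st by (auto simp: k_def l_def T_def p_def q_def)
    have letters: "\<exists>z\<in>FF. \<exists>x'\<in>G. \<exists>y'\<in>G. \<exists>r\<in>FF. \<exists>r'\<in>FF. deg z = d \<and>
        deg r = (nat \<bar>s1\<bar>, nat \<bar>t1\<bar>) \<and> base 0 = act \<theta> \<tau> r (act \<theta> \<tau> z x') \<and>
        deg r' = (nat \<bar>s1 + p\<bar>, nat \<bar>t1 + q\<bar>) \<and> base 0 = act \<theta> \<tau> r' (act \<theta> \<tau> z y')" for d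
    proof -
      obtain w x' y' where w: "w \<in> FF" "x' \<in> G" "y' \<in> G" "deg w = (k + fst d, l + snd d)"
          "io s g = act \<theta> \<tau> w x'" "io s h = act \<theta> \<tau> w y'"
        using al unfolding alike_def by blast
      obtain w0 z where w0: "w0 \<in> FF" "z \<in> FF" "deg w0 = (k, l)" "w = w0 \<odot> z"
        using factor_exists[OF w(1), of k l] w(4) by auto
      have z: "deg z = d"
        using w(4) w0 by (simp add: deg_mul prod_eq_iff)
      have G: "act \<theta> \<tau> z x' \<in> G" "act \<theta> \<tau> z y' \<in> G"
        using w0(2) w(2,3) by (simp_all add: act_closed)
      have eq: "io s g = act \<theta> \<tau> w0 (act \<theta> \<tau> z x')" "io s h = act \<theta> \<tau> w0 (act \<theta> \<tau> z y')"
        unfolding w(5,6) w0(4) using w0(1,2) w(2,3) by (simp_all add: act_mul)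
      have "\<exists>r\<in>FF. deg r = (nat \<bar>s1\<bar>, nat \<bar>t1\<bar>) \<and> base 0 = act \<theta> \<tau> r (act \<theta> \<tau> z x')"
        using base_prefix[OF g(1) w0(1) _ _ G(1) eq(1)] le unfolding w0(3) fst_conv snd_conv num by blast
      moreover have "\<exists>r\<in>FF. deg r = (nat \<bar>s1 + p\<bar>, nat \<bar>t1 + q\<bar>) \<and> base 0 = act \<theta> \<tau> r (act \<theta> \<tau> z y')"
        using base_prefix[OF g(2) w0(1) _ _ G(2) eq(2)] le unfolding w0(3) fst_conv snd_conv num by blast
      ultimately show ?thesis using w0(2) w(2,3) z by blast
    qed
    obtain z x' y' r r' where z: "z \<in> FF" "x' \<in> G" "y' \<in> G" "deg z = (1, 0)"
      and r: "r \<in> FF" "deg r = (nat \<bar>s1\<bar>, nat \<bar>t1\<bar>)" "base 0 = act \<theta> \<tau> r (act \<theta> \<tau> z x')"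
      and r': "r' \<in> FF" "deg r' = (nat \<bar>s1 + p\<bar>, nat \<bar>t1 + q\<bar>)" "base 0 = act \<theta> \<tau> r' (act \<theta> \<tau> z y')"
      using letters[of "(1, 0)"] by blast
    obtain i where i: "z = E [i]"
      using degree_E[OF z(1,4)] by (auto simp: length_Suc_conv)
    have I: "tail_i \<theta> \<tau> s1 t1 = i" "tail_i \<theta> \<tau> (s1 + p) (t1 + q) = i"
      using tail_i_eq[OF r(1,2) z(2) r(3)[unfolded i]] tail_i_eq[OF r'(1,2) z(3) r'(3)[unfolded i]]
      by blast+
    obtain z x' y' r r' where z: "z \<in> FF" "x' \<in> G" "y' \<in> G" "deg z = (0, 1)"
      and r: "r \<in> FF" "deg r = (nat \<bar>s1\<bar>, nat \<bar>t1\<bar>)" "base 0 = act \<theta> \<tau> r (act \<theta> \<tau> z x')"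
      and r': "r' \<in> FF" "deg r' = (nat \<bar>s1 + p\<bar>, nat \<bar>t1 + q\<bar>)" "base 0 = act \<theta> \<tau> r' (act \<theta> \<tau> z y')"
      using letters[of "(0, 1)"] by blast
    obtain j where j: "z = V [j]"
      using degree_V[OF z(1,4)] by (auto simp: length_Suc_conv)
    have J: "tail_j \<theta> \<tau> s1 t1 = j" "tail_j \<theta> \<tau> (s1 + p) (t1 + q) = j"
      using tail_j_eq[OF r(1,2) z(2) r(3)[unfolded j]] tail_j_eq[OF r'(1,2) z(3) r'(3)[unfolded j]]
      by blast+
    show ?thesis using I J by simp
  qed
  then have "tail_periodic_below \<theta> \<tau> T p q"
    unfolding tail_periodic_below_def by blast
  then show ?thesis
    unfolding H_tail_def p_def q_def by blast
qed

end

section \<open>The period acts by a bijection of the tail space\<close>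

context perm_semigroup
begin

text \<open>
  The relation \<open>e\<^sub>u f\<^sub>v = f\<^bsub>\<gamma> u\<^esub> e\<^bsub>\<gamma>\<^sup>-\<^sup>1 v\<^esub>\<close> determines how \<open>f\<^bsub>\<gamma> u\<^esub>\<close> moves past a single letter: the words
  \<open>\<gamma> u\<close> behave like the words \<open>u\<close> that they replace. The proof multiplies by a word \<open>P t\<close>, which turns
  \<open>Q (g u)\<close> into \<open>P u\<close>, and compares factorizations. It is stated for two families \<open>P\<close>, \<open>Q\<close> with mutually
  inverse \<open>g\<close>, \<open>h\<close> because it is applied with the two kinds of generators in both roles.
\<close>

lemma period_slide:
  fixes P :: "'p list \<Rightarrow> ('m, 'n) sem" and Q :: "'q list \<Rightarrow> ('m, 'n) sem"
  assumes P: "\<And>u. P u \<in> FF" and Q: "\<And>v. Q v \<in> FF"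
    and P_append: "\<And>u u'. P (u @ u') = P u \<odot> P u'"
    and P_inject: "\<And>u u'. P u = P u' \<Longrightarrow> u = u'"
    and Q_cancel: "\<And>x y v v'. x \<in> FF \<Longrightarrow> y \<in> FF \<Longrightarrow> length v = length v' \<Longrightarrow>
        Q v \<odot> x = Q v' \<odot> y \<Longrightarrow> v = v' \<and> x = y"
    and move: "\<And>i v. \<exists>v' k. length v' = length v \<and> P [i] \<odot> Q v = Q v' \<odot> P [k]"
    and g: "\<And>u. length u = a \<Longrightarrow> length (g u) = b" "\<And>u. length u = a \<Longrightarrow> h (g u) = u"
    and h: "\<And>v. length v = b \<Longrightarrow> length (h v) = a" "\<And>v. length v = b \<Longrightarrow> g (h v) = v"
    and swap: "\<And>u v. length u = a \<Longrightarrow> length v = b \<Longrightarrow> P u \<odot> Q v = Q (g u) \<odot> P (h v)"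
    and a: "a > 0" and u: "length u = a" "length u' = a" "i # u = u' @ [k]"
  shows "P [i] \<odot> Q (g u) = Q (g u') \<odot> P [k]"
proof -
  \<comment> \<open>At first only the word is known, not the letter \<open>l\<close>; the second part is used to identify it.\<close>
  have slide: "\<exists>l. P [i] \<odot> Q (g u) = Q (g u') \<odot> P [l] \<and>
      (\<forall>t p q. length t = a \<and> length p = b \<and> P [k] \<odot> Q (g t) = Q p \<odot> P [q] \<longrightarrow> l # t = h p @ [q])"
    if u: "length u = a" "length u' = a" "i # u = u' @ [k]" for i u u' k
  proof -
    obtain v l where v: "length v = b" "P [i] \<odot> Q (g u) = Q v \<odot> P [l]"
      using move g u by metis
    have iu: "P [i] \<odot> P u = P u' \<odot> P [k]"
      using u(3) P_append[of "[i]" u] P_append[of u' "[k]"] by simp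
    have main: "v = g u' \<and> l # t = h p @ [q]"
      if t: "length t = a" "length p = b" "P [k] \<odot> Q (g t) = Q p \<odot> P [q]" for t p q
    proof -
      have "Q v \<odot> (P [l] \<odot> P t) = (P [i] \<odot> Q (g u)) \<odot> P t"
        by (simp only: v(2) mul_assoc P Q)
      also have "\<dots> = P [i] \<odot> (Q (g u) \<odot> P (h (g t)))"
        by (simp only: mul_assoc P Q g(2)[OF t(1)])
      also have "\<dots> = P [i] \<odot> (P u \<odot> Q (g t))"
        by (simp only: swap[OF u(1) g(1)[OF t(1)]])
      also have "\<dots> = (P [i] \<odot> P u) \<odot> Q (g t)"
        by (simp only: mul_assoc P Q)
      also have "\<dots> = P u' \<odot> (P [k] \<odot> Q (g t))"
        by (simp only: iu mul_assoc P Q)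
      also have "\<dots> = (P u' \<odot> Q p) \<odot> P [q]"
        by (simp only: t(3) mul_assoc P Q)
      also have "\<dots> = Q (g u') \<odot> (P (h p) \<odot> P [q])"
        by (simp only: swap[OF u(2) t(2)] mul_assoc P Q)
      finally have "v = g u' \<and> P [l] \<odot> P t = P (h p) \<odot> P [q]"
        by (rule Q_cancel[rotated -1]) (simp_all add: P v g u)
      then show ?thesis
        using P_append[of "[l]" t] P_append[of "h p" "[q]"] P_inject[of "l # t" "h p @ [q]"] by simp
    qed
    obtain p q where "length p = b" "P [k] \<odot> Q (g u) = Q p \<odot> P [q]"
      using move g u by metis
    with main[OF u(1)] have "v = g u'" by blast
    with v main show ?thesis by blast
  qed
  obtain l where l: "P [i] \<odot> Q (g u) = Q (g u') \<odot> P [l]"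
    "\<And>t p q. length t = a \<Longrightarrow> length p = b \<Longrightarrow> P [k] \<odot> Q (g t) = Q p \<odot> P [q] \<Longrightarrow> l # t = h p @ [q]"
    using slide[OF u] by blast
  \<comment> \<open>Applying the first result to \<open>k\<close> and \<open>u\<close> shows that \<open>p = g w\<close> for a word \<open>w\<close> that begins with \<open>k\<close>, whence \<open>l = k\<close>.\<close>
  define w where "w = butlast (k # u)"
  have w: "length w = a" "k # u = w @ [last (k # u)]"
    by (simp_all add: w_def u del: butlast.simps last.simps)
  obtain q where "P [k] \<odot> Q (g u) = Q (g w) \<odot> P [q]"
    using slide[OF u(1) w] by blast
  then have "l # u = h (g w) @ [q]"
    using l(2) u(1) g(1)[OF w(1)] by blast
  then have "l # u = w @ [q]" using g(2)[OF w(1)] by simp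
  moreover have "w \<noteq> []" using w(1) a by auto
  ultimately have "l = k" using w(2) by (cases w) auto
  then show ?thesis using l(1) by simp
qed

lemma move_E_past_V: "\<exists>v' k. length v' = length v \<and> E [i] \<odot> V v = V v' \<odot> E [k]"
proof -
  obtain v' y where y: "y \<in> FF" "length v' = length v" "E [i] \<odot> V v = V v' \<odot> y"
    using split_V_word[of "E [i] \<odot> V v" "length v"] by (auto simp: deg_mul)
  have "deg (E [i]) + deg (V v) = deg (V v') + deg y"
    using y by (metis deg_mul E_FF V_FF)
  then have "deg y = (1, 0)" using y(2) by (simp add: prod_eq_iff)
  then show ?thesis using degree_E[OF y(1)] y by (auto simp: length_Suc_conv)
qed

lemma move_V_past_E: "\<exists>u' k. length u' = length u \<and> V [j] \<odot> E u = E u' \<odot> V [k]"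
proof -
  obtain u' y where y: "y \<in> FF" "length u' = length u" "V [j] \<odot> E u = E u' \<odot> y"
    using split_E_word[of "V [j] \<odot> E u" "length u"] by (auto simp: deg_mul)
  have "deg (V [j]) + deg (E u) = deg (E u') + deg y"
    using y by (metis deg_mul E_FF V_FF)
  then have "deg y = (0, 1)" using y(2) by (simp add: prod_eq_iff)
  then show ?thesis using degree_V[OF y(1)] y by (auto simp: length_Suc_conv)
qed

end

locale periodic_tail = tail_space \<theta> \<tau>
  for \<theta> :: "('m::finite, 'n::finite) perm" and \<tau> +
  fixes a b :: nat and \<gamma> :: "'m list \<Rightarrow> 'n list"
  assumes ab: "a > 0" "b > 0" and gamma: "period_bijection \<theta> a b \<gamma>"
begin

definition \<delta> :: "'n list \<Rightarrow> 'm list" where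
  "\<delta> = inv_into {u. length u = a} \<gamma>"

lemma length_gamma: "length u = a \<Longrightarrow> length (\<gamma> u) = b"
  and length_delta: "length v = b \<Longrightarrow> length (\<delta> v) = a"
  and delta_gamma: "length u = a \<Longrightarrow> \<delta> (\<gamma> u) = u"
  and gamma_delta: "length v = b \<Longrightarrow> \<gamma> (\<delta> v) = v"
  and swap_gamma: "length u = a \<Longrightarrow> length v = b \<Longrightarrow> E u \<odot> V v = V (\<gamma> u) \<odot> E (\<delta> v)"
proof -
  have bij: "bij_betw \<gamma> {u. length u = a} {v. length v = b}"
    using gamma by (simp add: period_bijection_def)
  show "length u = a \<Longrightarrow> length (\<gamma> u) = b"
    using bij_betwE[OF bij] by simp
  show "length v = b \<Longrightarrow> length (\<delta> v) = a"
    using bij_betwE[OF bij_betw_inv_into[OF bij]] by (simp add: \<delta>_def)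
  show "length u = a \<Longrightarrow> \<delta> (\<gamma> u) = u"
    using bij_betw_inv_into_left[OF bij] by (simp add: \<delta>_def)
  show "length v = b \<Longrightarrow> \<gamma> (\<delta> v) = v"
    using bij_betw_inv_into_right[OF bij] by (simp add: \<delta>_def)
  show "length u = a \<Longrightarrow> length v = b \<Longrightarrow> E u \<odot> V v = V (\<gamma> u) \<odot> E (\<delta> v)"
    using gamma by (simp add: period_bijection_def \<delta>_def)
qed

lemma slide_E:
  assumes "length u = a" "length u' = a" "i # u = u' @ [k]"
  shows "E [i] \<odot> V (\<gamma> u) = V (\<gamma> u') \<odot> E [k]"
  by (rule period_slide[where P = E and Q = V and h = \<delta>, OF E_FF V_FF E_append E_inject V_word_cancel
        move_E_past_V length_gamma delta_gamma length_delta gamma_delta swap_gamma ab(1) assms])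

lemma swap_delta: "length v = b \<Longrightarrow> length u = a \<Longrightarrow> V v \<odot> E u = E (\<delta> v) \<odot> V (\<gamma> u)"
  using swap_gamma[of "\<delta> v" "\<gamma> u"]
  by (simp add: length_gamma length_delta delta_gamma gamma_delta)

lemma slide_V:
  assumes "length v = b" "length v' = b" "j # v = v' @ [k]"
  shows "V [j] \<odot> E (\<delta> v) = E (\<delta> v') \<odot> V [k]"
  by (rule period_slide[where P = V and Q = E and h = \<gamma>, OF V_FF E_FF V_append V_inject E_word_cancel
        move_V_past_E length_delta gamma_delta length_gamma delta_gamma swap_delta ab(2) assms])

abbreviation ac :: "('m, 'n) sem \<Rightarrow> ('m, 'n) gpoint \<Rightarrow> ('m, 'n) gpoint" where "ac \<equiv> act \<theta> \<tau>"

text \<open>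
  The permutation of the points by which \<open>W\<close> acts on the basis.
\<close>

definition twist :: "('m, 'n) gpoint \<Rightarrow> ('m, 'n) gpoint" where
  "twist x = (THE z. \<exists>u y. length u = a \<and> y \<in> G \<and> x = ac (E u) y \<and> z = ac (V (\<gamma> u)) y)"

lemma twist_eq:
  assumes "length u = a" "y \<in> G"
  shows "twist (ac (E u) y) = ac (V (\<gamma> u)) y"
  unfolding twist_def
proof (rule the_equality)
  fix z assume "\<exists>u' y'. length u' = a \<and> y' \<in> G \<and> ac (E u) y = ac (E u') y' \<and> z = ac (V (\<gamma> u')) y'"
  then obtain u' y' where z: "length u' = a" "y' \<in> G" "ac (E u) y = ac (E u') y'" "z = ac (V (\<gamma> u')) y'"
    by blast
  then have "E u = E u'" "y = y'"
    using act_unique[OF E_FF E_FF assms(2) z(2) _ z(3)] assms by simp_all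
  then show "z = ac (V (\<gamma> u)) y" using z E_inject by blast
qed (use assms in blast)

lemma E_prefix: "x \<in> G \<Longrightarrow> \<exists>u. \<exists>y\<in>G. length u = k \<and> x = ac (E u) y"
  using act_factor[of x k 0] degree_E by blast

lemma V_prefix: "x \<in> G \<Longrightarrow> \<exists>v. \<exists>y\<in>G. length v = k \<and> x = ac (V v) y"
  using act_factor[of x 0 k] degree_V by blast

lemma twist_eq': "length v = b \<Longrightarrow> y \<in> G \<Longrightarrow> twist (ac (E (\<delta> v)) y) = ac (V v) y"
  using twist_eq[of "\<delta> v" y] by (simp add: length_delta gamma_delta)

lemma twist_G: "x \<in> G \<Longrightarrow> twist x \<in> G"
  using E_prefix[of x a] twist_eq act_closed[OF V_FF] by metis

lemma twist_inj: "inj_on twist G"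
proof (rule inj_onI)
  fix x x' assume x: "x \<in> G" "x' \<in> G" and eq: "twist x = twist x'"
  obtain u y where u: "length u = a" "y \<in> G" "x = ac (E u) y" using E_prefix x by blast
  obtain u' y' where u': "length u' = a" "y' \<in> G" "x' = ac (E u') y'" using E_prefix x by blast
  have "ac (V (\<gamma> u)) y = ac (V (\<gamma> u')) y'"
    using eq u u' by (simp add: twist_eq)
  then have "V (\<gamma> u) = V (\<gamma> u')" "y = y'"
    using act_unique[OF V_FF V_FF u(2) u'(2), of "\<gamma> u" "\<gamma> u'"] u(1) u'(1)
    by (simp_all add: length_gamma)
  then have "u = u'" using V_inject delta_gamma u u' by metis
  with \<open>y = y'\<close> u u' show "x = x'" by simp
qed

lemma twist_surj: "x \<in> G \<Longrightarrow> \<exists>y\<in>G. x = twist y"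
  using V_prefix[of x b] twist_eq' act_closed E_FF by metis

lemma height_twist:
  assumes "x \<in> G"
  shows "height (twist x) = height x + (- int a, int b)"
proof -
  obtain u y where "length u = a" "y \<in> G" "x = ac (E u) y" using E_prefix assms by blast
  then show ?thesis by (simp add: twist_eq height_act length_gamma prod_eq_iff)
qed

text \<open>
  If \<open>x = e\<^sub>u y\<close> and \<open>iu = u'k\<close>, then the prefix that \<open>twist\<close> replaces in \<open>e\<^sub>i x\<close> is \<open>e\<^bsub>u'\<^esub>\<close>, and \<open>slide_E\<close> moves the
  letter \<open>e\<^sub>i\<close> back to the front.
\<close>

lemma twist_E:
  assumes "x \<in> G"
  shows "twist (ac (E [i]) x) = ac (E [i]) (twist x)"
proof -
  obtain u y where u: "length u = a" "y \<in> G" "x = ac (E u) y" using E_prefix assms by blast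
  define u' where "u' = butlast (i # u)"
  define k where "k = last (i # u)"
  have u': "length u' = a" "i # u = u' @ [k]"
    by (simp_all add: u'_def k_def u del: butlast.simps last.simps)
  have "ac (E [i]) x = ac (E (i # u)) y"
    using u E_append[of "[i]" u] by (simp add: act_mul)
  also have "\<dots> = ac (E u') (ac (E [k]) y)"
    using u u' E_append[of u' "[k]"] by (simp add: act_mul)
  finally have "twist (ac (E [i]) x) = ac (V (\<gamma> u')) (ac (E [k]) y)"
    using u u' by (simp add: twist_eq act_closed)
  also have "\<dots> = ac (V (\<gamma> u') \<odot> E [k]) y"
    using u by (simp add: act_mul)
  also have "\<dots> = ac (E [i]) (ac (V (\<gamma> u)) y)"
    using u slide_E[OF u(1) u'] by (simp add: act_mul[symmetric])
  also have "ac (V (\<gamma> u)) y = twist x"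
    using u by (simp add: twist_eq)
  finally show ?thesis .
qed

text \<open>
  The same computation as for the generators \<open>e\<^sub>i\<close>, with \<open>twist\<close> read as \<open>e\<^bsub>\<gamma>\<^sup>-\<^sup>1 v\<^esub> y \<mapsto> f\<^sub>v y\<close>.
\<close>

lemma twist_V:
  assumes "x \<in> G"
  shows "twist (ac (V [j]) x) = ac (V [j]) (twist x)"
proof -
  obtain u y where u: "length u = a" "y \<in> G" "x = ac (E u) y" using E_prefix assms by blast
  define v where "v = \<gamma> u"
  have v: "length v = b" "u = \<delta> v"
    using u by (simp_all add: v_def length_gamma delta_gamma)
  define v' where "v' = butlast (j # v)"
  define k where "k = last (j # v)"
  have v': "length v' = b" "j # v = v' @ [k]"
    by (simp_all add: v'_def k_def v del: butlast.simps last.simps)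
  have "ac (V [j]) x = ac (V [j] \<odot> E (\<delta> v)) y"
    using u v by (simp add: act_mul)
  also have "\<dots> = ac (E (\<delta> v')) (ac (V [k]) y)"
    using u slide_V[OF v(1) v'] by (simp add: act_mul)
  finally have "twist (ac (V [j]) x) = ac (V v') (ac (V [k]) y)"
    using u v' by (simp add: twist_eq' act_closed)
  also have "\<dots> = ac (V (j # v)) y"
    using u v' V_append[of v' "[k]"] by (simp add: act_mul)
  also have "\<dots> = ac (V [j]) (ac (V v) y)"
    using u V_append[of "[j]" v] by (simp add: act_mul)
  also have "ac (V v) y = twist x"
    using u by (simp add: twist_eq v_def)
  finally show ?thesis .
qed

lemma twist_act:
  assumes "w \<in> FF" "x \<in> G"
  shows "twist (ac w x) = ac w (twist x)"
proof -
  have "twist (ac (cls \<theta> z) x) = ac (cls \<theta> z) (twist x)" for z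
  proof (induction z)
    case Nil
    then show ?case using assms act_unit by (simp add: unit_cls[symmetric] twist_G)
  next
    case (Cons g z)
    have G: "ac (cls \<theta> z) x \<in> G" using assms by (simp add: act_closed)
    show ?case
    proof (cases g)
      case (GenE i)
      have e: "cls \<theta> (g # z) = E [i] \<odot> cls \<theta> z"
        by (simp add: GenE eword_def mult_cls)
      show ?thesis
        unfolding e using assms(2) Cons.IH twist_E[OF G] by (simp add: act_mul twist_G)
    next
      case (GenF j)
      have e: "cls \<theta> (g # z) = V [j] \<odot> cls \<theta> z"
        by (simp add: GenF fword_def mult_cls)
      show ?thesis
        unfolding e using assms(2) Cons.IH twist_V[OF G] by (simp add: act_mul twist_G)
    qed
  qed
  then show ?thesis using FF_E assms(1) by blast
qed

lemma pow_G: "x \<in> G \<Longrightarrow> (twist ^^ n) x \<in> G"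
  by (induction n) (simp_all add: twist_G)

lemma pow_inject: "x \<in> G \<Longrightarrow> y \<in> G \<Longrightarrow> (twist ^^ n) x = (twist ^^ n) y \<Longrightarrow> x = y"
  by (induction n) (auto dest: inj_onD[OF twist_inj] simp: pow_G)

lemma pow_surj: "x \<in> G \<Longrightarrow> \<exists>y\<in>G. x = (twist ^^ n) y"
proof (induction n arbitrary: x)
  case (Suc n)
  then obtain y z where "y \<in> G" "x = twist y" "z \<in> G" "y = (twist ^^ n) z"
    using twist_surj by metis
  then show ?case by (intro bexI[of _ z]) simp_all
qed auto

lemma pow_act: "w \<in> FF \<Longrightarrow> x \<in> G \<Longrightarrow> (twist ^^ n) (ac w x) = ac w ((twist ^^ n) x)"
  by (induction n) (simp_all add: twist_act pow_G)

lemma height_pow: "x \<in> G \<Longrightarrow> height ((twist ^^ n) x) = height x + (- (int n * int a), int n * int b)"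
  by (induction n) (simp_all add: height_twist pow_G prod_eq_iff algebra_simps)

text \<open>
  For \<open>x = e\<^sub>u y\<close> with \<open>u\<close> of length \<open>a\<close>, only the summand of \<open>W\<close> that belongs to \<open>u\<close> does not kill the basis vector of \<open>x\<close>.
\<close>

lemma W_op: "rep_ext (lambda_tau \<theta> \<tau>) (Wunitary \<theta> a \<gamma>) = push_op G twist"
proof -
  have fin: "finite {u :: 'm list. length u = a}"
    using finite_lists_length_eq[of "UNIV :: 'm set" a] by simp
  have "rep_ext (lambda_tau \<theta> \<tau>) (Wunitary \<theta> a \<gamma>) =
      (\<Sum>u\<in>{u. length u = a}. shift (V (\<gamma> u)) o\<^sub>L coshift (E u))"
    unfolding rep_ext_def Wunitary_def ugen_def lambda_tau_def
    by (simp add: star_rep_act basis_op_shift adj_shift)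
  also have "\<dots> = push_op G twist"
  proof (rule ops_on_eqI)
    show "(\<Sum>u\<in>{u. length u = a}. shift (V (\<gamma> u)) o\<^sub>L coshift (E u)) \<in> ops_on G"
      by (rule sum_ops) (simp add: comp_ops shift_ops coshift_ops)
    show "push_op G twist \<in> ops_on G"
      by (rule push_op_ops[OF twist_inj]) (use twist_G in blast)
    fix x assume "x \<in> G"
    then obtain u y where u: "length u = a" "y \<in> G" "x = ac (E u) y" using E_prefix by blast
    have "blinfun_apply (shift (V (\<gamma> u')) o\<^sub>L coshift (E u')) (ket x) =
        (if u' = u then ket (twist x) else 0)" if "length u' = a" for u'
    proof (cases "u' = u")
      case True
      then show ?thesis using u by (simp add: coshift_ket shift_ket twist_eq)
    next
      case False
      then have "E u' \<noteq> E u" using E_inject by blast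
      then have "x \<notin> ac (E u') ` G"
        using ranges_disjoint[OF E_FF E_FF, of u' u] u that by auto
      then show ?thesis using False by (simp add: coshift_ket_outside blinfun.zero_right)
    qed
    then have "blinfun_apply (\<Sum>u\<in>{u. length u = a}. shift (V (\<gamma> u)) o\<^sub>L coshift (E u)) (ket x) =
        (\<Sum>u'\<in>{u. length u = a}. if u' = u then ket (twist x) else 0)"
      unfolding blinfun.sum_left by (intro sum.cong) auto
    also have "\<dots> = ket (twist x)"
      using u fin by simp
    finally show "blinfun_apply (\<Sum>u\<in>{u. length u = a}. shift (V (\<gamma> u)) o\<^sub>L coshift (E u)) (ket x) =
        blinfun_apply (push_op G twist) (ket x)"
      by (simp add: push_op_ket[OF twist_inj \<open>x \<in> G\<close>])
  qed
  finally show ?thesis .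
qed

abbreviation orb :: "('m, 'n) gpoint \<Rightarrow> ('m, 'n) gpoint set" where
  "orb x \<equiv> orbrel \<theta> a \<gamma> \<tau> `` {x}"

text \<open>
  The two exponents avoid negative powers of \<open>twist\<close>, and make the relation visibly symmetric.
\<close>

lemma orbrel_iff: "(x, y) \<in> orbrel \<theta> a \<gamma> \<tau> \<longleftrightarrow>
    x \<in> G \<and> y \<in> G \<and> (\<exists>m n. (twist ^^ m) x = (twist ^^ n) y)"
proof -
  have push: "(blinfun_apply (push_op G twist) ^^ n) (ket x) = ket ((twist ^^ n) x)" if "x \<in> G" for n x
    by (induction n) (simp_all add: that push_op_ket[OF twist_inj] pow_G)
  have pull: "(blinfun_apply (pull_op G twist) ^^ n) (ket ((twist ^^ n) x)) = ket x" if "x \<in> G" for n x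
  proof (induction n)
    case (Suc n)
    have "(blinfun_apply (pull_op G twist) ^^ Suc n) (ket ((twist ^^ Suc n) x)) =
        (blinfun_apply (pull_op G twist) ^^ n) (blinfun_apply (pull_op G twist) (ket (twist ((twist ^^ n) x))))"
      by (simp only: funpow.simps(2)[of _ twist] funpow_Suc_right[of _ "blinfun_apply (pull_op G twist)"] comp_apply)
    then show ?case
      using Suc pow_G[OF that] by (simp only: pull_op_ket[OF twist_inj])
  qed simp
  have adj: "adj (push_op G twist) = pull_op G twist"
    by (rule adj_eqI[OF adjoint_pair_push_pull[OF twist_inj]])
  have "(\<exists>k. unitary_power (push_op G twist) k (ket x) = ket y) \<longleftrightarrow>
      (\<exists>m n. (twist ^^ m) x = (twist ^^ n) y)" if x: "x \<in> G" "y \<in> G"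
  proof
    assume "\<exists>k. unitary_power (push_op G twist) k (ket x) = ket y"
    then obtain k where k: "unitary_power (push_op G twist) k (ket x) = ket y" by blast
    show "\<exists>m n. (twist ^^ m) x = (twist ^^ n) y"
    proof (cases "k \<ge> 0")
      case True
      with k have "(twist ^^ nat k) x = (twist ^^ 0) y"
        by (simp add: unitary_power_def push x ket_inject)
      then show ?thesis by blast
    next
      case False
      obtain z where z: "z \<in> G" "x = (twist ^^ nat (- k)) z" using pow_surj x by blast
      with k False have "z = y"
        by (simp add: unitary_power_def adj pull ket_inject)
      with z have "(twist ^^ 0) x = (twist ^^ nat (- k)) y" by simp
      then show ?thesis by blast
    qed
  next
    assume "\<exists>m n. (twist ^^ m) x = (twist ^^ n) y"
    then obtain m n where mn: "(twist ^^ m) x = (twist ^^ n) y" by blast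
    show "\<exists>k. unitary_power (push_op G twist) k (ket x) = ket y"
    proof (cases "n \<le> m")
      case True
      have "(twist ^^ n) ((twist ^^ (m - n)) x) = (twist ^^ n) y"
        using mn True by (metis funpow_add comp_apply le_add_diff_inverse)
      then have "(twist ^^ (m - n)) x = y"
        using pow_inject[of "(twist ^^ (m - n)) x" y n] x by (simp add: pow_G)
      then have "unitary_power (push_op G twist) (int (m - n)) (ket x) = ket y"
        by (simp add: unitary_power_def push x)
      then show ?thesis by blast
    next
      case False
      have "(twist ^^ m) ((twist ^^ (n - m)) y) = (twist ^^ m) x"
        using mn False by (metis funpow_add comp_apply le_add_diff_inverse nat_le_linear)
      then have "x = (twist ^^ (n - m)) y"
        using pow_inject[of "(twist ^^ (n - m)) y" x m] x by (simp add: pow_G)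
      then have "unitary_power (push_op G twist) (- int (n - m)) (ket x) = ket y"
        using False x by (simp add: unitary_power_def adj pull del: of_nat_diff)
      then show ?thesis by blast
    qed
  qed
  then show ?thesis
    unfolding orbrel_def W_op by blast
qed

lemma equiv_orbrel: "equiv G (orbrel \<theta> a \<gamma> \<tau>)"
proof (rule equivI)
  show "orbrel \<theta> a \<gamma> \<tau> \<subseteq> G \<times> G" by (auto simp: orbrel_def)
  show "refl_on G (orbrel \<theta> a \<gamma> \<tau>)" by (auto simp: refl_on_def orbrel_iff)
  show "sym (orbrel \<theta> a \<gamma> \<tau>)" by (rule symI) (metis orbrel_iff)
  show "trans (orbrel \<theta> a \<gamma> \<tau>)"
  proof (rule transI)
    fix x y z assume xy: "(x, y) \<in> orbrel \<theta> a \<gamma> \<tau>" and yz: "(y, z) \<in> orbrel \<theta> a \<gamma> \<tau>"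
    obtain m n where mn: "(twist ^^ m) x = (twist ^^ n) y" using xy orbrel_iff by blast
    obtain m' n' where mn': "(twist ^^ m') y = (twist ^^ n') z" using yz orbrel_iff by blast
    have "(twist ^^ (m' + m)) x = (twist ^^ m') ((twist ^^ n) y)"
      by (simp add: funpow_add mn)
    also have "\<dots> = (twist ^^ n) ((twist ^^ m') y)"
      by (metis funpow_add comp_apply add.commute)
    also have "\<dots> = (twist ^^ (n + n')) z"
      by (simp add: funpow_add mn')
    finally show "(x, z) \<in> orbrel \<theta> a \<gamma> \<tau>"
      using xy yz orbrel_iff by blast
  qed
qed

lemma orb_eq_iff: "x \<in> G \<Longrightarrow> y \<in> G \<Longrightarrow> orb x = orb y \<longleftrightarrow> (\<exists>m n. (twist ^^ m) x = (twist ^^ n) y)"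
  using eq_equiv_class_iff[OF equiv_orbrel, of x y] by (simp add: orbrel_iff)

abbreviation \<Omega> :: "('m, 'n) gpoint set set" where "\<Omega> \<equiv> orbits \<theta> a \<gamma> \<tau>"

lemma orb_Omega [simp]: "x \<in> G \<Longrightarrow> orb x \<in> \<Omega>"
  unfolding orbits_def by (rule quotientI)

lemma Omega_orb: "X \<in> \<Omega> \<Longrightarrow> \<exists>x\<in>G. X = orb x"
  by (auto simp: orbits_def quotient_def)

lemma orbit_act_orb:
  assumes "w \<in> FF" "x \<in> G"
  shows "orbit_act \<theta> a \<gamma> \<tau> w (orb x) = orb (ac w x)"
proof -
  have "orb (ac w y) = orb (ac w x)" if "y \<in> orb x" for y
  proof -
    obtain m n where y: "y \<in> G" "(twist ^^ m) x = (twist ^^ n) y"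
      using \<open>y \<in> orb x\<close> by (auto simp: orbrel_iff)
    then have "(twist ^^ n) (ac w y) = (twist ^^ m) (ac w x)"
      using assms by (simp add: pow_act)
    then show ?thesis
      using orb_eq_iff[of "ac w y" "ac w x"] assms y act_closed by blast
  qed
  then have "orbit_act \<theta> a \<gamma> \<tau> w (orb x) = (\<Union>y\<in>orb x. orb (ac w x))"
    unfolding orbit_act_def by (intro SUP_cong) auto
  moreover have "x \<in> orb x"
    using equiv_class_self[OF equiv_orbrel assms(2)] .
  ultimately show ?thesis by auto
qed

lemma orb_factor_unique:
  assumes v: "v \<in> FF" "w \<in> FF" and x: "x \<in> G" "y \<in> G" and d: "deg v = deg w"
    and eq: "orb (ac v x) = orb (ac w y)"
  shows "v = w \<and> orb x = orb y"
proof -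
  obtain m n where "(twist ^^ m) (ac v x) = (twist ^^ n) (ac w y)"
    using eq orb_eq_iff v x act_closed by blast
  then have "ac v ((twist ^^ m) x) = ac w ((twist ^^ n) y)"
    using v x by (simp add: pow_act)
  then have "v = w" "(twist ^^ m) x = (twist ^^ n) y"
    using act_unique[of v w "(twist ^^ m) x" "(twist ^^ n) y"] v x d pow_G by blast+
  then show ?thesis using orb_eq_iff x by blast
qed

text \<open>
  A prefix \<open>e\<^sub>u\<close> of \<open>w\<close> with \<open>u\<close> of length \<open>a\<close> is replaced by \<open>f\<^bsub>\<gamma> u\<^esub>\<close>, so \<open>twist\<close> only changes \<open>w\<close>. Every step uses up
  \<open>a\<close> letters \<open>e\<close>, which explains the condition on the degree.
\<close>

lemma twist_pow_absorbed:
  assumes "w \<in> FF" "n * a \<le> fst (deg w)"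
  shows "\<exists>w'\<in>FF. \<forall>z\<in>G. (twist ^^ n) (ac w z) = ac w' z"
  using assms
proof (induction n arbitrary: w)
  case (Suc n)
  obtain u y where u: "y \<in> FF" "length u = a" "w = E u \<odot> y"
    using split_E_word[of w a] Suc.prems by auto
  have "n * a \<le> fst (deg (V (\<gamma> u) \<odot> y))"
    using Suc.prems u by (simp add: deg_mul)
  then obtain w' where w': "w' \<in> FF" "\<And>z. z \<in> G \<Longrightarrow> (twist ^^ n) (ac (V (\<gamma> u) \<odot> y) z) = ac w' z"
    using Suc.IH[of "V (\<gamma> u) \<odot> y"] u by auto
  have "(twist ^^ Suc n) (ac w z) = ac w' z" if z: "z \<in> G" for z
  proof -
    have "twist (ac w z) = ac (V (\<gamma> u) \<odot> y) z"
      using u z by (simp add: act_mul twist_eq act_closed)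
    then show ?thesis using w'(2)[OF z] by (simp add: funpow_swap1)
  qed
  with w' show ?case by blast
qed (auto intro: bexI[of _ w])

text \<open>
  Comparing heights at the point \<open>y\<close> shows that \<open>w\<close> has enough letters \<open>e\<close> for all \<open>n\<close> twists to be absorbed
  into some \<open>w'\<close>. Then \<open>v\<close> and \<open>w'\<close> have the same degree and map \<open>y\<close> to the same point, so they are equal.
\<close>

lemma effective_pow:
  assumes v: "v \<in> FF" "w \<in> FF" and y: "y \<in> G" and eq: "ac v y = (twist ^^ n) (ac w y)" and z: "z \<in> G"
  shows "ac v z = (twist ^^ n) (ac w z)"
proof -
  have "height (ac v y) = height (ac w y) + (- (int n * int a), int n * int b)"
    using eq v y height_pow act_closed by simp
  then have "int (fst (deg v)) = int (fst (deg w)) - int n * int a"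
    using v y by (simp add: height_act prod_eq_iff)
  then have "int (n * a) \<le> int (fst (deg w))" by simp
  then have "n * a \<le> fst (deg w)" by (simp only: of_nat_le_iff)
  then obtain w' where w': "w' \<in> FF" "\<And>z. z \<in> G \<Longrightarrow> (twist ^^ n) (ac w z) = ac w' z"
    using twist_pow_absorbed v by blast
  have eq': "ac v y = ac w' y" using eq w' y by simp
  then have "height (ac v y) = height (ac w' y)" by simp
  then have "deg v = deg w'" using v y w' by (simp add: height_act prod_eq_iff)
  then have "v = w'" using act_unique[OF v(1) w'(1) y y _ eq'] by blast
  with w' z show ?thesis by simp
qed

text \<open>
  The heights of alike points differ by a multiple of \<open>(a, -b)\<close>. A power of \<open>twist\<close>, which commutes with the
  action and so does not change the word that is spelled, makes them equal, and alike points of equal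
  height coincide.
\<close>

lemma alike_orb:
  assumes H: "H_tail \<theta> \<tau> \<subseteq> range (\<lambda>k::int. (k * int a, - (k * int b)))"
    and x: "x \<in> G" "y \<in> G" and al: "alike x y"
  shows "orb x = orb y"
proof -
  obtain s g h where g: "g \<in> FF" "h \<in> FF" "x = io s g" "y = io s h"
    using G_io2[OF x] by blast
  obtain k :: int where k: "int (fst (deg h)) - int (fst (deg g)) = k * int a"
      "int (snd (deg h)) - int (snd (deg g)) = - (k * int b)"
    using alike_period[OF g(1,2), of s] al H g(3,4) by blast
  then have ht: "height y = height x + (k * int a, - (k * int b))"
    using g by (simp add: height_io prod_eq_iff)
  show ?thesis
  proof (cases "k \<ge> 0")
    case True
    let ?z = "(twist ^^ nat k) y"
    have "alike x ?z"
      unfolding alike_def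
    proof (intro allI)
      fix k' l'
      obtain w x' y' where "w \<in> FF" "x' \<in> G" "y' \<in> G" "deg w = (k', l')" "x = ac w x'" "y = ac w y'"
        using al unfolding alike_def by blast
      then show "\<exists>w\<in>FF. \<exists>x'\<in>G. \<exists>y'\<in>G. deg w = (k', l') \<and> x = ac w x' \<and> ?z = ac w y'"
        using pow_act pow_G by blast
    qed
    moreover have "height x = height ?z"
      using ht True x by (simp add: height_pow prod_eq_iff)
    ultimately have "(twist ^^ 0) x = ?z"
      using alike_same_height[of x ?z] x pow_G by simp
    then show ?thesis using orb_eq_iff x by blast
  next
    case False
    let ?z = "(twist ^^ nat (- k)) x"
    have "alike ?z y"
      unfolding alike_def
    proof (intro allI)
      fix k' l'
      obtain w x' y' where "w \<in> FF" "x' \<in> G" "y' \<in> G" "deg w = (k', l')" "x = ac w x'" "y = ac w y'"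
        using al unfolding alike_def by blast
      then show "\<exists>w\<in>FF. \<exists>x'\<in>G. \<exists>y'\<in>G. deg w = (k', l') \<and> ?z = ac w x' \<and> y = ac w y'"
        using pow_act pow_G by blast
    qed
    moreover have "height ?z = height y"
      using ht False x by (simp add: height_pow prod_eq_iff)
    ultimately have "?z = (twist ^^ 0) y"
      using alike_same_height[of ?z y] x pow_G by simp
    then show ?thesis using orb_eq_iff x by blast
  qed
qed

lemma orbit_action:
  assumes H: "H_tail \<theta> \<tau> \<subseteq> range (\<lambda>k::int. (k * int a, - (k * int b)))"
  shows "aperiodic_action \<theta> \<Omega> (orbit_act \<theta> a \<gamma> \<tau>)"
proof
  fix w X assume w: "w \<in> FF" and X: "X \<in> \<Omega>"
  then obtain x where "x \<in> G" "X = orb x" using Omega_orb by blast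
  then show "orbit_act \<theta> a \<gamma> \<tau> w X \<in> \<Omega>"
    using w by (simp add: orbit_act_orb act_closed)
next
  fix X assume "X \<in> \<Omega>"
  then obtain x where x: "x \<in> G" "X = orb x" using Omega_orb by blast
  then show "orbit_act \<theta> a \<gamma> \<tau> unit X = X"
    by (simp add: orbit_act_orb act_unit)
  fix k l
  obtain w y where "w \<in> FF" "y \<in> G" "deg w = (k, l)" "x = ac w y"
    using act_factor[OF x(1)] by blast
  then show "\<exists>w\<in>FF. \<exists>Y\<in>\<Omega>. deg w = (k, l) \<and> X = orbit_act \<theta> a \<gamma> \<tau> w Y"
    using x by (intro bexI[of _ w] bexI[of _ "orb y"]) (simp_all add: orbit_act_orb)
next
  fix v w X assume v: "v \<in> FF" and w: "w \<in> FF" and X: "X \<in> \<Omega>"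
  then obtain x where "x \<in> G" "X = orb x" using Omega_orb by blast
  then show "orbit_act \<theta> a \<gamma> \<tau> (v \<odot> w) X = orbit_act \<theta> a \<gamma> \<tau> v (orbit_act \<theta> a \<gamma> \<tau> w X)"
    using v w by (simp add: orbit_act_orb act_mul act_closed)
next
  fix v w X Y assume v: "v \<in> FF" "w \<in> FF" and X: "X \<in> \<Omega>" "Y \<in> \<Omega>" and d: "deg v = deg w"
    and eq: "orbit_act \<theta> a \<gamma> \<tau> v X = orbit_act \<theta> a \<gamma> \<tau> w Y"
  obtain x where x: "x \<in> G" "X = orb x" using X Omega_orb by blast
  obtain y where y: "y \<in> G" "Y = orb y" using X Omega_orb by blast
  have "orb (ac v x) = orb (ac w y)"
    using eq x y v by (simp only: orbit_act_orb)
  then show "v = w \<and> X = Y"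
    using orb_factor_unique[OF v x(1) y(1) d] x y by blast
next
  have "io 0 unit \<in> G" by simp
  then show "\<Omega> \<noteq> {}" using orb_Omega by blast
next
  fix X Y assume X: "X \<in> \<Omega>" "Y \<in> \<Omega>"
    and prefix: "\<And>k l. \<exists>w\<in>FF. \<exists>X'\<in>\<Omega>. \<exists>Y'\<in>\<Omega>. deg w = (k, l) \<and>
      X = orbit_act \<theta> a \<gamma> \<tau> w X' \<and> Y = orbit_act \<theta> a \<gamma> \<tau> w Y'"
  obtain x where x: "x \<in> G" "X = orb x" using X Omega_orb by blast
  obtain y where y: "y \<in> G" "Y = orb y" using X Omega_orb by blast
  have "alike x y"
    unfolding alike_def
  proof (intro allI)
    fix k l
    obtain w X' Y' where w: "w \<in> FF" "X' \<in> \<Omega>" "Y' \<in> \<Omega>" "deg w = (k, l)"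
        "X = orbit_act \<theta> a \<gamma> \<tau> w X'" "Y = orbit_act \<theta> a \<gamma> \<tau> w Y'"
      using prefix by blast
    obtain x' where x': "x' \<in> G" "X' = orb x'" using w Omega_orb by blast
    obtain y' where y': "y' \<in> G" "Y' = orb y'" using w Omega_orb by blast
    obtain p xx where p: "p \<in> FF" "xx \<in> G" "deg p = (k, l)" "x = ac p xx"
      using act_factor[OF x(1)] by blast
    obtain q yy where q: "q \<in> FF" "yy \<in> G" "deg q = (k, l)" "y = ac q yy"
      using act_factor[OF y(1)] by blast
    have "orb (ac p xx) = orb (ac w x')"
      using x p w x' orbit_act_orb by simp
    then have "p = w" using orb_factor_unique[OF p(1) w(1) p(2) x'(1)] p w by simp
    have "orb (ac q yy) = orb (ac w y')"
      using y q w y' orbit_act_orb by simp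
    then have "q = w" using orb_factor_unique[OF q(1) w(1) q(2) y'(1)] q w by simp
    with \<open>p = w\<close> p q show "\<exists>w\<in>FF. \<exists>x'\<in>G. \<exists>y'\<in>G. deg w = (k, l) \<and> x = ac w x' \<and> y = ac w y'"
      by blast
  qed
  then show "X = Y" using alike_orb[OF H x(1) y(1)] x y by simp
next
  fix v w Y Z assume v: "v \<in> FF" "w \<in> FF" and Y: "Y \<in> \<Omega>"
    and eq: "orbit_act \<theta> a \<gamma> \<tau> v Y = orbit_act \<theta> a \<gamma> \<tau> w Y" and Z: "Z \<in> \<Omega>"
  obtain y where y: "y \<in> G" "Y = orb y" using Y Omega_orb by blast
  obtain z where z: "z \<in> G" "Z = orb z" using Z Omega_orb by blast
  have "orb (ac v y) = orb (ac w y)"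
    using eq y v by (simp only: orbit_act_orb)
  then obtain m n where mn: "(twist ^^ m) (ac v y) = (twist ^^ n) (ac w y)"
    using orb_eq_iff v y act_closed by blast
  have "\<exists>m n. (twist ^^ m) (ac v z) = (twist ^^ n) (ac w z)"
  proof (cases "m \<le> n")
    case True
    have "(twist ^^ m) (ac v y) = (twist ^^ m) ((twist ^^ (n - m)) (ac w y))"
      using mn True by (metis funpow_add comp_apply le_add_diff_inverse)
    then have "ac v y = (twist ^^ (n - m)) (ac w y)"
      by (rule pow_inject[rotated -1]) (simp_all add: v y act_closed pow_G)
    from effective_pow[OF v y(1) this z(1)]
    have "(twist ^^ 0) (ac v z) = (twist ^^ (n - m)) (ac w z)" by simp
    then show ?thesis by blast
  next
    case False
    have "(twist ^^ n) (ac w y) = (twist ^^ n) ((twist ^^ (m - n)) (ac v y))"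
      using mn False by (metis funpow_add comp_apply le_add_diff_inverse nat_le_linear)
    then have "ac w y = (twist ^^ (m - n)) (ac v y)"
      by (rule pow_inject[rotated -1]) (simp_all add: v y act_closed pow_G)
    from effective_pow[OF v(2,1) y(1) this z(1)]
    have "(twist ^^ (m - n)) (ac v z) = (twist ^^ 0) (ac w z)" by simp
    then show ?thesis by blast
  qed
  then have "orb (ac v z) = orb (ac w z)"
    using orb_eq_iff v z act_closed by blast
  then show "orbit_act \<theta> a \<gamma> \<tau> v Z = orbit_act \<theta> a \<gamma> \<tau> w Z"
    using z v by (simp only: orbit_act_orb)
next
  fix X Y assume X: "X \<in> \<Omega>" "Y \<in> \<Omega>"
  obtain x where x: "x \<in> G" "X = orb x" using X Omega_orb by blast
  obtain y where y: "y \<in> G" "Y = orb y" using X Omega_orb by blast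
  obtain s g h where g: "g \<in> FF" "h \<in> FF" "x = io s g" "y = io s h"
    using G_io2[OF x(1) y(1)] by blast
  have "X = orbit_act \<theta> a \<gamma> \<tau> g (orb (io s unit))" "Y = orbit_act \<theta> a \<gamma> \<tau> h (orb (io s unit))"
    using x y g by (simp_all add: orbit_act_orb act_io)
  moreover have "orb (io s unit) \<in> \<Omega>" by simp
  ultimately show "\<exists>Z\<in>\<Omega>. \<exists>g\<in>FF. \<exists>h\<in>FF. X = orbit_act \<theta> a \<gamma> \<tau> g Z \<and> Y = orbit_act \<theta> a \<gamma> \<tau> h Z"
    using g by blast
qed

end

section \<open>Simplicity of the algebra of the orbit representation\<close>

lemma star_poly_vanish:
  assumes "p \<in> star_poly \<theta>" "\<not> star_rep \<theta> \<rho>"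
  shows "p \<rho> = 0"
  using assms(1)
proof (induction rule: star_poly.induct)
  case (star c)
  then show ?case using adj_eqI[OF adjoint_pair_zero] by simp
next
  case (scale c z)
  then show ?case by (intro blinfun_eqI) (simp add: cscale_zero)
qed (simp_all add: ugen_def assms(2))

lemma star_poly_Cstar:
  assumes "p \<in> star_poly \<theta>"
  shows "p \<in> Cstar \<theta>"
  unfolding Cstar_def
  using assms star_poly_vanish[OF assms] by (auto intro!: bexI[of _ p])

theorem corollary5p10:
  fixes \<theta> :: "('m::finite, 'n::finite) perm"
    and a b :: nat
    and \<gamma> :: "'m list \<Rightarrow> 'n list"
    and \<tau> :: "('m, 'n) tail"
  assumes "CARD('m) \<ge> 2" and "CARD('n) \<ge> 2"
    and "bij \<theta>"
    and "periodic_semigroup \<theta>"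
    and "minimal_period \<theta> a b"
    and "period_bijection \<theta> a b \<gamma>"
    and "H_tail \<theta> \<tau> = range (\<lambda>k::int. (k * int a, - (k * int b)))"
  shows "simple_algebra (frakA \<theta> a \<gamma> \<tau>)"
proof -
  interpret periodic_tail \<theta> \<tau> a b \<gamma>
    using assms by unfold_locales (simp_all add: minimal_period_def)
  interpret orbit: aperiodic_action \<theta> \<Omega> "orbit_act \<theta> a \<gamma> \<tau>"
    by (rule orbit_action) (simp add: assms)
  let ?\<rho> = "sigma1 \<theta> a \<gamma> \<tau>"
  have rep: "star_rep \<theta> ?\<rho>"
    unfolding sigma1_def by (rule orbit.star_rep_act)
  have ugen: "ugen \<theta> w ?\<rho> = orbit.shift w" if "w \<in> FF" for w
    using rep that by (simp add: ugen_def sigma1_def orbit.basis_op_shift)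
  show ?thesis
  proof (rule orbit.simple_algebra_if_approximable)
    fix w assume w: "w \<in> FF"
    have "ugen \<theta> w \<in> Cstar \<theta>" "(\<lambda>\<rho>. adj (ugen \<theta> w \<rho>)) \<in> Cstar \<theta>"
      by (intro star_poly_Cstar star_poly.intros w)+
    then show "orbit.shift w \<in> frakA \<theta> a \<gamma> \<tau>" "orbit.coshift w \<in> frakA \<theta> a \<gamma> \<tau>"
      unfolding frakA_def rep_ext_def
      using ugen[OF w] orbit.adj_shift[OF w] by (metis (no_types, lifting) image_eqI)+
  next
    fix T and \<epsilon> :: real
    assume "T \<in> frakA \<theta> a \<gamma> \<tau>" "\<epsilon> > 0"
    then obtain c where c: "c \<in> Cstar \<theta>" "T = c ?\<rho>"
      by (auto simp: frakA_def rep_ext_def)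
    then obtain p where p: "p \<in> star_poly \<theta>" "norm (c ?\<rho> - p ?\<rho>) \<le> \<epsilon>"
      using \<open>\<epsilon> > 0\<close> rep unfolding Cstar_def by blast
    have "p ?\<rho> \<in> orbit.star_alg"
      using p(1)
    proof (induction rule: star_poly.induct)
      case (gen w)
      then show ?case by (simp add: ugen orbit.star_alg.gen)
    qed (auto intro: orbit.star_alg.intros)
    with p c show "\<exists>P\<in>orbit.star_alg. norm (T - P) \<le> \<epsilon>" by blast
  qed
qed

end
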